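(* One has $$Z_1(s)=\zeta^2(s),\qquad Z_2(s)=\frac{\zeta^2(s)\,\zeta^3(2s)}{\zeta(3s)},$$ and, for every integer $k\ge 3$, $$Z_k(s)=\zeta^2(s)\,\zeta^3(2s)\,\zeta^3(3s)\,G_{3,k}(s),$$ where $G_{3,k}(s)$ is a Dirichlet series without real zeroes and absolutely convergent for $\Re(s)>1/4$.
   Context: $\zeta$ is the Riemann zeta function. For a finite abelian group $G$, the number of subgroup classes of $G$ is the number of isomorphism classes of groups $H$ that are isomorphic to a subgroup of $G$. For $r\ge1$, $A_r(n)$ is the sum, over isomorphism classes of abelian groups $G$ of order $n$ and rank at most $r$ (rank = minimal number of generators), of the number of subgroup classes of $G$, and $Z_r(s)=\sum_{n=1}^\infty A_r(n)n^{-s}$. The identities hold for $\Re(s)>1$ (and then by meromorphic continuation); "without real zeroes" refers to real $s>1/4$. *)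

theory Defs
  imports "HOL-Algebra.Generated_Groups" "HOL-Complex_Analysis.Complex_Analysis"
begin

text \<open>The coefficients are indexed from 1; the value \<open>a 0\<close> is irrelevant.\<close>

definition dirichlet_series :: "(nat \<Rightarrow> complex) \<Rightarrow> complex \<Rightarrow> complex" where
  "dirichlet_series a s = suminf (\<lambda>n. a (Suc n) * of_nat (Suc n) powr (- s))"

definition dirichlet_abs_conv :: "(nat \<Rightarrow> complex) \<Rightarrow> complex \<Rightarrow> bool" where
  "dirichlet_abs_conv a s \<longleftrightarrow> summable (\<lambda>n. norm (a (Suc n) * of_nat (Suc n) powr (- s)))"

text \<open>The Dirichlet series with all coefficients 1, analytically continued to the plane without
  the pole at 1; the value at 1 itself is unspecified.\<close>

definition zeta :: "complex \<Rightarrow> complex" where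
  "zeta = (SOME f. f holomorphic_on (- {1}) \<and>
                   (\<forall>s. Re s > 1 \<longrightarrow> f s = dirichlet_series (\<lambda>_. 1) s))"

text \<open>Finite groups are represented, up to isomorphism, by groups whose elements are natural
  numbers. The isomorphism relation is restricted to \<open>S\<close> because \<open>\<cong>\<close> can relate a group to a
  record that is not a group (\<open>\<cong>\<close> does not constrain the field \<open>one\<close>).\<close>

definition iso_classes :: "nat monoid set \<Rightarrow> nat monoid set set" where
  "iso_classes S = S // {(G, H). G \<in> S \<and> H \<in> S \<and> G \<cong> H}"

definition group_rank :: "'a monoid \<Rightarrow> nat" where
  "group_rank G =
     (LEAST d. \<exists>X. X \<subseteq> carrier G \<and> finite X \<and> card X = d \<and> generate G X = carrier G)"

definition num_subgroup_classes :: "'a monoid \<Rightarrow> nat" where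
  "num_subgroup_classes G =
     card (iso_classes {H. group H \<and> (\<exists>K. subgroup K G \<and> H \<cong> G\<lparr>carrier := K\<rparr>)})"

definition abelian_groups :: "nat \<Rightarrow> nat \<Rightarrow> nat monoid set" where
  "abelian_groups r n =
     {G. comm_group G \<and> finite (carrier G) \<and> card (carrier G) = n \<and> group_rank G \<le> r}"

text \<open>Each isomorphism class contributes through an arbitrary representative.\<close>

definition A_sum :: "nat \<Rightarrow> nat \<Rightarrow> nat" where
  "A_sum r n = (\<Sum>C \<in> iso_classes (abelian_groups r n). num_subgroup_classes (SOME G. G \<in> C))"

abbreviation A_coeff :: "nat \<Rightarrow> nat \<Rightarrow> complex" where
  "A_coeff r \<equiv> (\<lambda>n. of_nat (A_sum r n))"

definition Z_series :: "nat \<Rightarrow> complex \<Rightarrow> complex" where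
  "Z_series r s = dirichlet_series (A_coeff r) s"

end

theory Submission
  imports Defs "HOL-Algebra.Multiplicative_Group" "HOL-Number_Theory.Number_Theory"
    "HOL-Real_Asymp.Real_Asymp"
begin

text \<open>A finite abelian group is determined by its chain of invariant factors \<open>d 0, d 1, \<dots>\<close> with
  \<open>d (i + 1)\<close> dividing \<open>d i\<close>; its rank is at most \<open>r\<close> iff \<open>d i = 1\<close> for \<open>i \<ge> r\<close>, and the group with
  chain \<open>e\<close> embeds into the one with chain \<open>d\<close> iff every \<open>e i\<close> divides \<open>d i\<close>. Hence \<open>A_sum r n\<close>
  counts pairs of chains and is multiplicative in \<open>n\<close>; at \<open>p ^ a\<close> it counts the pairs of partitions
  \<open>m \<le> l\<close> with \<open>l\<close> a partition of \<open>a\<close> into at most \<open>r\<close> parts. So \<open>Z_r\<close> has an Euler product whose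
  local factor \<open>C\<^sub>r\<close>, a power series in \<open>X = p powr - s\<close>, does not depend on \<open>p\<close>. One computes
  \<open>C\<^sub>1 (1 - X)\<^sup>2 = 1\<close> and \<open>C\<^sub>2 (1 - X)\<^sup>2 (1 - X\<^sup>2)\<^sup>3 = 1 - X\<^sup>3\<close>. For \<open>k \<ge> 3\<close> the series \<open>C\<^sub>k\<close> starts with
  \<open>1 + 2 X + 6 X\<^sup>2 + 13 X\<^sup>3\<close>, which makes \<open>C\<^sub>k (1 - X)\<^sup>2 (1 - X\<^sup>2)\<^sup>3 (1 - X\<^sup>3)\<^sup>3 = 1 + O(X\<^sup>4)\<close>; its Euler
  product therefore converges absolutely for \<open>Re s > 1/4\<close>, and none of its factors vanishes at a
  real \<open>s\<close> since \<open>C\<^sub>k\<close> has nonnegative coefficients. The meromorphic continuation of zeta is obtained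
  by Landau's recurrence, which expresses \<open>(s - 1) zeta s\<close> through the values of zeta at
  \<open>s + 1, s + 2, \<dots>\<close>.\<close>

subsection \<open>Finite abelian groups as products of cyclic groups\<close>

text \<open>The exponents 2, 3, 3 are forced degree by degree: 1 / (1 - X)^2 starts with 1 + 2 X + 3
  X^2 + 4 X^3, the quadratic coefficient 6 asks for three factors 1 / (1 - X^2), these raise the
  cubic coefficient to 10, and 13 asks for three factors 1 / (1 - X^3). In rank 2 the cubic
  coefficient is 9, one less than 10, whence the factor 1 - X^3 and \<open>zeta (3 * s)\<close> in
  the denominator. A local factor 1 + O(X^m) is controlled by the sum of
  \<open>p powr (- m * Re s)\<close>, which converges for \<open>m * Re s > 1\<close>; m = 4 is the
  origin of 1/4. Positivity is available only at real X, so zeros are excluded only on the real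
  axis, and absolute convergence is what passes nonvanishing from the factors to the product. The
  function \<open>zeta\<close> is chosen among the holomorphic functions on the punctured plane that
  extend the Dirichlet series, so nothing about it, not even its values for \<open>Re s > 1\<close>,
  is available before a continuation has been constructed. The identities for
  \<open>Z_series\<close> come from comparing finite products over the primes up to N factor by
  factor and passing to the limit.\<close>

definition divisor_chain :: "(nat \<Rightarrow> nat) \<Rightarrow> bool" where
  "divisor_chain d \<longleftrightarrow> d 0 > 0 \<and> (\<forall>i. d (Suc i) dvd d i) \<and> (\<exists>N. \<forall>i\<ge>N. d i = 1)"

text \<open>The direct sum of the groups \<open>\<int>/d i\<close>, with least residues as elements.
  Where \<open>d i = 1\<close> the coordinate is forced to be 0, so chains of every length live in
  one type without a length parameter.\<close>

definition prod_cyc :: "(nat \<Rightarrow> nat) \<Rightarrow> (nat \<Rightarrow> nat) monoid" where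
  "prod_cyc d = \<lparr>carrier = {f. \<forall>i. f i < d i}, monoid.mult = (\<lambda>f g i. (f i + g i) mod d i), one = (\<lambda>i. 0)\<rparr>"

lemma divisor_chain_dvd:
  assumes "divisor_chain d" "i \<le> j"
  shows "d j dvd d i"
  using assms(2)
proof (induction j rule: dec_induct)
  case (step n)
  then show ?case using assms(1) unfolding divisor_chain_def by (meson dvd_trans)
qed simp

lemma divisor_chain_pos:
  assumes "divisor_chain d"
  shows "d i > 0"
  using divisor_chain_dvd[OF assms, of 0 i] assms unfolding divisor_chain_def
  by (metis dvd_0_left_iff gr0I zero_le less_irrefl)

lemma carrier_prod_cyc [simp]: "f \<in> carrier (prod_cyc d) \<longleftrightarrow> (\<forall>i. f i < d i)"
  by (simp add: prod_cyc_def)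

lemma mult_prod_cyc: "f \<otimes>\<^bsub>prod_cyc d\<^esub> g = (\<lambda>i. (f i + g i) mod d i)"
  by (simp add: prod_cyc_def)

lemma one_prod_cyc: "\<one>\<^bsub>prod_cyc d\<^esub> = (\<lambda>i. 0)"
  by (simp add: prod_cyc_def)

lemma comm_group_prod_cyc:
  assumes "divisor_chain d"
  shows "comm_group (prod_cyc d)"
proof (rule comm_groupI)
  fix f assume f: "f \<in> carrier (prod_cyc d)"
  \<comment> \<open>The outer \<open>mod\<close> sends \<open>f i = 0\<close> to 0 instead of
    \<open>d i\<close>, which lies outside the carrier.\<close>
  define g where "g = (\<lambda>i. (d i - f i) mod d i)"
  have "g \<in> carrier (prod_cyc d)"
    using divisor_chain_pos[OF assms] by (simp add: g_def)
  moreover have "((d i - f i) mod d i + f i) mod d i = 0" for i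
    using f by (simp add: mod_add_left_eq less_imp_le)
  ultimately show "\<exists>y\<in>carrier (prod_cyc d). y \<otimes>\<^bsub>prod_cyc d\<^esub> f = \<one>\<^bsub>prod_cyc d\<^esub>"
    by (intro bexI[of _ g]) (auto simp: mult_prod_cyc one_prod_cyc g_def fun_eq_iff)
qed (use divisor_chain_pos[OF assms] in \<open>auto simp: mult_prod_cyc one_prod_cyc fun_eq_iff mod_simps ac_simps\<close>)

lemma pow_prod_cyc:
  fixes k :: nat
  shows "f [^]\<^bsub>prod_cyc d\<^esub> k = (\<lambda>i. if k = 0 then 0 else k * f i mod d i)"
proof (induction k)
  case (Suc k)
  then show ?case by (auto simp: mult_prod_cyc fun_eq_iff mod_simps algebra_simps)
qed (simp add: one_prod_cyc)

lemma card_prod_cyc: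
  assumes "\<forall>i\<ge>N. d i = 1"
  shows "finite (carrier (prod_cyc d)) \<and> card (carrier (prod_cyc d)) = (\<Prod>i<N. d i)"
proof -
  have "f i = 0" if "N \<le> i" "\<forall>i. f i < d i" for f i
    using assms that by (metis less_one)
  then have "bij_betw (\<lambda>f. restrict f {..<N}) (carrier (prod_cyc d)) (PiE {..<N} (\<lambda>i. {..<d i}))"
    using assms
    by (intro bij_betw_byWitness[where f' = "\<lambda>g i. if i < N then g i else 0"])
       (auto simp: fun_eq_iff restrict_def PiE_def extensional_def Pi_def not_less)
  moreover have "finite (PiE {..<N} (\<lambda>i. {..<d i}))" by (intro finite_PiE) auto
  ultimately show ?thesis
    by (auto simp: bij_betw_finite bij_betw_same_card card_PiE)
qed

lemma finite_prod_cyc: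
  assumes "divisor_chain d"
  shows "finite (carrier (prod_cyc d))"
  using assms card_prod_cyc unfolding divisor_chain_def by blast

section \<open>Orders of elements and the exponent of a finite abelian group\<close>

lemma (in comm_group) ord_mult_coprime:
  assumes "x \<in> carrier G" "y \<in> carrier G" "coprime (ord x) (ord y)"
  shows "ord (x \<otimes> y) = ord x * ord y"
proof (rule dvd_antisym)
  let ?k = "ord (x \<otimes> y)"
  have "(x \<otimes> y) [^] ?k = \<one>" using assms by simp
  then have eq: "x [^] ?k \<otimes> y [^] ?k = \<one>" using assms by (metis nat_pow_distrib)
  have "ord x dvd ?k"
  proof -
    \<comment> \<open>The exponent \<open>ord y\<close> kills the contribution of \<open>y\<close>
      and leaves a power of \<open>x\<close>.\<close>
    have "(x [^] ?k \<otimes> y [^] ?k) [^] ord y = \<one>" using eq by simp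
    then have "x [^] (?k * ord y) = \<one>"
      using assms by (simp add: nat_pow_distrib nat_pow_pow mult.commute[of _ "ord y"])
         (simp add: nat_pow_pow[symmetric])
    then have "ord x dvd ?k * ord y" using assms by (simp add: pow_eq_id)
    then show ?thesis using assms(3) by (simp add: coprime_dvd_mult_left_iff)
  qed
  moreover have "ord y dvd ?k"
  proof -
    have "(x [^] ?k \<otimes> y [^] ?k) [^] ord x = \<one>" using eq by simp
    then have "y [^] (?k * ord x) = \<one>"
      using assms by (simp add: nat_pow_distrib nat_pow_pow mult.commute[of _ "ord x"])
         (simp add: nat_pow_pow[symmetric])
    then have "ord y dvd ?k * ord x" using assms by (simp add: pow_eq_id)
    then show ?thesis using assms(3) by (simp add: coprime_dvd_mult_left_iff coprime_commute)
  qed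
  ultimately show "ord x * ord y dvd ?k" using assms(3) by (simp add: divides_mult)
qed (use assms in \<open>simp add: abelian_ord_mul_divides\<close>)

text \<open>Take \<open>x\<close> of maximal order. If a prime \<open>p\<close> divided
  \<open>ord y\<close> to a higher power than \<open>ord x\<close>, the prime-to-\<open>p\<close>
  part of \<open>x\<close> times the \<open>p\<close>-part of \<open>y\<close> would have larger
  order.\<close>

lemma (in comm_group) exponent_attained:
  assumes fin: "finite (carrier G)"
  shows "\<exists>x\<in>carrier G. \<forall>y\<in>carrier G. ord y dvd ord x"
proof -
  have "Max (ord ` carrier G) \<in> ord ` carrier G" using fin by (intro Max_in) auto
  then obtain x where x: "x \<in> carrier G" and mx: "ord x = Max (ord ` carrier G)" by auto
  have max: "ord z \<le> ord x" if "z \<in> carrier G" for z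
    using fin that by (simp add: mx)
  have pos: "ord z > 0" if "z \<in> carrier G" for z using ord_ge_1[OF fin that] by simp
  have "ord y dvd ord x" if y: "y \<in> carrier G" for y
  proof (rule multiplicity_le_imp_dvd)
    show "ord y \<noteq> 0" using pos[OF y] by simp
    fix p :: nat assume p: "prime p"
    let ?a = "multiplicity p (ord x)" and ?b = "multiplicity p (ord y)"
    obtain u where u: "ord x = p ^ ?a * u" "\<not> p dvd u"
      using multiplicity_decompose'[of "ord x" p] pos[OF x] p by (metis less_irrefl not_prime_unit)
    obtain v where v: "ord y = p ^ ?b * v" "\<not> p dvd v"
      using multiplicity_decompose'[of "ord y" p] pos[OF y] p by (metis less_irrefl not_prime_unit)
    have p0: "p > 0" using p prime_gt_0_nat by blast
    have "u > 0" using u pos[OF x] by (cases u) auto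
    have "v > 0" using v pos[OF y] by (cases v) auto
    have "ord (x [^] (p ^ ?a)) = u"
      using ord_pow[OF x, of "p ^ ?a"] u(1) p0
      by (metis dvd_triv_left nonzero_mult_div_cancel_left power_not_zero less_irrefl)
    moreover have "ord (y [^] v) = p ^ ?b"
      using ord_pow[OF y, of v] v(1) \<open>v > 0\<close>
      by (metis dvd_triv_right nonzero_mult_div_cancel_right less_irrefl)
    moreover have "coprime u (p ^ ?b)"
      using u(2) p by (metis coprime_commute coprime_power_left_iff prime_imp_coprime)
    ultimately have "ord (x [^] (p ^ ?a) \<otimes> y [^] v) = u * p ^ ?b"
      using ord_mult_coprime x y by simp
    then have "u * p ^ ?b \<le> ord x" using max[of "x [^] (p ^ ?a) \<otimes> y [^] v"] x y by simp
    also have "ord x = u * p ^ ?a" using u(1) by (metis mult.commute)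
    finally have "p ^ ?b \<le> p ^ ?a" using \<open>u > 0\<close> by simp
    then show "?b \<le> ?a" using p prime_gt_1_nat by (simp add: power_le_imp_le_exp)
  qed
  then show ?thesis using x by blast
qed

text \<open>A homomorphism from \<open>H\<close> to \<open>\<int>/m\<close> is represented by an integer-valued function, which matters only
  modulo \<open>m\<close>. Such homomorphisms extend to the whole group when \<open>m\<close> is a multiple of the exponent,
  so that the subgroup generated by an element of maximal order has a complement.\<close>

definition mod_hom_on :: "('a, 'b) monoid_scheme \<Rightarrow> nat \<Rightarrow> 'a set \<Rightarrow> ('a \<Rightarrow> int) \<Rightarrow> bool" where
  "mod_hom_on G m H f \<longleftrightarrow> (\<forall>a\<in>H. \<forall>b\<in>H. [f (a \<otimes>\<^bsub>G\<^esub> b) = f a + f b] (mod int m))"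

lemma (in group) mod_hom_on_one:
  assumes "subgroup H G" "mod_hom_on G m H f"
  shows "[f \<one> = 0] (mod int m)"
proof -
  have "[f (\<one> \<otimes> \<one>) = f \<one> + f \<one>] (mod int m)"
    using assms subgroup.one_closed unfolding mod_hom_on_def by blast
  then have "[0 + f \<one> = f \<one> + f \<one>] (mod int m)" by simp
  then show ?thesis by (simp only: cong_add_rcancel cong_sym_eq)
qed

lemma (in group) subgroup_nat_pow_closed:
  assumes "subgroup H G" "a \<in> H"
  shows "a [^] (k::nat) \<in> H"
  by (induction k) (simp_all add: subgroup.one_closed[OF assms(1)] subgroup.m_closed[OF assms(1) _ assms(2)])

lemma (in group) mod_hom_on_pow:
  assumes "subgroup H G" "mod_hom_on G m H f" "a \<in> H"
  shows "[f (a [^] (k::nat)) = int k * f a] (mod int m)"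
proof (induction k)
  case 0
  then show ?case using mod_hom_on_one[OF assms(1,2)] by simp
next
  case (Suc k)
  have "a [^] k \<in> H" using subgroup_nat_pow_closed[OF assms(1,3)] .
  then have "[f (a [^] k \<otimes> a) = f (a [^] k) + f a] (mod int m)"
    using assms unfolding mod_hom_on_def by blast
  also have "[f (a [^] k) + f a = int k * f a + f a] (mod int m)"
    using Suc by (rule cong_add) simp
  finally show ?case by (simp add: algebra_simps)
qed

text \<open>This is the injectivity of \<open>\<int>/m\<close> among abelian groups of exponent
  dividing \<open>m\<close>, for one new generator \<open>g\<close>: the value at \<open>g\<close>
  has to be a \<open>t\<close>-th part of \<open>f (g [^] t)\<close>, where \<open>t\<close> is the
  order of \<open>g\<close> modulo \<open>H\<close>.\<close>

lemma (in comm_group) mod_hom_on_extend_step: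
  assumes H: "subgroup H G" and f: "mod_hom_on G m H f" and g: "g \<in> carrier G" "g \<notin> H"
    and m: "m > 0" and exp: "\<And>y. y \<in> carrier G \<Longrightarrow> y [^] m = \<one>"
  shows "\<exists>H' f'. subgroup H' G \<and> H \<subset> H' \<and> mod_hom_on G m H' f' \<and> (\<forall>x\<in>H. [f' x = f x] (mod int m))"
proof -
  have HG: "x \<in> carrier G" if "x \<in> H" for x using subgroup.mem_carrier[OF H that] .
  have Hpow: "x [^] (k::nat) \<in> H" if "x \<in> H" for x k
    using subgroup_nat_pow_closed[OF H that] .
  define t where "t = (LEAST t::nat. t > 0 \<and> g [^] t \<in> H)"
  have "m > 0 \<and> g [^] m \<in> H" using m exp[OF g(1)] subgroup.one_closed[OF H] by simp
  then have "t > 0 \<and> g [^] t \<in> H" unfolding t_def by (rule LeastI)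
  then have t: "t > 0" "g [^] t \<in> H" by auto
  have least: "t \<le> k" if "k > 0" "g [^] k \<in> H" for k :: nat
    unfolding t_def using that by (intro Least_le) simp
  have dvdk: "t dvd k" if k: "g [^] k \<in> H" for k :: nat
  proof -
    let ?u = "(g [^] t) [^] (k div t)"
    have u: "?u \<in> H" using Hpow[OF t(2)] .
    have "g [^] k = ?u \<otimes> g [^] (k mod t)"
      using g by (simp add: nat_pow_pow nat_pow_mult)
    then have "g [^] (k mod t) = inv ?u \<otimes> g [^] k"
      using g u HG by (subst inv_solve_left) auto
    then have "g [^] (k mod t) \<in> H"
      using k u subgroup.m_closed[OF H] subgroup.m_inv_closed[OF H] by simp
    then have "k mod t = 0" using least[of "k mod t"] t(1) by (meson mod_less_divisor not_le gr0I)
    then show ?thesis by auto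
  qed
  have "t dvd m" using dvdk[of m] exp[OF g(1)] subgroup.one_closed[OF H] by simp
  then obtain q where q: "m = t * q" by auto
  then have "q > 0" using m by (cases q) auto
  \<comment> \<open>With \<open>m = t * q\<close>, the number \<open>q * f (g [^] t)\<close>
    vanishes modulo \<open>t * q\<close>, so \<open>t\<close> divides \<open>f (g [^] t)\<close> as
    an integer; the quotient \<open>c\<close> becomes the value at \<open>g\<close>.\<close>
  have "[int q * f (g [^] t) = f ((g [^] t) [^] q)] (mod int m)"
    using mod_hom_on_pow[OF H f t(2), of q] cong_sym by blast
  also have "(g [^] t) [^] q = \<one>" using g exp[OF g(1)] q by (simp add: nat_pow_pow)
  also have "[f \<one> = 0] (mod int m)" by (rule mod_hom_on_one[OF H f])
  finally have "int q * int t dvd int q * f (g [^] t)" using q by (simp add: cong_0_iff mult.commute)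
  then have "int t dvd f (g [^] t)" using \<open>q > 0\<close> by simp
  then obtain c where c: "f (g [^] t) = int t * c" by auto
  have wd_le: "[f h1 + int k1 * c = f h2 + int k2 * c] (mod int m)"
    if h: "h1 \<in> H" "h2 \<in> H" and eq: "h1 \<otimes> g [^] k1 = h2 \<otimes> g [^] k2" and le: "k1 \<le> k2"
    for h1 h2 and k1 k2 :: nat
  proof -
    define j where "j = k2 - k1"
    have k2: "k2 = j + k1" using le j_def by simp
    have "h1 \<otimes> g [^] k1 = (h2 \<otimes> g [^] j) \<otimes> g [^] k1"
      using eq g HG[OF h(2)] by (simp add: k2 m_assoc nat_pow_mult)
    then have h1: "h1 = h2 \<otimes> g [^] j" using g HG h by simp
    then have "g [^] j = inv h2 \<otimes> h1" using g HG[OF h(1)] HG[OF h(2)] by (subst inv_solve_left) auto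
    then have gj: "g [^] j \<in> H" using h subgroup.m_closed[OF H] subgroup.m_inv_closed[OF H] by simp
    then obtain i where i: "j = t * i" using dvdk by blast
    have "[f h1 = f h2 + f (g [^] j)] (mod int m)"
      using f h gj unfolding h1 mod_hom_on_def by blast
    also have "g [^] j = (g [^] t) [^] i" using g by (simp add: i nat_pow_pow)
    also have "[f h2 + f ((g [^] t) [^] i) = f h2 + int i * f (g [^] t)] (mod int m)"
      by (intro cong_add cong_refl mod_hom_on_pow[OF H f t(2)])
    also have "f h2 + int i * f (g [^] t) = f h2 + int j * c" by (simp add: c i)
    finally have "[f h1 + int k1 * c = f h2 + int j * c + int k1 * c] (mod int m)"
      by (intro cong_add cong_refl)
    then show ?thesis by (simp add: k2 algebra_simps)
  qed
  have wd: "[f h1 + int k1 * c = f h2 + int k2 * c] (mod int m)"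
    if "h1 \<in> H" "h2 \<in> H" "h1 \<otimes> g [^] k1 = h2 \<otimes> g [^] k2" for h1 h2 and k1 k2 :: nat
    using wd_le[of h1 h2 k1 k2] wd_le[of h2 h1 k2 k1] that
    by (cases "k1 \<le> k2") (auto intro: cong_sym)
  define H' where "H' = {h \<otimes> g [^] k | h (k::nat). h \<in> H}"
  \<comment> \<open>An element of \<open>H'\<close> has many presentations
    \<open>h \<otimes> g [^] k\<close>; by \<open>wd\<close> the value modulo \<open>m\<close> is
    the same for whichever is picked here.\<close>
  define dec where "dec = (\<lambda>y. SOME hk. fst hk \<in> H \<and> y = fst hk \<otimes> g [^] (snd hk :: nat))"
  define f' where "f' = (\<lambda>y. f (fst (dec y)) + int (snd (dec y)) * c)"
  have f': "[f' (h \<otimes> g [^] k) = f h + int k * c] (mod int m)" if "h \<in> H" for h and k :: nat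
  proof -
    let ?d = "dec (h \<otimes> g [^] k)"
    have "fst ?d \<in> H \<and> h \<otimes> g [^] k = fst ?d \<otimes> g [^] (snd ?d)"
      unfolding dec_def by (rule someI[of _ "(h, k)"]) (use that in simp)
    then show ?thesis unfolding f'_def using wd[of "fst ?d" h "snd ?d" k] that by simp
  qed
  have mult: "(h1 \<otimes> g [^] k1) \<otimes> (h2 \<otimes> g [^] k2) = (h1 \<otimes> h2) \<otimes> g [^] (k1 + k2)"
    if "h1 \<in> H" "h2 \<in> H" for h1 h2 and k1 k2 :: nat
    using HG[OF that(1)] HG[OF that(2)] g by (simp add: nat_pow_mult[symmetric] m_ac)
  have sub: "subgroup H' G"
  proof (rule subgroupI)
    show "H' \<subseteq> carrier G" using HG g by (auto simp: H'_def)
    show "H' \<noteq> {}" using subgroup.one_closed[OF H] by (auto simp: H'_def)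
    fix a assume "a \<in> H'"
    then obtain h k where a: "a = h \<otimes> g [^] (k::nat)" "h \<in> H" by (auto simp: H'_def)
    \<comment> \<open>\<open>H'\<close> is described with natural exponents only, so the inverse of
      \<open>g [^] k\<close> is written as a natural power.\<close>
    have "g [^] k \<otimes> g [^] (k * (m - 1)) = (g [^] m) [^] k"
      using g m by (simp add: nat_pow_mult nat_pow_pow) (simp add: algebra_simps)
    then have "inv (g [^] k) = g [^] (k * (m - 1))"
      using g exp[OF g(1)] by (intro inv_equality) (auto simp: m_comm)
    then have "inv a = inv h \<otimes> g [^] (k * (m - 1))"
      using a HG[OF a(2)] g by (simp add: inv_mult)
    then show "inv a \<in> H'" using subgroup.m_inv_closed[OF H a(2)] by (auto simp: H'_def)
    fix b assume "b \<in> H'"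
    then obtain h2 k2 where b: "b = h2 \<otimes> g [^] (k2::nat)" "h2 \<in> H" by (auto simp: H'_def)
    show "a \<otimes> b \<in> H'"
      using mult[OF a(2) b(2)] subgroup.m_closed[OF H a(2) b(2)] a b by (auto simp: H'_def)
  qed
  have "x = x \<otimes> g [^] (0::nat)" if "x \<in> H" for x using HG[OF that] by simp
  then have "H \<subseteq> H'" unfolding H'_def by blast
  moreover have "g = \<one> \<otimes> g [^] (1::nat)" using g by simp
  then have "g \<in> H'" using subgroup.one_closed[OF H] unfolding H'_def by blast
  moreover have "mod_hom_on G m H' f'"
    unfolding mod_hom_on_def
  proof (intro ballI)
    fix a b assume "a \<in> H'" "b \<in> H'"
    then obtain h k h2 k2 where a: "a = h \<otimes> g [^] (k::nat)" "h \<in> H"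
      and b: "b = h2 \<otimes> g [^] (k2::nat)" "h2 \<in> H" by (auto simp: H'_def)
    have "[f' (a \<otimes> b) = f (h \<otimes> h2) + int (k + k2) * c] (mod int m)"
      unfolding a b mult[OF a(2) b(2)] by (intro f' subgroup.m_closed[OF H a(2) b(2)])
    also have "[f (h \<otimes> h2) + int (k + k2) * c = (f h + f h2) + int (k + k2) * c] (mod int m)"
      using f a b unfolding mod_hom_on_def by (intro cong_add cong_refl) auto
    also have "(f h + f h2) + int (k + k2) * c = (f h + int k * c) + (f h2 + int k2 * c)"
      by (simp add: algebra_simps)
    also have "[\<dots> = f' a + f' b] (mod int m)"
      unfolding a b by (intro cong_add cong_sym[OF f'] a b)
    finally show "[f' (a \<otimes> b) = f' a + f' b] (mod int m)" .
  qed
  moreover have "[f' x = f x] (mod int m)" if "x \<in> H" for x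
    using f'[OF that, of 0] HG[OF that] by simp
  ultimately show ?thesis using sub g by (intro exI[of _ H'] exI[of _ f']) auto
qed

lemma (in comm_group) mod_hom_on_extend:
  assumes fin: "finite (carrier G)" and m: "m > 0" and exp: "\<And>y. y \<in> carrier G \<Longrightarrow> y [^] m = \<one>"
  shows "subgroup H G \<Longrightarrow> mod_hom_on G m H f \<Longrightarrow>
    \<exists>f'. mod_hom_on G m (carrier G) f' \<and> (\<forall>x\<in>H. [f' x = f x] (mod int m))"
proof (induction "card (carrier G) - card H" arbitrary: H f rule: less_induct)
  case less
  show ?case
  proof (cases "H = carrier G")
    case True
    then show ?thesis using less.prems by auto
  next
    case False
    then obtain g where g: "g \<in> carrier G" "g \<notin> H" using subgroup.subset[OF less.prems(1)] by blast
    obtain H' f' where H': "subgroup H' G" "H \<subset> H'" "mod_hom_on G m H' f'"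
      and f': "\<forall>x\<in>H. [f' x = f x] (mod int m)"
      using mod_hom_on_extend_step[OF less.prems g m exp] by metis
    have "H' \<subseteq> carrier G" using subgroup.subset[OF H'(1)] .
    then have "card H < card H'" "card H' \<le> card (carrier G)"
      using psubset_card_mono[OF finite_subset[OF _ fin] H'(2)] card_mono[OF fin] by auto
    then have "card (carrier G) - card H' < card (carrier G) - card H" by simp
    then obtain f'' where "mod_hom_on G m (carrier G) f''" "\<forall>x\<in>H'. [f'' x = f' x] (mod int m)"
      using less.hyps[OF _ H'(1,3)] by blast
    moreover from this f' H'(2) have "\<forall>x\<in>H. [f'' x = f x] (mod int m)"
      by (blast intro: cong_trans)
    ultimately show ?thesis by blast
  qed
qed

text \<open>The discrete logarithm to base \<open>x\<close> is a homomorphism on the cyclic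
  subgroup, and it extends to \<open>G\<close> because \<open>ord x\<close> is a multiple of every
  order. The kernel of the extension will be the complement of that subgroup.\<close>

lemma (in comm_group) ex_mod_hom_on_generator:
  assumes fin: "finite (carrier G)" and x: "x \<in> carrier G"
    and exp: "\<And>y. y \<in> carrier G \<Longrightarrow> ord y dvd ord x"
  shows "\<exists>f. mod_hom_on G (ord x) (carrier G) f \<and> [f x = 1] (mod int (ord x))"
proof -
  let ?H = "generate G {x}"
  have H: "?H = {x [^] (k::int) | k. k \<in> UNIV}" using generate_pow[OF x] .
  define f where "f = (\<lambda>y. SOME k::int. x [^] k = y)"
  have "x [^] f (x [^] k) = x [^] k" for k :: int
    unfolding f_def by (rule someI[of _ k]) simp
  then have f: "[f (x [^] k) = k] (mod int (ord x))" for k :: int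
    using int_pow_eq[OF x, of "f (x [^] k)" k] by (simp add: cong_iff_dvd_diff dvd_diff_commute)
  have "mod_hom_on G (ord x) ?H f"
    unfolding mod_hom_on_def
  proof (intro ballI)
    fix a b assume "a \<in> ?H" "b \<in> ?H"
    then obtain k l :: int where a: "a = x [^] k" and b: "b = x [^] l" unfolding H by blast
    have "[f (a \<otimes> b) = k + l] (mod int (ord x))"
      unfolding a b using f[of "k + l"] x by (simp add: int_pow_mult)
    also have "[k + l = f a + f b] (mod int (ord x))"
      unfolding a b by (intro cong_add cong_sym[OF f])
    finally show "[f (a \<otimes> b) = f a + f b] (mod int (ord x))" .
  qed
  moreover have "subgroup ?H G" using generate_is_subgroup[of "{x}"] x by simp
  moreover have "y [^] ord x = \<one>" if "y \<in> carrier G" for y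
    using exp[OF that] that by (simp add: pow_eq_id)
  moreover have "ord x > 0" using ord_ge_1[OF fin x] by simp
  ultimately obtain f' where "mod_hom_on G (ord x) (carrier G) f'"
      "\<forall>y\<in>?H. [f' y = f y] (mod int (ord x))"
    using mod_hom_on_extend[OF fin] by blast
  moreover have "x \<in> ?H" by (simp add: generate.incl)
  moreover have "[f x = 1] (mod int (ord x))" using f[of 1] x by (simp add: int_pow_1)
  ultimately show ?thesis by (meson cong_trans)
qed

section \<open>Splitting off a cyclic factor of maximal order\<close>

lemma prod_cyc_unit_dvd:
  assumes d: "divisor_chain d" and G: "group G" and "\<psi> \<in> hom (prod_cyc d) G" "inj_on \<psi> (carrier (prod_cyc d))"
    and exp: "\<And>y. y \<in> carrier G \<Longrightarrow> y [^]\<^bsub>G\<^esub> (m::nat) = \<one>\<^bsub>G\<^esub>"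
  shows "d 0 dvd m"
proof -
  interpret P: comm_group "prod_cyc d" by (rule comm_group_prod_cyc[OF d])
  interpret \<psi>: group_hom "prod_cyc d" G \<psi>
    using assms by (simp add: group_hom_def group_hom_axioms_def P.group_axioms)
  \<comment> \<open>The first unit vector; \<open>1 mod d 0\<close> keeps it in the carrier when
    \<open>d 0 = 1\<close>.\<close>
  define e where "e = (\<lambda>i::nat. if i = 0 then 1 mod d 0 else 0)"
  have "1 mod d 0 < d 0" using divisor_chain_pos[OF d] by (rule mod_less_divisor)
  then have e: "e \<in> carrier (prod_cyc d)"
    using divisor_chain_pos[OF d] by (simp add: e_def del: One_nat_def)
  have "\<psi> (e [^]\<^bsub>prod_cyc d\<^esub> m) = \<psi> \<one>\<^bsub>prod_cyc d\<^esub>"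
    using exp[of "\<psi> e"] e \<psi>.hom_nat_pow[OF e, of m] by simp
  then have "e [^]\<^bsub>prod_cyc d\<^esub> m = \<one>\<^bsub>prod_cyc d\<^esub>"
    using assms(4) e by (meson P.nat_pow_closed P.one_closed inj_onD)
  from fun_cong[OF this, of 0] show ?thesis
    by (cases "d 0 = 1") (simp_all add: pow_prod_cyc one_prod_cyc e_def mod_mult_right_eq mod_eq_0_iff_dvd split: if_splits)
qed

lemma divisor_chain_case_nat:
  assumes "divisor_chain d" "d 0 dvd m" "m > 0"
  shows "divisor_chain (case_nat m d)"
  unfolding divisor_chain_def
proof (intro conjI allI)
  obtain N where "\<forall>i\<ge>N. d i = 1" using assms unfolding divisor_chain_def by blast
  then show "\<exists>N. \<forall>i\<ge>N. (case i of 0 \<Rightarrow> m | Suc j \<Rightarrow> d j) = 1"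
    by (intro exI[of _ "Suc N"]) (auto split: nat.splits)
qed (use assms in \<open>auto simp: divisor_chain_def split: nat.splits\<close>)

text \<open>Since \<open>f x = 1\<close> and \<open>f\<close> vanishes on \<open>K\<close>, applying
  \<open>f\<close> to the image reads off coordinate 0, which gives injectivity; conversely
  \<open>y\<close> times the inverse of \<open>x [^] f y\<close> lies in \<open>K\<close>, which
  gives surjectivity.\<close>

lemma (in comm_group) split_off_cyclic:
  assumes fin: "finite (carrier G)" and x: "x \<in> carrier G" and m: "m = ord x"
    and f: "mod_hom_on G m (carrier G) f" "[f x = 1] (mod int m)"
    and K: "K = {y \<in> carrier G. [f y = 0] (mod int m)}"
    and d: "divisor_chain d" and \<psi>: "\<psi> \<in> iso (prod_cyc d) (G\<lparr>carrier := K\<rparr>)"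
  shows "(\<lambda>a. x [^] a 0 \<otimes> \<psi> (\<lambda>i. a (Suc i))) \<in> iso (prod_cyc (case_nat m d)) G" (is "?\<phi> \<in> _")
proof -
  let ?P = "prod_cyc (case_nat m d)"
  have m0: "m > 0" using ord_ge_1[OF fin x] m by simp
  have xm: "x [^] (k mod m) = x [^] k" for k :: nat
  proof -
    have "x [^] k = x [^] (m * (k div m) + k mod m)" by simp
    also have "\<dots> = (x [^] m) [^] (k div m) \<otimes> x [^] (k mod m)"
      using x by (simp only: nat_pow_mult nat_pow_pow nat_pow_closed)
    finally show ?thesis using x m by simp
  qed
  have fh: "[f (a \<otimes> b) = f a + f b] (mod int m)" if "a \<in> carrier G" "b \<in> carrier G" for a b
    using f(1) that unfolding mod_hom_on_def by blast
  have fx: "[f (x [^] k) = int k] (mod int m)" for k :: nat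
    using mod_hom_on_pow[OF subgroup_self f(1) x, of k] cong_mult[OF cong_refl f(2), of "int k"]
    by (simp add: cong_def)
  have tail: "(\<lambda>i. a (Suc i)) \<in> carrier (prod_cyc d)" if "a \<in> carrier ?P" for a
    using that by (auto simp: split: nat.splits)
  have head: "a 0 < m" if "a \<in> carrier ?P" for a
    using that by (auto dest: spec[of _ 0])
  have \<psi>K: "\<psi> b \<in> K" if "b \<in> carrier (prod_cyc d)" for b
    using \<psi> that by (auto simp: iso_def hom_def)
  then have \<psi>G: "\<psi> b \<in> carrier G" if "b \<in> carrier (prod_cyc d)" for b
    using that K by auto
  have \<psi>mult: "\<psi> (\<lambda>i. (a i + b i) mod d i) = \<psi> a \<otimes> \<psi> b"
    if "a \<in> carrier (prod_cyc d)" "b \<in> carrier (prod_cyc d)" for a b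
    using \<psi> that unfolding iso_def hom_def by (simp add: mult_prod_cyc)
  have "?\<phi> \<in> hom ?P G"
  proof (rule homI)
    fix a assume a: "a \<in> carrier ?P"
    show "?\<phi> a \<in> carrier G" using \<psi>G[OF tail[OF a]] x by simp
    fix b assume b: "b \<in> carrier ?P"
    have "?\<phi> (a \<otimes>\<^bsub>?P\<^esub> b) = x [^] ((a 0 + b 0) mod m) \<otimes> \<psi> (\<lambda>i. (a (Suc i) + b (Suc i)) mod d i)"
      by (simp add: mult_prod_cyc)
    also have "\<dots> = (x [^] a 0 \<otimes> x [^] b 0) \<otimes> (\<psi> (\<lambda>i. a (Suc i)) \<otimes> \<psi> (\<lambda>i. b (Suc i)))"
      using x \<psi>mult[OF tail[OF a] tail[OF b]] by (simp add: xm nat_pow_mult)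
    also have "\<dots> = ?\<phi> a \<otimes> ?\<phi> b"
      using x \<psi>G[OF tail[OF a]] \<psi>G[OF tail[OF b]] by (simp add: m_ac)
    finally show "?\<phi> (a \<otimes>\<^bsub>?P\<^esub> b) = ?\<phi> a \<otimes> ?\<phi> b" .
  qed
  moreover have "inj_on ?\<phi> (carrier ?P)"
  proof (rule inj_onI)
    fix a b assume a: "a \<in> carrier ?P" and b: "b \<in> carrier ?P" and eq: "?\<phi> a = ?\<phi> b"
    have fa: "[f (?\<phi> a) = int (a 0)] (mod int m)" if a: "a \<in> carrier ?P" for a
    proof -
      have "[f (?\<phi> a) = f (x [^] a 0) + f (\<psi> (\<lambda>i. a (Suc i)))] (mod int m)"
        using x \<psi>G[OF tail[OF a]] by (intro fh) auto
      also have "[f (x [^] a 0) + f (\<psi> (\<lambda>i. a (Suc i))) = int (a 0) + 0] (mod int m)"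
        using \<psi>K[OF tail[OF a]] K by (intro cong_add fx) auto
      finally show ?thesis by simp
    qed
    have "[int (a 0) = int (b 0)] (mod int m)"
      using fa[OF a] fa[OF b] eq by (simp add: cong_def)
    then have 0: "a 0 = b 0"
      using head[OF a] head[OF b] by (simp add: cong_int_iff cong_def)
    then have "\<psi> (\<lambda>i. a (Suc i)) = \<psi> (\<lambda>i. b (Suc i))"
      using eq x \<psi>G[OF tail[OF a]] \<psi>G[OF tail[OF b]] by simp
    then have "(\<lambda>i. a (Suc i)) = (\<lambda>i. b (Suc i))"
      using \<psi> tail[OF a] tail[OF b] unfolding iso_def bij_betw_def by (auto dest: inj_onD)
    then have "a i = b i" for i
      using 0 by (cases i) (auto dest: fun_cong)
    then show "a = b" by blast
  qed
  moreover have "?\<phi> ` carrier ?P = carrier G"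
  proof (intro subset_antisym subsetI)
    fix y assume "y \<in> ?\<phi> ` carrier ?P"
    then show "y \<in> carrier G" using x \<psi>G[OF tail] by auto
  next
    fix y assume y: "y \<in> carrier G"
    define k where "k = nat (f y mod int m)"
    have k: "k < m" "int k = f y mod int m" using m0 by (auto simp: k_def nat_less_iff)
    let ?z = "inv (x [^] k) \<otimes> y"
    have "[int k + f ?z = f (x [^] k) + f ?z] (mod int m)"
      by (intro cong_add cong_refl cong_sym[OF fx])
    also have "[f (x [^] k) + f ?z = f (x [^] k \<otimes> ?z)] (mod int m)"
      using x y by (intro cong_sym[OF fh]) auto
    also have "x [^] k \<otimes> ?z = y" using x y by (simp add: m_assoc[symmetric])
    also have "[f y = int k + 0] (mod int m)" using k by (simp add: cong_def)
    finally have "[f ?z = 0] (mod int m)" by (simp only: cong_add_lcancel)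
    then have "?z \<in> K" using x y K by simp
    then obtain b where b: "b \<in> carrier (prod_cyc d)" "\<psi> b = ?z"
      using \<psi> unfolding iso_def bij_betw_def by force
    have "case_nat k b \<in> carrier ?P" using b(1) k by (auto split: nat.splits)
    moreover have "?\<phi> (case_nat k b) = y"
      using x y b by (simp add: m_assoc[symmetric])
    ultimately show "y \<in> ?\<phi> ` carrier ?P" by (intro image_eqI[of _ _ "case_nat k b"]) simp_all
  qed
  ultimately show ?thesis by (simp add: iso_def bij_betw_def)
qed

text \<open>Strong induction on the order. The order \<open>m\<close> of the split-off element is
  the exponent of \<open>G\<close>, so the complement \<open>K\<close> also has exponent dividing
  \<open>m\<close>; this is why \<open>m\<close> may be put in front of the chain of
  \<open>K\<close>.\<close>

theorem finite_comm_group_iso_prod_cyc: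
  assumes "comm_group G" "finite (carrier G)"
  shows "\<exists>d. divisor_chain d \<and> prod_cyc d \<cong> G"
  using assms
proof (induction "card (carrier G)" arbitrary: G rule: less_induct)
  case less
  interpret comm_group G by (rule less.prems)
  note fin = less.prems(2)
  obtain x where x: "x \<in> carrier G" and exp: "\<And>y. y \<in> carrier G \<Longrightarrow> group.ord G y dvd group.ord G x"
    using exponent_attained[OF fin] by blast
  show ?case
  proof (cases "group.ord G x = 1")
    case True
    have "y = \<one>\<^bsub>G\<^esub>" if "y \<in> carrier G" for y using exp[OF that] True ord_eq_1[OF that] by simp
    then have C: "carrier G = {\<one>\<^bsub>G\<^esub>}" by auto
    let ?d = "\<lambda>i::nat. 1::nat"
    have "carrier (prod_cyc ?d) = {\<lambda>i. 0}" by (auto simp: fun_eq_iff)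
    then have "(\<lambda>_. \<one>\<^bsub>G\<^esub>) \<in> iso (prod_cyc ?d) G"
      using C by (auto simp: iso_def hom_def bij_betw_def)
    moreover have "divisor_chain ?d" by (simp add: divisor_chain_def)
    ultimately show ?thesis unfolding is_iso_def by blast
  next
    case False
    define m where "m = group.ord G x"
    have m1: "m > 1" using ord_ge_1[OF fin x] False by (simp add: m_def)
    obtain f where f: "mod_hom_on G m (carrier G) f" "[f x = 1] (mod int m)"
      using ex_mod_hom_on_generator[OF fin x exp] unfolding m_def by blast
    define K where "K = {y \<in> carrier G. [f y = 0] (mod int m)}"
    have K: "subgroup K G"
    proof (rule subgroupI)
      show "K \<subseteq> carrier G" by (auto simp: K_def)
      have f1: "[f \<one>\<^bsub>G\<^esub> = 0] (mod int m)" by (rule mod_hom_on_one[OF subgroup_self f(1)])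
      then show "K \<noteq> {}" by (auto simp: K_def)
      fix a assume a: "a \<in> K"
      have "[f (inv\<^bsub>G\<^esub> a) = f (inv\<^bsub>G\<^esub> a) + f a] (mod int m)"
        using a cong_add[OF cong_refl, of "f a" 0 "int m" "f (inv\<^bsub>G\<^esub> a)"] by (simp add: K_def cong_sym)
      also have "[f (inv\<^bsub>G\<^esub> a) + f a = f (inv\<^bsub>G\<^esub> a \<otimes>\<^bsub>G\<^esub> a)] (mod int m)"
        using f(1) a unfolding mod_hom_on_def K_def
        by (intro cong_sym[of "f (inv\<^bsub>G\<^esub> a \<otimes>\<^bsub>G\<^esub> a)"]) (use inv_closed in blast)
      also have "f (inv\<^bsub>G\<^esub> a \<otimes>\<^bsub>G\<^esub> a) = f \<one>\<^bsub>G\<^esub>" using a by (simp add: K_def)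
      finally show "inv\<^bsub>G\<^esub> a \<in> K" using a f1 by (auto simp: K_def intro: cong_trans)
      fix b assume b: "b \<in> K"
      have "[f (a \<otimes>\<^bsub>G\<^esub> b) = f a + f b] (mod int m)"
        using f(1) a b unfolding mod_hom_on_def K_def by auto
      also have "[f a + f b = 0 + 0] (mod int m)" using a b by (intro cong_add) (auto simp: K_def)
      finally show "a \<otimes>\<^bsub>G\<^esub> b \<in> K" using a b by (simp add: K_def)
    qed
    let ?K = "G\<lparr>carrier := K\<rparr>"
    have "\<not> [f x = 0] (mod int m)" using f(2) m1
      by (auto simp: cong_def)
    then have "K \<subset> carrier G" using x by (auto simp: K_def)
    then have "card (carrier ?K) < card (carrier G)" using fin by (simp add: psubset_card_mono)
    moreover have KC: "comm_group ?K"
      using K by (intro group.group_comm_groupI subgroup.subgroup_is_group is_group)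
        (auto simp: K_def m_comm)
    moreover have "finite (carrier ?K)" using fin by (simp add: K_def)
    ultimately obtain d \<psi> where d: "divisor_chain d" and \<psi>: "\<psi> \<in> iso (prod_cyc d) ?K"
      using less.hyps unfolding is_iso_def by blast
    have "d 0 dvd m"
    proof (rule prod_cyc_unit_dvd[OF d])
      show "group ?K" using KC by (simp add: comm_group_def)
      fix y assume "y \<in> carrier ?K"
      then show "y [^]\<^bsub>?K\<^esub> m = \<one>\<^bsub>?K\<^esub>"
        using exp[of y] by (simp add: K_def m_def pow_eq_id nat_pow_consistent[symmetric])
    qed (use \<psi> in \<open>auto simp: iso_def bij_betw_def\<close>)
    then have "divisor_chain (case_nat m d)" using d m1 by (intro divisor_chain_case_nat) auto
    moreover have "prod_cyc (case_nat m d) \<cong> G"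
      using split_off_cyclic[OF fin x m_def f K_def d \<psi>] unfolding is_iso_def by blast
    ultimately show ?thesis by blast
  qed
qed

subsection \<open>Embeddings and ranks\<close>

text \<open>In \<open>prod_cyc d\<close> this set has \<open>p\<close> to the number of \<open>i\<close> with \<open>p ^ (k + 1)\<close> dividing \<open>d i\<close> many
  elements, and it grows along embeddings.\<close>

definition power_torsion :: "('a, 'b) monoid_scheme \<Rightarrow> nat \<Rightarrow> nat \<Rightarrow> 'a set" where
  "power_torsion G p k =
     {y \<in> carrier G. y [^]\<^bsub>G\<^esub> p = \<one>\<^bsub>G\<^esub> \<and> (\<exists>z\<in>carrier G. y = z [^]\<^bsub>G\<^esub> (p ^ k))}"

text \<open>The \<open>p\<close>-part of \<open>n\<close> is at most \<open>p ^ k\<close>, and the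
  rest of \<open>n\<close> is coprime to \<open>p\<close>, so the extra factor \<open>p\<close>
  contributes nothing.\<close>

lemma dvd_prime_power_mult_cancel:
  fixes n p k z :: nat
  assumes p: "prime p" and n: "n > 0" "\<not> p ^ Suc k dvd n" "n dvd p ^ Suc k * z"
  shows "n dvd p ^ k * z"
proof -
  obtain u where u: "n = p ^ multiplicity p n * u" "\<not> p dvd u"
    using multiplicity_decompose'[of n p] n(1) p by (metis less_irrefl not_prime_unit)
  have "\<not> Suc k \<le> multiplicity p n"
    using n(2) by (meson multiplicity_dvd')
  then have le: "multiplicity p n \<le> k" by simp
  have "coprime u (p ^ Suc k)"
    using u(2) p by (metis coprime_commute coprime_power_left_iff prime_imp_coprime)
  moreover have "u dvd p ^ Suc k * z" using u(1) n(3) by (metis dvd_mult_right)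
  ultimately have "u dvd z" by (simp add: coprime_dvd_mult_right_iff)
  then have "p ^ multiplicity p n * u dvd p ^ k * z"
    using le by (intro mult_dvd_mono le_imp_power_dvd)
  then show ?thesis using u(1) by simp
qed

text \<open>From \<open>y [^] p = \<one>\<close> the number \<open>p * y j\<close> is a multiple of
  \<open>d j\<close> below \<open>p * d j\<close>, which leaves at most \<open>p\<close> values. For
  \<open>j \<ge> i\<close> the element being a \<open>p ^ k\<close>-th power leaves only 0, because
  \<open>p ^ (k + 1)\<close> does not divide \<open>d j\<close>.\<close>

lemma card_power_torsion_le:
  assumes d: "divisor_chain d" and p: "prime p" and ndvd: "\<not> p ^ Suc k dvd d i"
  shows "card (power_torsion (prod_cyc d) p k) \<le> p ^ i"
proof -
  let ?W = "power_torsion (prod_cyc d) p k"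
  have p0: "p > 0" using p prime_gt_0_nat by blast
  have dpos: "d j > 0" for j using divisor_chain_pos[OF d] .
  let ?q = "\<lambda>y. restrict (\<lambda>j. p * y j div d j) {..<i}"
  have lt: "y j < d j" if "y \<in> ?W" for y j using that by (auto simp: power_torsion_def)
  have dvd: "d j dvd p * y j" if "y \<in> ?W" for y j
  proof -
    have "y [^]\<^bsub>prod_cyc d\<^esub> p = \<one>\<^bsub>prod_cyc d\<^esub>" using that by (simp add: power_torsion_def)
    from fun_cong[OF this, of j] show ?thesis using p0 by (simp add: pow_prod_cyc one_prod_cyc mod_eq_0_iff_dvd)
  qed
  have tail: "y j = 0" if y: "y \<in> ?W" and j: "j \<ge> i" for y j
  proof -
    obtain z where z: "y = z [^]\<^bsub>prod_cyc d\<^esub> (p ^ k)" using y by (auto simp: power_torsion_def)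
    have yj: "y j = p ^ k * z j mod d j" using p0 unfolding z by (simp add: pow_prod_cyc)
    have "[p * (p ^ k * z j mod d j) = p * (p ^ k * z j)] (mod d j)"
      by (intro cong_mult cong_refl) (simp add: cong_def)
    moreover have "[p * (p ^ k * z j mod d j) = 0] (mod d j)"
      using dvd[OF y, of j] unfolding yj by (simp add: cong_0_iff)
    ultimately have "d j dvd p ^ Suc k * z j" by (simp add: cong_def mod_eq_0_iff_dvd mult.assoc)
    moreover have "\<not> p ^ Suc k dvd d j" using ndvd divisor_chain_dvd[OF d j] dvd_trans by blast
    ultimately have "d j dvd p ^ k * z j" using dvd_prime_power_mult_cancel[OF p dpos[of j]] by blast
    then show ?thesis using yj by simp
  qed
  have "inj_on ?q ?W"
  proof (rule inj_onI)
    fix y y' assume y: "y \<in> ?W" and y': "y' \<in> ?W" and eq: "?q y = ?q y'"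
    have "y j = y' j" for j
    proof (cases "j < i")
      case True
      then have "p * y j div d j = p * y' j div d j" using fun_cong[OF eq, of j] by simp
      then have "p * y j = p * y' j" using dvd[OF y, of j] dvd[OF y', of j] by (metis dvd_div_mult_self)
      then show ?thesis using p0 by simp
    next
      case False
      then show ?thesis using tail[OF y] tail[OF y'] by simp
    qed
    then show "y = y'" by blast
  qed
  moreover have "?q ` ?W \<subseteq> PiE {..<i} (\<lambda>_. {..<p})"
  proof -
    have "p * y j div d j < p" if "y \<in> ?W" for y j
      using lt[OF that, of j] p0 by (simp add: less_mult_imp_div_less)
    then show ?thesis by (auto simp: PiE_def)
  qed
  ultimately have "card ?W \<le> card (PiE {..<i} (\<lambda>_. {..<p}))"
    by (rule card_inj_on_le) (simp add: finite_PiE)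
  then show ?thesis by (simp add: card_PiE)
qed

text \<open>For \<open>j \<le> i\<close> the coordinates may be chosen freely among the multiples of
  \<open>d j / p = p ^ k * q j\<close>, each of which is the \<open>p ^ k\<close>-th power of a
  multiple of \<open>q j\<close>.\<close>

lemma card_power_torsion_ge:
  assumes d: "divisor_chain d" and p: "prime p" and dvd: "p ^ Suc k dvd d i"
  shows "p ^ Suc i \<le> card (power_torsion (prod_cyc d) p k)"
proof -
  let ?W = "power_torsion (prod_cyc d) p k"
  have p0: "p > 0" using p prime_gt_0_nat by blast
  have dpos: "d j > 0" for j using divisor_chain_pos[OF d] .
  define q where "q = (\<lambda>j. d j div p ^ Suc k)"
  have q: "d j = p ^ Suc k * q j" if "j \<le> i" for j
    using dvd_trans[OF dvd divisor_chain_dvd[OF d that]] by (simp add: q_def)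
  have q0: "q j > 0" if "j \<le> i" for j using q[OF that] dpos[of j] by (cases "q j") auto
  define y where "y = (\<lambda>c j. if j \<le> i then c j * (p ^ k * q j) else 0)"
  have "inj_on y (PiE {..i} (\<lambda>_. {..<p}))"
  proof (rule inj_onI)
    fix c c' assume c: "c \<in> PiE {..i} (\<lambda>_. {..<p})" "c' \<in> PiE {..i} (\<lambda>_. {..<p})" and eq: "y c = y c'"
    have "c j = c' j" if "j \<le> i" for j
      using fun_cong[OF eq, of j] that q0[OF that] p0 by (simp add: y_def)
    then show "c = c'" using c by (auto intro: PiE_ext)
  qed
  moreover have "y ` PiE {..i} (\<lambda>_. {..<p}) \<subseteq> ?W"
  proof
    fix w assume "w \<in> y ` PiE {..i} (\<lambda>_. {..<p})"
    then obtain c where w: "w = y c" and c: "\<And>j. j \<le> i \<Longrightarrow> c j < p" by auto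
    define z where "z = (\<lambda>j. if j \<le> i then c j * q j else 0)"
    have ylt: "y c j < d j" for j
      using c q q0 dpos[of j] p0 by (auto simp: y_def)
    have "z j \<le> y c j" for j using p0 by (simp add: z_def y_def Suc_le_eq)
    then have zlt: "z j < d j" for j using ylt[of j] by (rule le_less_trans)
    have "d j dvd p * y c j" for j
    proof (cases "j \<le> i")
      case True
      have "p * y c j = d j * c j" using True by (simp add: y_def q[OF True])
      then show ?thesis by simp
    qed (simp add: y_def)
    then have "y c [^]\<^bsub>prod_cyc d\<^esub> p = \<one>\<^bsub>prod_cyc d\<^esub>"
      using p0 by (simp add: pow_prod_cyc one_prod_cyc fun_eq_iff mod_eq_0_iff_dvd)
    moreover have "y c = z [^]\<^bsub>prod_cyc d\<^esub> (p ^ k)"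
    proof
      fix j
      have "(z [^]\<^bsub>prod_cyc d\<^esub> (p ^ k)) j = p ^ k * z j mod d j" using p0 by (simp add: pow_prod_cyc)
      also have "p ^ k * z j = y c j" by (simp add: z_def y_def)
      finally show "y c j = (z [^]\<^bsub>prod_cyc d\<^esub> (p ^ k)) j" using ylt[of j] by simp
    qed
    moreover have "y c \<in> carrier (prod_cyc d)" "z \<in> carrier (prod_cyc d)" using ylt zlt by simp_all
    ultimately show "w \<in> ?W" unfolding power_torsion_def w by blast
  qed
  moreover have "finite ?W" using finite_prod_cyc[OF d] by (simp add: power_torsion_def)
  ultimately have "card (PiE {..i} (\<lambda>_. {..<p})) \<le> card ?W" by (rule card_inj_on_le)
  then show ?thesis by (simp add: card_PiE)
qed

lemma card_power_torsion_mono: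
  assumes "group G" "group H" "h \<in> hom G H" "inj_on h (carrier G)" "finite (carrier H)"
  shows "card (power_torsion G p k) \<le> card (power_torsion H p k)"
proof (rule card_inj_on_le)
  interpret group_hom G H h using assms by (simp add: group_hom_def group_hom_axioms_def)
  show "inj_on h (power_torsion G p k)" 
    using assms(4) by (rule inj_on_subset) (auto simp: power_torsion_def)
  show "finite (power_torsion H p k)" using assms(5) by (simp add: power_torsion_def)
  show "h ` power_torsion G p k \<subseteq> power_torsion H p k"
  proof
    fix w assume "w \<in> h ` power_torsion G p k"
    then obtain y z where y: "w = h y" "y \<in> carrier G" "y [^]\<^bsub>G\<^esub> p = \<one>\<^bsub>G\<^esub>"
      and z: "z \<in> carrier G" "y = z [^]\<^bsub>G\<^esub> (p ^ k)" by (auto simp: power_torsion_def)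
    have "w [^]\<^bsub>H\<^esub> p = \<one>\<^bsub>H\<^esub>" using hom_nat_pow[OF y(2), of p] y by simp
    moreover have "w = h z [^]\<^bsub>H\<^esub> (p ^ k)" using hom_nat_pow[OF z(1), of "p ^ k"] y z by simp
    moreover have "w \<in> carrier H" "h z \<in> carrier H" using y z by auto
    ultimately show "w \<in> power_torsion H p k" unfolding power_torsion_def by blast
  qed
qed

text \<open>If \<open>p ^ (l + 1)\<close> divided \<open>e i\<close> but not \<open>d i\<close>, the
  source would have at least \<open>p ^ (i + 1)\<close> elements in its \<open>power_torsion\<close>
  and the target at most \<open>p ^ i\<close>.\<close>

lemma mono_hom_prod_cyc_imp_dvd:
  assumes e: "divisor_chain e" and d: "divisor_chain d"
    and h: "h \<in> hom (prod_cyc e) (prod_cyc d)" "inj_on h (carrier (prod_cyc e))"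
  shows "e i dvd d i"
proof (rule multiplicity_le_imp_dvd)
  show "e i \<noteq> 0" using divisor_chain_pos[OF e, of i] by simp
  fix p :: nat assume p: "prime p"
  have "p ^ k dvd d i" if k: "p ^ k dvd e i" for k
  proof (cases k)
    case (Suc l)
    show ?thesis
    proof (rule ccontr)
      assume "\<not> p ^ k dvd d i"
      then have "card (power_torsion (prod_cyc d) p l) \<le> p ^ i"
        using card_power_torsion_le[OF d p] Suc by simp
      moreover have "p ^ Suc i \<le> card (power_torsion (prod_cyc e) p l)"
        using card_power_torsion_ge[OF e p] k Suc by simp
      moreover have "card (power_torsion (prod_cyc e) p l) \<le> card (power_torsion (prod_cyc d) p l)"
        using comm_group_prod_cyc[OF e] comm_group_prod_cyc[OF d] h finite_prod_cyc[OF d]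
        by (intro card_power_torsion_mono[of _ _ h]) (auto simp: comm_group_def)
      ultimately have "p ^ Suc i \<le> p ^ i" by linarith
      then show False using p prime_gt_1_nat[OF p] by simp
    qed
  qed simp
  then have "p ^ multiplicity p (e i) dvd d i" using multiplicity_dvd by blast
  then show "multiplicity p (e i) \<le> multiplicity p (d i)"
    using divisor_chain_pos[OF d, of i] p by (intro multiplicity_geI) auto
qed

lemma mono_hom_prod_cyc:
  assumes e: "divisor_chain e" and d: "divisor_chain d" and dvd: "\<And>i. e i dvd d i"
  shows "\<exists>h. h \<in> hom (prod_cyc e) (prod_cyc d) \<and> inj_on h (carrier (prod_cyc e))"
proof (intro exI conjI)
  let ?h = "\<lambda>f i. f i * (d i div e i)"
  have q: "d i div e i > 0" for i
    using dvd[of i] divisor_chain_pos[OF d, of i] by (simp add: dvd_imp_le div_greater_zero_iff)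
      (meson divisor_chain_pos[OF e])
  have de: "d i = e i * (d i div e i)" for i using dvd[of i] by simp
  show "?h \<in> hom (prod_cyc e) (prod_cyc d)"
  proof (rule homI)
    fix f assume "f \<in> carrier (prod_cyc e)"
    then have "f i * (d i div e i) < e i * (d i div e i)" for i using q[of i] by simp
    then show "?h f \<in> carrier (prod_cyc d)" by (simp add: de[symmetric])
  next
    fix f g
    have "(f i + g i) mod e i * (d i div e i) = (f i * (d i div e i) + g i * (d i div e i)) mod d i" for i
      using mod_mult_mult2[of "f i + g i" "d i div e i" "e i"] by (simp add: de[symmetric] add_mult_distrib)
    then show "?h (f \<otimes>\<^bsub>prod_cyc e\<^esub> g) = ?h f \<otimes>\<^bsub>prod_cyc d\<^esub> ?h g"
      by (simp add: mult_prod_cyc)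
  qed
  show "inj_on ?h (carrier (prod_cyc e))"
  proof (rule inj_onI)
    fix f g assume eq: "?h f = ?h g"
    show "f = g"
    proof
      fix i show "f i = g i" using fun_cong[OF eq, of i] q[of i] by simp
    qed
  qed
qed

section \<open>The minimal number of generators\<close>

lemma (in group) mod_hom_on_cong_generate:
  assumes X: "X \<subseteq> carrier G" and f: "mod_hom_on G m (carrier G) f" and g: "mod_hom_on G m (carrier G) g"
    and eq: "\<And>x. x \<in> X \<Longrightarrow> [f x = g x] (mod int m)" and y: "y \<in> generate G X"
  shows "[f y = g y] (mod int m)"
  using y
proof (induction y rule: generate.induct)
  case one
  show ?case using mod_hom_on_one[OF subgroup_self f] mod_hom_on_one[OF subgroup_self g]
    by (metis cong_sym cong_trans)
next
  case (incl h)
  then show ?case by (rule eq)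
next
  case (inv h)
  have h: "h \<in> carrier G" using inv X by blast
  have *: "[u (inv h) + u h = 0] (mod int m)" if "mod_hom_on G m (carrier G) u" for u
  proof -
    have "[u (inv h \<otimes> h) = u (inv h) + u h] (mod int m)"
      using that h inv_closed[OF h] unfolding mod_hom_on_def by blast
    then show ?thesis using mod_hom_on_one[OF subgroup_self that] h
      by (simp add: l_inv) (metis cong_sym cong_trans)
  qed
  have "[f (inv h) + f h = g (inv h) + g h] (mod int m)"
    using *[OF f] *[OF g] by (metis cong_sym cong_trans)
  then have "[f (inv h) + f h - f h = g (inv h) + g h - g h] (mod int m)"
    using eq[OF inv] by (rule cong_diff)
  then show ?case by simp
next
  case (eng h1 h2)
  then have h: "h1 \<in> carrier G" "h2 \<in> carrier G" using generate_in_carrier[OF X] by auto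
  have "[f (h1 \<otimes> h2) = f h1 + f h2] (mod int m)"
    using f h unfolding mod_hom_on_def by blast
  also have "[f h1 + f h2 = g h1 + g h2] (mod int m)" using eng.IH by (rule cong_add)
  also have "[g h1 + g h2 = g (h1 \<otimes> h2)] (mod int m)"
    using g h unfolding mod_hom_on_def by (blast intro: cong_sym)
  finally show ?case .
qed

lemma mod_hom_on_linear_form:
  fixes c :: "nat \<Rightarrow> nat"
  assumes "\<And>i. i \<in> I \<Longrightarrow> p dvd d i"
  shows "mod_hom_on (prod_cyc d) p (carrier (prod_cyc d)) (\<lambda>f. int (\<Sum>i\<in>I. c i * f i))"
  unfolding mod_hom_on_def
proof (intro ballI)
  fix f g
  have "[\<Sum>i\<in>I. c i * ((f i + g i) mod d i) = \<Sum>i\<in>I. c i * (f i + g i)] (mod p)"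
  proof (rule cong_sum)
    fix i assume "i \<in> I"
    have "[(f i + g i) mod d i = f i + g i] (mod d i)" by (simp add: cong_def)
    then have "[(f i + g i) mod d i = f i + g i] (mod p)"
      using assms[OF \<open>i \<in> I\<close>] by (rule cong_dvd_modulus_nat)
    then show "[c i * ((f i + g i) mod d i) = c i * (f i + g i)] (mod p)"
      by (intro cong_mult cong_refl)
  qed
  then have "[int (\<Sum>i\<in>I. c i * ((f i + g i) mod d i)) = int (\<Sum>i\<in>I. c i * (f i + g i))] (mod int p)"
    by (simp only: cong_int_iff)
  then show "[int (\<Sum>i\<in>I. c i * (f \<otimes>\<^bsub>prod_cyc d\<^esub> g) i) =
      int (\<Sum>i\<in>I. c i * f i) + int (\<Sum>i\<in>I. c i * g i)] (mod int p)"
    by (simp add: mult_prod_cyc add_mult_distrib2 sum.distrib)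
qed

text \<open>If a prime \<open>p\<close> divides \<open>d r\<close>, there are \<open>p ^ (r + 1)\<close> linear forms modulo \<open>p\<close> in the first \<open>r + 1\<close>
  coordinates, and each is determined by its values on the at most \<open>r\<close> generators.\<close>

lemma generate_prod_cyc_trivial_above:
  assumes d: "divisor_chain d" and X: "X \<subseteq> carrier (prod_cyc d)" "finite X" "card X \<le> r"
    and gen: "generate (prod_cyc d) X = carrier (prod_cyc d)"
  shows "d r = 1"
proof (rule ccontr)
  assume "d r \<noteq> 1"
  then obtain p where p: "prime p" "p dvd d r" using prime_factor_nat by blast
  have p1: "p > 1" using p prime_gt_1_nat by blast
  have pd: "p dvd d i" if "i \<le> r" for i
    using dvd_trans[OF p(2) divisor_chain_dvd[OF d that]] .
  interpret P: comm_group "prod_cyc d" by (rule comm_group_prod_cyc[OF d])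
  let ?L = "\<lambda>c f. \<Sum>i\<in>{..r}. c i * f i :: nat"
  let ?C = "PiE {..r} (\<lambda>_. {..<p})"
  let ?h = "\<lambda>c. restrict (\<lambda>f. ?L c f mod p) X"
  have "inj_on ?h ?C"
  proof (rule inj_onI)
    fix c c' assume c: "c \<in> ?C" "c' \<in> ?C" and eq: "?h c = ?h c'"
    have X_eq: "[int (?L c x) = int (?L c' x)] (mod int p)" if "x \<in> X" for x
      using fun_cong[OF eq, of x] that unfolding cong_int_iff by (simp add: cong_def)
    have all: "[?L c f = ?L c' f] (mod p)" if "f \<in> carrier (prod_cyc d)" for f
      unfolding cong_int_iff[symmetric]
      by (rule P.mod_hom_on_cong_generate[OF X(1) mod_hom_on_linear_form mod_hom_on_linear_form X_eq])
        (use that pd gen in auto)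
    have "c i = c' i" if i: "i \<le> r" for i
    proof -
      let ?e = "\<lambda>j. if j = i then 1 else 0 :: nat"
      have "d i > 1" using pd[OF i] p1 divisor_chain_pos[OF d, of i] dvd_imp_le[of p "d i"] by linarith
      then have "?e \<in> carrier (prod_cyc d)" using divisor_chain_pos[OF d] by simp
      from all[OF this] have "[c i = c' i] (mod p)" using i by (simp add: if_distrib sum.delta cong: if_cong)
      moreover have "c i < p" "c' i < p" using c i by auto
      ultimately show ?thesis by (simp add: cong_def)
    qed
    then show "c = c'" using c by (auto intro: PiE_ext)
  qed
  moreover have "?h ` ?C \<subseteq> PiE X (\<lambda>_. {..<p})" using p1 by auto
  ultimately have "card ?C \<le> card (PiE X (\<lambda>_. {..<p}))"
    by (rule card_inj_on_le) (use X in \<open>simp add: finite_PiE\<close>)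
  then have "p ^ Suc r \<le> p ^ card X" using X by (simp add: card_PiE)
  then have "Suc r \<le> card X" using p1 by (metis power_le_imp_le_exp)
  then show False using X(3) by simp
qed

text \<open>Writing \<open>1 mod d n\<close> keeps the unit vector in the carrier for trivial
  factors. An element is assembled from its truncations: the \<open>f n\<close>-th power of
  \<open>u n\<close> supplies coordinate \<open>n\<close>.\<close>

lemma generate_prod_cyc_units:
  assumes d: "divisor_chain d" and r: "\<And>i. i \<ge> r \<Longrightarrow> d i = 1"
  defines "u \<equiv> \<lambda>n i. if i = n then 1 mod d n else 0 :: nat"
  shows "u ` {..<r} \<subseteq> carrier (prod_cyc d)" "generate (prod_cyc d) (u ` {..<r}) = carrier (prod_cyc d)"
proof -
  interpret P: comm_group "prod_cyc d" by (rule comm_group_prod_cyc[OF d])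
  have dpos: "d i > 0" for i using divisor_chain_pos[OF d] .
  have "u n i < d i" for n i
    using dpos[of i] mod_less_divisor[OF dpos[of n], of 1]
    by (cases "i = n") (simp_all only: u_def if_True if_False simp_thms)
  then show sub: "u ` {..<r} \<subseteq> carrier (prod_cyc d)" by auto
  let ?S = "generate (prod_cyc d) (u ` {..<r})"
  have S: "subgroup ?S (prod_cyc d)" by (rule P.generate_is_subgroup[OF sub])
  show "?S = carrier (prod_cyc d)"
  proof (intro subset_antisym subsetI)
    fix f assume "f \<in> ?S" then show "f \<in> carrier (prod_cyc d)" using P.generate_in_carrier[OF sub] by blast
  next
    fix f assume f: "f \<in> carrier (prod_cyc d)"
    have "(\<lambda>i. if i < n then f i else 0) \<in> ?S" if "n \<le> r" for n
      using that
    proof (induction n)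
      case 0
      then show ?case using subgroup.one_closed[OF S] by (simp add: one_prod_cyc)
    next
      case (Suc n)
      have "u n \<in> ?S" using Suc.prems by (intro generate.incl) auto
      then have "u n [^]\<^bsub>prod_cyc d\<^esub> f n \<in> ?S" by (rule P.subgroup_nat_pow_closed[OF S])
      then have "(\<lambda>i. if i < n then f i else 0) \<otimes>\<^bsub>prod_cyc d\<^esub> (u n [^]\<^bsub>prod_cyc d\<^esub> f n) \<in> ?S"
        using Suc subgroup.m_closed[OF S] by simp
      also have "(\<lambda>i. if i < n then f i else 0) \<otimes>\<^bsub>prod_cyc d\<^esub> (u n [^]\<^bsub>prod_cyc d\<^esub> f n) =
          (\<lambda>i. if i < Suc n then f i else 0)"
      proof
        fix i
        have fi: "f i mod d i = f i" for i using f by simp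
        have "f n * (1 mod d n) mod d n = f n" using fi by (simp add: mod_mult_right_eq del: One_nat_def)
        then show "((\<lambda>i. if i < n then f i else 0) \<otimes>\<^bsub>prod_cyc d\<^esub> (u n [^]\<^bsub>prod_cyc d\<^esub> f n)) i =
            (if i < Suc n then f i else 0)"
          using fi by (cases i n rule: linorder_cases)
            (simp_all add: mult_prod_cyc pow_prod_cyc u_def del: One_nat_def)
      qed
      finally show ?case .
    qed
    from this[of r] have "(\<lambda>i. if i < r then f i else 0) \<in> ?S" by simp
    moreover have "(\<lambda>i. if i < r then f i else 0) = f"
    proof
      fix i
      have "f i < d i" using f by simp
      then show "(if i < r then f i else 0) = f i" using r[of i] by (cases "i < r") auto
    qed
    ultimately show "f \<in> ?S" by simp
  qed
qed

lemma group_rank_le_iff: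
  assumes "group G" "finite (carrier G)"
  shows "group_rank G \<le> r \<longleftrightarrow> (\<exists>X. X \<subseteq> carrier G \<and> card X \<le> r \<and> generate G X = carrier G)"
proof
  interpret group G by fact
  let ?Q = "\<lambda>d. \<exists>X. X \<subseteq> carrier G \<and> finite X \<and> card X = d \<and> generate G X = carrier G"
  have "generate G (carrier G) = carrier G"
    using generate_in_carrier[of "carrier G"] by (auto intro: generate.incl)
  then have "?Q (card (carrier G))" using assms(2) by blast
  then have "?Q (group_rank G)" unfolding group_rank_def by (rule LeastI)
  then obtain X where X: "X \<subseteq> carrier G" "card X = group_rank G" "generate G X = carrier G"
    by (elim exE conjE)
  show "\<exists>X. X \<subseteq> carrier G \<and> card X \<le> r \<and> generate G X = carrier G" if "group_rank G \<le> r"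
    using X that by (intro exI[of _ X]) simp
  show "group_rank G \<le> r" if ex: "\<exists>X. X \<subseteq> carrier G \<and> card X \<le> r \<and> generate G X = carrier G"
  proof -
    obtain X where X: "X \<subseteq> carrier G" "card X \<le> r" "generate G X = carrier G"
      using ex by (elim exE conjE)
    then have "?Q (card X)" using finite_subset[OF X(1) assms(2)] by (intro exI[of _ X]) simp
    then have "group_rank G \<le> card X" unfolding group_rank_def by (rule Least_le)
    then show ?thesis using X by simp
  qed
qed

lemma group_rank_prod_cyc_le_iff:
  assumes d: "divisor_chain d" and G: "group G" and iso: "prod_cyc d \<cong> G"
  shows "group_rank G \<le> r \<longleftrightarrow> (\<forall>i\<ge>r. d i = 1)"
proof -
  interpret P: comm_group "prod_cyc d" by (rule comm_group_prod_cyc[OF d])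
  obtain \<phi> where \<phi>: "\<phi> \<in> iso (prod_cyc d) G" using iso unfolding is_iso_def by blast
  then obtain \<psi> where \<psi>: "\<psi> \<in> iso G (prod_cyc d)" using P.iso_set_sym by blast
  interpret \<phi>: group_hom "prod_cyc d" G \<phi>
    using \<phi> G by (simp add: group_hom_def group_hom_axioms_def P.group_axioms iso_def)
  interpret \<psi>: group_hom G "prod_cyc d" \<psi>
    using \<psi> G by (simp add: group_hom_def group_hom_axioms_def P.group_axioms iso_def)
  have im: "\<phi> ` carrier (prod_cyc d) = carrier G" "\<psi> ` carrier G = carrier (prod_cyc d)"
    using \<phi> \<psi> by (auto simp: iso_def bij_betw_def)
  have fin: "finite (carrier G)" using finite_prod_cyc[OF d] im(1) by (metis finite_imageI)
  show ?thesis
    unfolding group_rank_le_iff[OF G fin]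
  proof
    assume "\<exists>X. X \<subseteq> carrier G \<and> card X \<le> r \<and> generate G X = carrier G"
    then obtain X where X: "X \<subseteq> carrier G" "card X \<le> r" "generate G X = carrier G" by blast
    have finX: "finite X" using finite_subset[OF X(1) fin] .
    have gen: "generate (prod_cyc d) (\<psi> ` X) = carrier (prod_cyc d)"
      using \<psi>.generate_img[OF X(1)] X(3) im(2) by simp
    show "\<forall>i\<ge>r. d i = 1"
    proof (intro allI impI)
      fix i assume "r \<le> i"
      show "d i = 1"
      proof (rule generate_prod_cyc_trivial_above[OF d _ _ _ gen])
        show "\<psi> ` X \<subseteq> carrier (prod_cyc d)" using X(1) im(2) by blast
        show "card (\<psi> ` X) \<le> i" using card_image_le[OF finX, of \<psi>] X(2) \<open>r \<le> i\<close> by linarith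
      qed (use finX in simp)
    qed
  next
    assume r: "\<forall>i\<ge>r. d i = 1"
    let ?u = "\<lambda>n i. if i = n then 1 mod d n else 0 :: nat"
    let ?X = "\<phi> ` ?u ` {..<r}"
    have u: "?u ` {..<r} \<subseteq> carrier (prod_cyc d)" "generate (prod_cyc d) (?u ` {..<r}) = carrier (prod_cyc d)"
      by (rule generate_prod_cyc_units[OF d], use r in blast)+
    have "?X \<subseteq> carrier G" using image_mono[OF u(1), of \<phi>] unfolding im(1) .
    moreover have "card ?X \<le> r"
      using card_image_le[of "?u ` {..<r}" \<phi>] card_image_le[of "{..<r}" ?u]
      by (simp del: One_nat_def)
    moreover have "generate G ?X = carrier G"
      using \<phi>.generate_img[OF u(1)] u(2) im(1) by simp
    ultimately show "\<exists>X. X \<subseteq> carrier G \<and> card X \<le> r \<and> generate G X = carrier G" by blast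
  qed
qed

subsection \<open>Isomorphism classes\<close>

lemma comm_group_of_mono_hom:
  assumes "group H" "comm_group G" "h \<in> hom H G" "inj_on h (carrier H)"
  shows "comm_group H"
proof (rule group.group_comm_groupI[OF assms(1)])
  interpret G: comm_group G by fact
  interpret H: group H by fact
  fix x y assume xy: "x \<in> carrier H" "y \<in> carrier H"
  have "h x \<in> carrier G" "h y \<in> carrier G" using assms(3) xy by (auto simp: hom_def)
  then have "h (x \<otimes>\<^bsub>H\<^esub> y) = h (y \<otimes>\<^bsub>H\<^esub> x)"
    using assms(3) xy by (simp add: hom_def G.m_comm)
  then show "x \<otimes>\<^bsub>H\<^esub> y = y \<otimes>\<^bsub>H\<^esub> x"
    using assms(4) xy by (meson H.m_closed inj_onD)
qed

lemma iso_subgroup_iff_mono_hom: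
  assumes "group H" "group G"
  shows "(\<exists>K. subgroup K G \<and> H \<cong> G\<lparr>carrier := K\<rparr>) \<longleftrightarrow> (\<exists>h. h \<in> hom H G \<and> inj_on h (carrier H))"
proof
  assume "\<exists>K. subgroup K G \<and> H \<cong> G\<lparr>carrier := K\<rparr>"
  then obtain K h where K: "subgroup K G" and h: "h \<in> iso H (G\<lparr>carrier := K\<rparr>)"
    unfolding is_iso_def by blast
  have "h \<in> hom H G" using h subgroup.subset[OF K] by (auto simp: iso_def hom_def)
  then show "\<exists>h. h \<in> hom H G \<and> inj_on h (carrier H)" using h by (auto simp: iso_def bij_betw_def)
next
  assume "\<exists>h. h \<in> hom H G \<and> inj_on h (carrier H)"
  then obtain h where h: "h \<in> hom H G" "inj_on h (carrier H)" by blast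
  interpret group_hom H G h using assms h by (simp add: group_hom_def group_hom_axioms_def)
  have "h \<in> iso H (G\<lparr>carrier := h ` carrier H\<rparr>)"
    using h by (auto simp: iso_def hom_def bij_betw_def)
  then show "\<exists>K. subgroup K G \<and> H \<cong> G\<lparr>carrier := K\<rparr>"
    using img_is_subgroup unfolding is_iso_def by blast
qed

lemma iso_imp_mono_hom:
  assumes "G \<cong> H"
  obtains h where "h \<in> hom G H" "inj_on h (carrier G)"
  using assms unfolding is_iso_def iso_def bij_betw_def by blast

lemma mono_hom_compose:
  assumes "f \<in> hom G H" "inj_on f (carrier G)" "g \<in> hom H I" "inj_on g (carrier H)"
  shows "g \<circ> f \<in> hom G I" "inj_on (g \<circ> f) (carrier G)"
proof -
  show "g \<circ> f \<in> hom G I" using assms(1,3) by (rule hom_compose)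
  have "f ` carrier G \<subseteq> carrier H" using assms(1) by (auto simp: hom_def)
  then show "inj_on (g \<circ> f) (carrier G)" using assms(2,4) by (meson comp_inj_on inj_on_subset)
qed

lemma mono_hom_iff_dvd:
  assumes e: "divisor_chain e" and d: "divisor_chain d"
    and H: "group H" "prod_cyc e \<cong> H" and G: "group G" "prod_cyc d \<cong> G"
  shows "(\<exists>h. h \<in> hom H G \<and> inj_on h (carrier H)) \<longleftrightarrow> (\<forall>i. e i dvd d i)"
proof -
  interpret E: comm_group "prod_cyc e" by (rule comm_group_prod_cyc[OF e])
  interpret D: comm_group "prod_cyc d" by (rule comm_group_prod_cyc[OF d])
  obtain a where a: "a \<in> hom (prod_cyc e) H" "inj_on a (carrier (prod_cyc e))"
    using iso_imp_mono_hom[OF H(2)] .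
  obtain a' where a': "a' \<in> hom H (prod_cyc e)" "inj_on a' (carrier H)"
    using iso_imp_mono_hom[OF E.iso_sym[OF H(2)]] .
  obtain b where b: "b \<in> hom (prod_cyc d) G" "inj_on b (carrier (prod_cyc d))"
    using iso_imp_mono_hom[OF G(2)] .
  obtain b' where b': "b' \<in> hom G (prod_cyc d)" "inj_on b' (carrier G)"
    using iso_imp_mono_hom[OF D.iso_sym[OF G(2)]] .
  show ?thesis
  proof
    assume "\<exists>h. h \<in> hom H G \<and> inj_on h (carrier H)"
    then obtain h where h: "h \<in> hom H G" "inj_on h (carrier H)" by blast
    note c1 = mono_hom_compose[OF a h]
    show "\<forall>i. e i dvd d i"
      using mono_hom_prod_cyc_imp_dvd[OF e d mono_hom_compose[OF c1 b']] by blast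
  next
    assume "\<forall>i. e i dvd d i"
    then obtain h where h: "h \<in> hom (prod_cyc e) (prod_cyc d)" "inj_on h (carrier (prod_cyc e))"
      using mono_hom_prod_cyc[OF e d] by blast
    note c1 = mono_hom_compose[OF a' h]
    show "\<exists>h. h \<in> hom H G \<and> inj_on h (carrier H)"
      using mono_hom_compose[OF c1 b] by blast
  qed
qed

text \<open>The identity map of \<open>G\<close> is an embedding, so the divisibility criterion
  applies in both directions: uniqueness of the invariant factors is a by-product of the embedding
  criterion.\<close>

lemma iso_imp_eq_divisor_chain:
  assumes "divisor_chain e" "divisor_chain d" "group G" "prod_cyc e \<cong> G" "prod_cyc d \<cong> G"
  shows "e = d"
proof
  fix i
  have h: "\<exists>h. h \<in> hom G G \<and> inj_on h (carrier G)" by (intro exI[of _ "\<lambda>x. x"]) (auto simp: hom_def)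
  have "e i dvd d i" using mono_hom_iff_dvd[OF assms(1,2,3,4,3,5)] h by blast
  moreover have "d i dvd e i" using mono_hom_iff_dvd[OF assms(2,1,3,5,3,4)] h by blast
  ultimately show "e i = d i" by (rule dvd_antisym)
qed

definition group_type :: "('a, 'b) monoid_scheme \<Rightarrow> nat \<Rightarrow> nat" where
  "group_type G = (THE d. divisor_chain d \<and> prod_cyc d \<cong> G)"

lemma group_type:
  assumes "comm_group G" "finite (carrier G)"
  shows "divisor_chain (group_type G)" "prod_cyc (group_type G) \<cong> G"
proof -
  have "\<exists>!d. divisor_chain d \<and> prod_cyc d \<cong> G"
    using finite_comm_group_iso_prod_cyc[OF assms] iso_imp_eq_divisor_chain assms(1)
    by (metis comm_group.axioms(2))
  from theI'[OF this] show "divisor_chain (group_type G)" "prod_cyc (group_type G) \<cong> G"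
    unfolding group_type_def by blast+
qed

lemma group_type_eqI:
  assumes "divisor_chain d" "group G" "prod_cyc d \<cong> G"
  shows "group_type G = d"
  unfolding group_type_def
  by (rule the_equality) (use assms iso_imp_eq_divisor_chain in blast)+

lemma iso_iff_group_type_eq:
  assumes "comm_group G" "finite (carrier G)" "comm_group H" "finite (carrier H)"
  shows "G \<cong> H \<longleftrightarrow> group_type G = group_type H"
proof
  have G: "group G" "group H" using assms by (simp_all add: comm_group_def)
  assume "G \<cong> H"
  then have "prod_cyc (group_type G) \<cong> H" using group_type(2)[OF assms(1,2)] iso_trans by blast
  then show "group_type G = group_type H"
    using group_type_eqI[OF group_type(1)[OF assms(1,2)] G(2)] by simp
next
  interpret P: comm_group "prod_cyc (group_type G)"
    by (rule comm_group_prod_cyc[OF group_type(1)[OF assms(1,2)]])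
  assume "group_type G = group_type H"
  then have "prod_cyc (group_type G) \<cong> H" using group_type(2)[OF assms(3,4)] by simp
  then show "G \<cong> H" using P.iso_sym[OF group_type(2)[OF assms(1,2)]] iso_trans by blast
qed

text \<open>\<open>iso_classes\<close> ranges over groups on natural numbers, so a group such as
  \<open>prod_cyc e\<close> has to be copied to \<open>nat\<close> before it can represent a
  class.\<close>

lemma ex_nat_group_iso:
  assumes "group G" "finite (carrier G)"
  shows "\<exists>H :: nat monoid. group H \<and> G \<cong> H"
proof -
  interpret group G by fact
  obtain f :: "'a \<Rightarrow> nat" where f: "inj_on f (carrier G)"
    using finite_imp_inj_to_nat_seg[OF assms(2)] by blast
  let ?g = "inv_into (carrier G) f"
  let ?H = "\<lparr>carrier = f ` carrier G, monoid.mult = (\<lambda>a b. f (?g a \<otimes>\<^bsub>G\<^esub> ?g b)), one = f \<one>\<^bsub>G\<^esub>\<rparr>"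
  have "f \<in> iso G ?H" using f by (auto simp: iso_def hom_def bij_betw_def)
  moreover from iso_imp_img_group[OF this] have "group ?H" by simp
  ultimately show ?thesis unfolding is_iso_def by blast
qed

text \<open>A complete invariant \<open>T\<close> makes the classes its fibres, so that classes are
  counted, and sums over them indexed, by values of \<open>T\<close>.\<close>

lemma bij_betw_iso_classes:
  assumes T: "\<And>G H. G \<in> S \<Longrightarrow> H \<in> S \<Longrightarrow> G \<cong> H \<longleftrightarrow> T G = T H"
  shows "bij_betw (\<lambda>t. {H \<in> S. T H = t}) (T ` S) (iso_classes S)"
proof -
  have "{(G, H). G \<in> S \<and> H \<in> S \<and> G \<cong> H} `` {G} = {H \<in> S. T H = T G}" if "G \<in> S" for G
    using T[OF that] that by auto
  then have "iso_classes S = (\<lambda>G. {H \<in> S. T H = T G}) ` S"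
    unfolding iso_classes_def quotient_def by auto
  also have "\<dots> = (\<lambda>t. {H \<in> S. T H = t}) ` T ` S" by (simp add: image_image)
  finally show ?thesis by (auto simp: bij_betw_def inj_on_def)
qed

lemma num_subgroup_classes_eq:
  assumes G: "comm_group G" "finite (carrier G)"
  shows "num_subgroup_classes G = card {e. divisor_chain e \<and> (\<forall>i. e i dvd group_type G i)}"
proof -
  let ?S = "{H :: nat monoid. group H \<and> (\<exists>K. subgroup K G \<and> H \<cong> G\<lparr>carrier := K\<rparr>)}"
  have G': "group G" using G(1) by (simp add: comm_group_def)
  have S: "H \<in> ?S \<longleftrightarrow> group H \<and> (\<exists>h. h \<in> hom H G \<and> inj_on h (carrier H))" for H
    using iso_subgroup_iff_mono_hom[OF _ G'] by auto
  \<comment> \<open>Groups that embed into \<open>G\<close> inherit finiteness and commutativity, so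
    \<open>group_type\<close> classifies them.\<close>
  have SC: "comm_group H \<and> finite (carrier H)" if H: "H \<in> ?S" for H
  proof -
    obtain h where h: "h \<in> hom H G" "inj_on h (carrier H)" "group H"
      using H unfolding S by blast
    have "h ` carrier H \<subseteq> carrier G" using h by (auto simp: hom_def)
    then have "finite (carrier H)" using G(2) h(2) by (meson finite_imageD finite_subset)
    then show ?thesis using comm_group_of_mono_hom[OF h(3) G(1) h(1,2)] by blast
  qed
  have "H \<cong> H' \<longleftrightarrow> group_type H = group_type H'" if "H \<in> ?S" "H' \<in> ?S" for H H'
    using SC[OF that(1)] SC[OF that(2)] by (intro iso_iff_group_type_eq) auto
  then have "card (iso_classes ?S) = card (group_type ` ?S)"
    by (metis (no_types, lifting) bij_betw_iso_classes bij_betw_same_card)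
  also have "group_type ` ?S = {e. divisor_chain e \<and> (\<forall>i. e i dvd group_type G i)}"
  proof (intro subset_antisym subsetI)
    fix e assume "e \<in> group_type ` ?S"
    then obtain H where H: "H \<in> ?S" "e = group_type H" by blast
    have HC: "comm_group H" "finite (carrier H)" using SC[OF H(1)] by auto
    have "\<exists>h. h \<in> hom H G \<and> inj_on h (carrier H)" "group H" using H(1) unfolding S by blast+
    then show "e \<in> {e. divisor_chain e \<and> (\<forall>i. e i dvd group_type G i)}"
      using mono_hom_iff_dvd[OF group_type(1)[OF HC] group_type(1)[OF G] _ group_type(2)[OF HC] G' group_type(2)[OF G]]
        group_type(1)[OF HC] H(2) by blast
  next
    fix e assume "e \<in> {e. divisor_chain e \<and> (\<forall>i. e i dvd group_type G i)}"
    then have e: "divisor_chain e" "\<forall>i. e i dvd group_type G i" by auto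
    have "group (prod_cyc e)" using comm_group_prod_cyc[OF e(1)] by (simp add: comm_group_def)
    then obtain H :: "nat monoid" where H: "group H" "prod_cyc e \<cong> H"
      using ex_nat_group_iso finite_prod_cyc[OF e(1)] by blast
    have "\<exists>h. h \<in> hom H G \<and> inj_on h (carrier H)"
      using mono_hom_iff_dvd[OF e(1) group_type(1)[OF G] H G' group_type(2)[OF G]] e(2) by blast
    then have "H \<in> ?S" unfolding S using H by blast
    then show "e \<in> group_type ` ?S" using group_type_eqI[OF e(1) H] by blast
  qed
  finally show ?thesis unfolding num_subgroup_classes_def .
qed

lemma group_type_image_abelian_groups:
  "group_type ` abelian_groups r n = {d. divisor_chain d \<and> (\<forall>i\<ge>r. d i = 1) \<and> (\<Prod>i<r. d i) = n}"
proof (intro subset_antisym subsetI)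
  fix d assume "d \<in> group_type ` abelian_groups r n"
  then obtain G :: "nat monoid" where G: "comm_group G" "finite (carrier G)" "card (carrier G) = n" "group_rank G \<le> r"
    and d: "d = group_type G" unfolding abelian_groups_def by blast
  have dG: "divisor_chain d" "prod_cyc d \<cong> G" using group_type[OF G(1,2)] d by auto
  have "group G" using G(1) by (simp add: comm_group_def)
  then have r: "\<forall>i\<ge>r. d i = 1" using group_rank_prod_cyc_le_iff[OF dG(1) _ dG(2)] G(4) by blast
  then have "(\<Prod>i<r. d i) = n" using card_prod_cyc[OF r] iso_same_card[OF dG(2)] G(3) by simp
  then show "d \<in> {d. divisor_chain d \<and> (\<forall>i\<ge>r. d i = 1) \<and> (\<Prod>i<r. d i) = n}" using dG r by blast
next
  fix d assume "d \<in> {d. divisor_chain d \<and> (\<forall>i\<ge>r. d i = 1) \<and> (\<Prod>i<r. d i) = n}"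
  then have d: "divisor_chain d" "\<forall>i\<ge>r. d i = 1" "(\<Prod>i<r. d i) = n" by auto
  interpret P: comm_group "prod_cyc d" by (rule comm_group_prod_cyc[OF d(1)])
  obtain G :: "nat monoid" where G: "group G" "prod_cyc d \<cong> G"
    using ex_nat_group_iso[OF P.group_axioms] finite_prod_cyc[OF d(1)] by blast
  have C: "card (carrier G) = n" "finite (carrier G)"
    using card_prod_cyc[OF d(2)] iso_same_card[OF G(2)] G(2) d(3)
    by (auto simp: is_iso_def iso_def dest: bij_betw_finite)
  obtain h where h: "h \<in> hom G (prod_cyc d)" "inj_on h (carrier G)"
    using iso_imp_mono_hom[OF P.iso_sym[OF G(2)]] .
  have "comm_group G" by (rule comm_group_of_mono_hom[OF G(1) P.comm_group_axioms h])
  moreover have "group_rank G \<le> r" using group_rank_prod_cyc_le_iff[OF d(1) G] d(2) by blast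
  ultimately have "G \<in> abelian_groups r n" using C unfolding abelian_groups_def by blast
  then show "d \<in> group_type ` abelian_groups r n" using group_type_eqI[OF d(1) G] by blast
qed

section \<open>The coefficients as numbers of pairs of chains\<close>

definition chain_pairs :: "nat \<Rightarrow> nat \<Rightarrow> ((nat \<Rightarrow> nat) \<times> (nat \<Rightarrow> nat)) set" where
  "chain_pairs r n = {(d, e). divisor_chain d \<and> (\<forall>i\<ge>r. d i = 1) \<and> (\<Prod>i<r. d i) = n \<and>
     divisor_chain e \<and> (\<forall>i. e i dvd d i)}"

lemma finite_divisor_chains_dvd:
  assumes "divisor_chain d"
  shows "finite {e. divisor_chain e \<and> (\<forall>i. e i dvd d i)}"
proof -
  obtain N where N: "\<forall>i\<ge>N. d i = 1" using assms unfolding divisor_chain_def by blast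
  have "{e. divisor_chain e \<and> (\<forall>i. e i dvd d i)} \<subseteq> {e. \<forall>i. (i \<in> {..<N} \<longrightarrow> e i \<in> {..d 0}) \<and> (i \<notin> {..<N} \<longrightarrow> e i = 1)}"
  proof
    fix e assume "e \<in> {e. divisor_chain e \<and> (\<forall>i. e i dvd d i)}"
    then have e: "e i dvd d i" for i by auto
    have "e i \<le> d 0" for i
      using dvd_trans[OF e divisor_chain_dvd[OF assms]] divisor_chain_pos[OF assms, of 0] by (meson dvd_imp_le zero_le)
    moreover have "e i = 1" if "i \<ge> N" for i using e[of i] N that by simp
    ultimately show "e \<in> {e. \<forall>i. (i \<in> {..<N} \<longrightarrow> e i \<in> {..d 0}) \<and> (i \<notin> {..<N} \<longrightarrow> e i = 1)}" by simp
  qed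
  then show ?thesis by (rule finite_subset) (rule finite_set_of_finite_funs, auto)
qed

lemma finite_divisor_chains:
  "finite {d. divisor_chain d \<and> (\<forall>i\<ge>r. d i = 1) \<and> (\<Prod>i<r. d i) = n}"
proof -
  have "{d. divisor_chain d \<and> (\<forall>i\<ge>r. d i = 1) \<and> (\<Prod>i<r. d i) = n} \<subseteq>
      {d. \<forall>i. (i \<in> {..<r} \<longrightarrow> d i \<in> {..n}) \<and> (i \<notin> {..<r} \<longrightarrow> d i = 1)}"
  proof
    fix d assume "d \<in> {d. divisor_chain d \<and> (\<forall>i\<ge>r. d i = 1) \<and> (\<Prod>i<r. d i) = n}"
    then have d: "divisor_chain d" "\<forall>i\<ge>r. d i = 1" "(\<Prod>i<r. d i) = n" by auto
    have "n > 0" using d(3) divisor_chain_pos[OF d(1)] by (metis prod_pos)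
    moreover have "d i dvd n" if "i < r" for i using that d(3) by (metis dvd_prodI finite_lessThan lessThan_iff)
    ultimately have "d i \<le> n" if "i < r" for i using that dvd_imp_le by blast
    then show "d \<in> {d. \<forall>i. (i \<in> {..<r} \<longrightarrow> d i \<in> {..n}) \<and> (i \<notin> {..<r} \<longrightarrow> d i = 1)}" using d(2) by simp
  qed
  then show ?thesis by (rule finite_subset) (rule finite_set_of_finite_funs, auto)
qed

theorem A_sum_eq_card_chain_pairs: "A_sum r n = card (chain_pairs r n)"
proof -
  let ?S = "abelian_groups r n"
  let ?D = "{d. divisor_chain d \<and> (\<forall>i\<ge>r. d i = 1) \<and> (\<Prod>i<r. d i) = n}"
  let ?E = "\<lambda>d. {e. divisor_chain e \<and> (\<forall>i. e i dvd d i)}"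
  let ?B = "\<lambda>t. {H \<in> ?S. group_type H = t}"
  have S: "comm_group G" "finite (carrier G)" if "G \<in> ?S" for G
    using that by (auto simp: abelian_groups_def)
  have "bij_betw ?B (group_type ` ?S) (iso_classes ?S)"
    by (rule bij_betw_iso_classes) (use S in \<open>intro iso_iff_group_type_eq, auto\<close>)
  then have "A_sum r n = (\<Sum>t\<in>group_type ` ?S. num_subgroup_classes (SOME G. G \<in> ?B t))"
    unfolding A_sum_def by (rule sum.reindex_bij_betw[symmetric])
  also have "\<dots> = (\<Sum>t\<in>?D. card (?E t))"
  proof (rule sum.cong[OF group_type_image_abelian_groups])
    fix t assume "t \<in> ?D"
    then have "t \<in> group_type ` ?S" by (simp only: group_type_image_abelian_groups)
    then have "\<exists>G. G \<in> ?B t" by blast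
    \<comment> \<open>The members of a class share their type \<open>t\<close>, so the value below
      is the same for every choice of representative.\<close>
    then have "(SOME G. G \<in> ?B t) \<in> ?B t" by (rule someI_ex)
    then have "(SOME G. G \<in> ?B t) \<in> ?S" "group_type (SOME G. G \<in> ?B t) = t" by simp_all
    then show "num_subgroup_classes (SOME G. G \<in> ?B t) = card (?E t)"
      using num_subgroup_classes_eq[OF S] by metis
  qed
  also have "\<dots> = card (Sigma ?D ?E)"
    using finite_divisor_chains finite_divisor_chains_dvd by (intro card_SigmaI[symmetric]) auto
  also have "Sigma ?D ?E = chain_pairs r n" unfolding chain_pairs_def by auto
  finally show ?thesis .
qed

subsection \<open>Pairs of partitions\<close>

text \<open>A partition is a weakly decreasing sequence, and \<open>m\<close> lies inside
  \<open>l\<close> as a Young diagram. Such pairs are the exponents of one prime in a pair of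
  chains.\<close>

definition part_pairs :: "nat \<Rightarrow> nat \<Rightarrow> ((nat \<Rightarrow> nat) \<times> (nat \<Rightarrow> nat)) set" where
  "part_pairs r a = {(l, m). (\<forall>i. l (Suc i) \<le> l i) \<and> (\<forall>i\<ge>r. l i = 0) \<and> (\<Sum>i<r. l i) = a \<and>
     (\<forall>i. m (Suc i) \<le> m i) \<and> (\<forall>i. m i \<le> l i)}"

lemma prod_primes_power_multiplicity:
  fixes n x :: nat
  assumes "n > 0" "x dvd n"
  shows "(\<Prod>p\<in>prime_factors n. p ^ multiplicity p x) = x"
proof (rule multiplicity_eq_nat)
  have x: "x > 0" using assms by (meson dvd_pos_nat)
  then show "x > 0" .
  show "(\<Prod>p\<in>prime_factors n. p ^ multiplicity p x) > 0"
    by (rule prod_pos) (auto intro: prime_gt_0_nat in_prime_factors_imp_prime)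
  fix q :: nat assume q: "prime q"
  have "multiplicity q (\<Prod>p\<in>prime_factors n. p ^ multiplicity p x) =
      (if q \<in> prime_factors n then multiplicity q x else 0)"
    using q by (intro multiplicity_prod_prime_powers) auto
  also have "\<dots> = multiplicity q x"
  proof -
    have "multiplicity q x = 0" if "\<not> q dvd n"
      using that assms(2) dvd_trans by (metis not_dvd_imp_multiplicity_0)
    then show ?thesis using q assms(1) by (auto simp: prime_factors_dvd)
  qed
  finally show "multiplicity q (\<Prod>p\<in>prime_factors n. p ^ multiplicity p x) = multiplicity q x" .
qed

lemma chain_pairs_dvd:
  assumes "(d, e) \<in> chain_pairs r n"
  shows "d i dvd n" "e i dvd n" "d i > 0" "e i > 0"
proof -
  have de: "divisor_chain d" "divisor_chain e" "e i dvd d i" "\<forall>i\<ge>r. d i = 1" "(\<Prod>i<r. d i) = n"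
    using assms by (auto simp: chain_pairs_def)
  show d: "d i dvd n"
    using de(4,5) dvd_prodI[of "{..<r}" i d] by (cases "i < r") auto
  show "e i dvd n" using de(3) d by (rule dvd_trans)
  show "d i > 0" "e i > 0" using divisor_chain_pos de by blast+
qed

lemma part_pairs_of_chain_pairs:
  assumes n: "n > 0" and p: "prime p" and de: "(d, e) \<in> chain_pairs r n"
  shows "(\<lambda>i. multiplicity p (d i), \<lambda>i. multiplicity p (e i)) \<in> part_pairs r (multiplicity p n)"
proof -
  have de': "divisor_chain d" "divisor_chain e" "\<And>i. e i dvd d i" "\<forall>i\<ge>r. d i = 1" "(\<Prod>i<r. d i) = n"
    using de by (auto simp: chain_pairs_def)
  note pos = chain_pairs_dvd(3,4)[OF de]
  have "0 \<notin> d ` {..<r}" using pos(1) by (metis imageE less_irrefl)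
  then have "multiplicity p (\<Prod>i<r. d i) = (\<Sum>i<r. multiplicity p (d i))"
    using p by (intro prime_elem_multiplicity_prod_distrib) auto
  then have "(\<Sum>i<r. multiplicity p (d i)) = multiplicity p n" using de'(5) by simp
  moreover have "d (Suc i) dvd d i" "e (Suc i) dvd e i" for i
    using de'(1,2) by (auto simp: divisor_chain_def)
  moreover have "multiplicity p x \<le> multiplicity p y" if "x dvd y" "y > 0" for x y :: nat
    using that by (intro dvd_imp_multiplicity_le) auto
  ultimately show ?thesis
    using de'(3,4) pos unfolding part_pairs_def by simp
qed

lemma chain_pairs_of_part_pairs:
  assumes n: "n > 0" and g: "\<And>p. p \<in> prime_factors n \<Longrightarrow> g p \<in> part_pairs r (multiplicity p n)"
  shows "(\<lambda>i. \<Prod>p\<in>prime_factors n. p ^ fst (g p) i, \<lambda>i. \<Prod>p\<in>prime_factors n. p ^ snd (g p) i) \<in> chain_pairs r n"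
proof -
  let ?P = "prime_factors n"
  have g': "fst (g p) (Suc i) \<le> fst (g p) i" "snd (g p) (Suc i) \<le> snd (g p) i"
      "snd (g p) i \<le> fst (g p) i" "r \<le> i \<Longrightarrow> fst (g p) i = 0"
      "r \<le> i \<Longrightarrow> snd (g p) i = 0" "(\<Sum>i<r. fst (g p) i) = multiplicity p n"
    if "p \<in> ?P" for p i
    using g[OF that] by (auto simp: part_pairs_def split: prod.splits) (metis le_zero_eq)
  have pos: "(\<Prod>p\<in>?P. p ^ f p) > 0" for f :: "nat \<Rightarrow> nat"
    by (rule prod_pos) (auto intro: prime_gt_0_nat in_prime_factors_imp_prime)
  have dvd: "(\<Prod>p\<in>?P. p ^ f p) dvd (\<Prod>p\<in>?P. p ^ h p)" if "\<And>p. p \<in> ?P \<Longrightarrow> f p \<le> h p" for f h :: "nat \<Rightarrow> nat"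
    using that by (intro prod_dvd_prod le_imp_power_dvd)
  have "(\<Prod>i<r. \<Prod>p\<in>?P. p ^ fst (g p) i) = (\<Prod>p\<in>?P. \<Prod>i<r. p ^ fst (g p) i)"
    by (rule prod.swap)
  also have "\<dots> = (\<Prod>p\<in>?P. p ^ multiplicity p n)"
    using g'(6) by (intro prod.cong) (simp_all add: power_sum[symmetric])
  also have "\<dots> = n" using prod_primes_power_multiplicity[OF n] by simp
  finally have prod: "(\<Prod>i<r. \<Prod>p\<in>?P. p ^ fst (g p) i) = n" .
  have chain: "divisor_chain (\<lambda>i. \<Prod>p\<in>?P. p ^ f p i)"
    if "\<And>p i. p \<in> ?P \<Longrightarrow> f p (Suc i) \<le> f p i" "\<And>p i. p \<in> ?P \<Longrightarrow> r \<le> i \<Longrightarrow> f p i = 0" for f :: "nat \<Rightarrow> nat \<Rightarrow> nat"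
    unfolding divisor_chain_def using pos dvd that by (auto intro!: exI[of _ r] prod.neutral)
  show ?thesis
    unfolding chain_pairs_def using prod chain[of "\<lambda>p. fst (g p)"] chain[of "\<lambda>p. snd (g p)"] dvd g'
    by (auto intro!: prod.neutral)
qed

text \<open>By unique factorisation a pair of chains amounts to an independent choice of a pair of
  partitions for each prime of \<open>n\<close>: divisibility becomes comparison of exponents, and
  the product of the \<open>d i\<close> becomes the sum of the parts.\<close>

lemma card_chain_pairs:
  assumes n: "n > 0"
  shows "card (chain_pairs r n) = (\<Prod>p\<in>prime_factors n. card (part_pairs r (multiplicity p n)))"
proof -
  let ?P = "prime_factors n"
  let ?F = "\<lambda>(d, e). restrict (\<lambda>p. (\<lambda>i. multiplicity p (d i), \<lambda>i. multiplicity p (e i))) ?P"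
  let ?G = "\<lambda>g. (\<lambda>i. \<Prod>p\<in>?P. p ^ fst (g p) i, \<lambda>i. \<Prod>p\<in>?P. p ^ snd (g p) i)"
  let ?A = "PiE ?P (\<lambda>p. part_pairs r (multiplicity p n))"
  have "bij_betw ?F (chain_pairs r n) ?A"
  proof (rule bij_betw_byWitness[where f' = ?G])
    show "\<forall>de\<in>chain_pairs r n. ?G (?F de) = de"
    proof
      fix de assume de: "de \<in> chain_pairs r n"
      obtain d e where [simp]: "de = (d, e)" by (cases de)
      have "(\<Prod>p\<in>?P. p ^ multiplicity p (d i)) = d i" "(\<Prod>p\<in>?P. p ^ multiplicity p (e i)) = e i" for i
        using prod_primes_power_multiplicity[OF n] chain_pairs_dvd de by simp_all
      then show "?G (?F de) = de" by simp
    qed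
    show "\<forall>g\<in>?A. ?F (?G g) = g"
    proof
      fix g assume g: "g \<in> ?A"
      have "multiplicity q (\<Prod>p\<in>?P. p ^ f p) = f q" if "q \<in> ?P" for f and q :: nat
        using that by (subst multiplicity_prod_prime_powers) auto
      then show "?F (?G g) = g" using g by (auto simp: fun_eq_iff restrict_def PiE_def extensional_def)
    qed
    show "?F ` chain_pairs r n \<subseteq> ?A"
    proof (rule image_subsetI)
      fix x assume x: "x \<in> chain_pairs r n"
      obtain d e where de: "x = (d, e)" by (cases x)
      show "?F x \<in> ?A"
        using part_pairs_of_chain_pairs[OF n in_prime_factors_imp_prime x[unfolded de]] unfolding de by simp
    qed
    show "?G ` ?A \<subseteq> chain_pairs r n"
      using chain_pairs_of_part_pairs[OF n] by (auto simp: PiE_def Pi_def)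
  qed
  then show ?thesis by (simp add: bij_betw_same_card card_PiE)
qed

section \<open>Counting pairs of partitions in small cases\<close>

definition part_count :: "nat \<Rightarrow> nat \<Rightarrow> nat" where
  "part_count r a = card (part_pairs r a)"

lemma A_sum_eq_prod_part_count:
  assumes "n > 0"
  shows "A_sum r n = (\<Prod>p\<in>prime_factors n. part_count r (multiplicity p n))"
  using card_chain_pairs[OF assms] by (simp add: A_sum_eq_card_chain_pairs part_count_def)

lemma part_pairs_le:
  assumes "(l, m) \<in> part_pairs r a"
  shows "l i \<le> a" "m i \<le> a" "r \<le> i \<Longrightarrow> l i = 0 \<and> m i = 0"
proof -
  have lm: "\<forall>i\<ge>r. l i = 0" "(\<Sum>i<r. l i) = a" "m i \<le> l i" using assms by (auto simp: part_pairs_def)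
  show l: "l i \<le> a"
    using lm(1,2) member_le_sum[of i "{..<r}" l] by (cases "i < r") auto
  show "m i \<le> a" using l lm(3) by simp
  show "r \<le> i \<Longrightarrow> l i = 0 \<and> m i = 0" using lm by auto
qed

text \<open>A crude bound, but polynomial in \<open>a\<close> for fixed \<open>r\<close>, which is
  what gives the local series radius of convergence at least 1.\<close>

lemma part_count_le: "part_count r a \<le> (a + 1) ^ (2 * r)"
proof -
  let ?F = "{f. \<forall>i. (i \<in> {..<r} \<longrightarrow> f i \<in> {..a}) \<and> (i \<notin> {..<r} \<longrightarrow> f i = (0::nat))}"
  have F: "?F \<subseteq> (\<lambda>g i. if i < r then g i else 0) ` (PiE {..<r} (\<lambda>_. {..a}))"
  proof
    fix f assume "f \<in> ?F"
    then show "f \<in> (\<lambda>g i. if i < r then g i else 0) ` (PiE {..<r} (\<lambda>_. {..a}))"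
      by (intro image_eqI[of _ _ "restrict f {..<r}"]) (auto simp: fun_eq_iff)
  qed
  have finP: "finite (PiE {..<r} (\<lambda>_. {..a}))" by (intro finite_PiE) auto
  have fin: "finite ?F" using F finite_imageI[OF finP] by (rule finite_subset)
  have "card ?F \<le> card (PiE {..<r} (\<lambda>_. {..a}))"
    using card_mono[OF finite_imageI[OF finP] F] card_image_le[OF finP] by (rule le_trans)
  then have card: "card ?F \<le> (a + 1) ^ r" by (simp add: card_PiE)
  have "part_pairs r a \<subseteq> ?F \<times> ?F"
  proof
    fix x assume x: "x \<in> part_pairs r a"
    obtain l m where lm: "x = (l, m)" by (cases x)
    show "x \<in> ?F \<times> ?F" using part_pairs_le[OF x[unfolded lm]] unfolding lm by (simp add: not_less)
  qed
  then have "part_count r a \<le> card (?F \<times> ?F)"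
    unfolding part_count_def using fin by (intro card_mono) auto
  also have "\<dots> = card ?F * card ?F" by (rule card_cartesian_product)
  also have "\<dots> \<le> (a + 1) ^ r * (a + 1) ^ r" using card card by (rule mult_le_mono)
  finally show ?thesis by (simp add: power_add[symmetric] mult_2)
qed

lemma part_count_0: "part_count r 0 = 1"
proof -
  have "part_pairs r 0 = {(\<lambda>_. 0, \<lambda>_. 0)}"
  proof (intro subset_antisym subsetI)
    fix x assume x: "x \<in> part_pairs r 0"
    obtain l m where lm: "x = (l, m)" by (cases x)
    have "l i = 0" "m i = 0" for i using part_pairs_le(1,2)[OF x[unfolded lm], of i] by simp_all
    then show "x \<in> {(\<lambda>_. 0, \<lambda>_. 0)}" unfolding lm by (simp add: fun_eq_iff)
  qed (simp add: part_pairs_def)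
  then show ?thesis by (simp add: part_count_def)
qed

lemma part_count_1: "part_count 1 a = a + 1"
proof -
  let ?F = "\<lambda>k i. if i = 0 then k else 0 :: nat"
  have "bij_betw (\<lambda>k. (?F a, ?F k)) {..a} (part_pairs 1 a)"
  proof (rule bij_betw_byWitness[where f' = "\<lambda>(l, m). m 0"])
    show "\<forall>x\<in>part_pairs 1 a. (?F a, ?F (case x of (l, m) \<Rightarrow> m 0)) = x"
    proof
      fix x assume x: "x \<in> part_pairs 1 a"
      obtain l m where lm: "x = (l, m)" by (cases x)
      have "l i = 0 \<and> m i = 0" if "i \<noteq> 0" for i
        using part_pairs_le(3)[OF x[unfolded lm], of i] that by simp
      moreover have "l 0 = a" using x lm by (simp add: part_pairs_def)
      ultimately show "(?F a, ?F (case x of (l, m) \<Rightarrow> m 0)) = x" unfolding lm by (auto simp: fun_eq_iff)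
    qed
  qed (auto simp: part_pairs_def)
  from bij_betw_same_card[OF this] show ?thesis by (simp add: part_count_def)
qed

text \<open>Here \<open>j\<close> and \<open>k\<close> are the smaller parts of \<open>l\<close> and
  \<open>m\<close>, so \<open>l = (a - j, j)\<close> with \<open>j \<le> a div 2\<close>, and the
  larger part of \<open>m\<close> runs from \<open>k\<close> to \<open>a - j\<close>.\<close>

lemma part_count_2_sum: "part_count 2 a = (\<Sum>j\<le>a div 2. \<Sum>k\<le>j. a + 1 - j - k)"
proof -
  let ?F = "\<lambda>x y i. if i = 0 then x else if i = 1 then y else 0 :: nat"
  have sum2: "(\<Sum>i<2. f i) = f 0 + f 1" for f :: "nat \<Rightarrow> nat" by (simp add: numeral_2_eq_2)
  let ?T = "Sigma {..a div 2} (\<lambda>j. Sigma {..j} (\<lambda>k. {k..a - j}))"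
  have "bij_betw (\<lambda>(j, k, i). (?F (a - j) j, ?F i k)) ?T (part_pairs 2 a)"
  proof (rule bij_betw_byWitness[where f' = "\<lambda>(l, m). (l 1, m 1, m 0)"])
    have lm: "?F (a - l 1) (l 1) = l \<and> ?F (m 0) (m 1) = m \<and> l 1 \<le> a div 2 \<and> m 1 \<le> l 1 \<and> m 1 \<le> m 0 \<and> m 0 \<le> a - l 1"
      if "(l, m) \<in> part_pairs 2 a" for l m
    proof -
      have "l 0 + l 1 = a" "l 1 \<le> l 0" "m 1 \<le> m 0" "m 0 \<le> l 0" "m 1 \<le> l 1"
        using that by (auto simp: part_pairs_def sum2)
      moreover have "l i = 0 \<and> m i = 0" if "i \<noteq> 0" "i \<noteq> 1" for i
        using part_pairs_le(3)[OF \<open>(l, m) \<in> part_pairs 2 a\<close>, of i] that by simp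
      moreover from calculation(1) have "a - l 1 = l 0" by simp
      ultimately show ?thesis by (simp add: fun_eq_iff)
    qed
    show "\<forall>x\<in>part_pairs 2 a. (case (case x of (l, m) \<Rightarrow> (l 1, m 1, m 0)) of (j, k, i) \<Rightarrow> (?F (a - j) j, ?F i k)) = x"
      using lm by fastforce
    show "(\<lambda>(l, m). (l 1, m 1, m 0)) ` part_pairs 2 a \<subseteq> ?T"
      using lm by fastforce
    show "(\<lambda>(j, k, i). (?F (a - j) j, ?F i k)) ` ?T \<subseteq> part_pairs 2 a"
      by (auto simp: part_pairs_def sum2)
  qed auto
  then have "part_count 2 a = card ?T" by (simp add: part_count_def bij_betw_same_card)
  also have "\<dots> = (\<Sum>j\<le>a div 2. \<Sum>k\<le>j. card {k..a - j})"
    by (simp add: card_SigmaI)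
  also have "\<dots> = (\<Sum>j\<le>a div 2. \<Sum>k\<le>j. a + 1 - j - k)"
    by (intro sum.cong refl) auto
  finally show ?thesis .
qed

text \<open>Both sums have closed forms valid for every real \<open>x\<close>, which turns the
  inductions on the upper limit into polynomial identities; doubling keeps out fractions.\<close>

lemma part_count_2:
  "2 * real (part_count 2 a) = (real (a div 2) + 1) * (real (a div 2) + 2) * (real a + 1 - real (a div 2))"
proof -
  have inner: "2 * (\<Sum>k\<le>j. x - real k) = (real j + 1) * (2 * x - real j)" for j and x :: real
    by (induction j) (simp_all add: algebra_simps)
  have outer: "(\<Sum>j\<le>b. (real j + 1) * (2 * (x - real j) - real j)) =
      (real b + 1) * (real b + 2) * (x - real b)" for b and x :: real
    by (induction b) (simp_all add: algebra_simps)
  have "real (part_count 2 a) = (\<Sum>j\<le>a div 2. \<Sum>k\<le>j. (real a + 1 - real j) - real k)"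
    unfolding part_count_2_sum of_nat_sum by (intro sum.cong refl) (simp add: of_nat_diff)
  then have "2 * real (part_count 2 a) = (\<Sum>j\<le>a div 2. 2 * (\<Sum>k\<le>j. (real a + 1 - real j) - real k))"
    by (simp add: sum_distrib_left)
  also have "\<dots> = (\<Sum>j\<le>a div 2. (real j + 1) * (2 * (real a + 1 - real j) - real j))"
    by (simp only: inner)
  finally show ?thesis using outer[of "real a + 1" "a div 2"] by simp
qed

text \<open>A partition of \<open>a \<le> 3\<close> has at most three parts, so for
  \<open>k \<ge> 3\<close> the count does not depend on \<open>k\<close> and is found by listing the
  pairs.\<close>

lemma part_count_small:
  assumes k: "k \<ge> 3"
  shows "part_count k 1 = 2" "part_count k 2 = 6" "part_count k 3 = 13"
proof -
  let ?F = "\<lambda>x y z (i::nat). if i = 0 then x else if i = 1 then y else if i = 2 then z else 0 :: nat"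
  \<comment> \<open>The tuples list the first three parts of \<open>l\<close>, then those of
    \<open>m\<close>; the bound \<open>x < 4\<close> comes from \<open>a \<le> 3\<close>.\<close>
  let ?T = "\<lambda>a. [(x, y, z, u, v, w). x \<leftarrow> [0..<4], y \<leftarrow> [0..<Suc x], z \<leftarrow> [0..<Suc y], x + y + z = (a::nat),
    u \<leftarrow> [0..<Suc x], v \<leftarrow> [0..<Suc (min u y)], w \<leftarrow> [0..<Suc (min v z)]]"
  have T: "(x, y, z, u, v, w) \<in> set (?T a) \<longleftrightarrow>
      x < 4 \<and> y \<le> x \<and> z \<le> y \<and> x + y + z = a \<and> u \<le> x \<and> v \<le> min u y \<and> w \<le> min v z" for x y z u v w a
    by (simp add: image_iff less_Suc_eq_le del: upt_Suc min_less_iff_conj)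
  have count: "part_count k a = card (set (?T a))" if a: "a \<le> 3" for a
  proof -
    have "{..<k} = {..<3} \<union> {3..<k}" using k by auto
    then have sum_k: "(\<Sum>i<k. f i) = (\<Sum>i<3. f i) + (\<Sum>i=3..<k. f i)" for f :: "nat \<Rightarrow> nat"
      by (simp add: sum.union_disjoint ivl_disj_int)
    have sum3: "(\<Sum>i<3. f i) = f 0 + f 1 + f 2" for f :: "nat \<Rightarrow> nat"
      by (simp add: eval_nat_numeral)
    have "bij_betw (\<lambda>(x, y, z, u, v, w). (?F x y z, ?F u v w)) (set (?T a)) (part_pairs k a)"
    proof (rule bij_betw_byWitness[where f' = "\<lambda>(l, m). (l 0, l 1, l 2, m 0, m 1, m 2)"])
      have lm: "?F (l 0) (l 1) (l 2) = l \<and> ?F (m 0) (m 1) (m 2) = m \<and>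
          (l 0, l 1, l 2, m 0, m 1, m 2) \<in> set (?T a)"
        if lm: "(l, m) \<in> part_pairs k a" for l m
      proof -
        have anti: "\<And>i. l (Suc i) \<le> l i" "\<And>i. m (Suc i) \<le> m i" "\<And>i. m i \<le> l i" 
          and suml: "(\<Sum>i<k. l i) = a" using lm by (auto simp: part_pairs_def)
        \<comment> \<open>A nonzero fourth part would force four parts of size at least 1, with sum
          at least 4.\<close>
        have "l 3 = 0"
        proof (cases "k = 3")
          case True then show ?thesis using part_pairs_le(3)[OF lm, of 3] by simp
        next
          case False
          then have "3 \<in> {3..<k}" using k by simp
          then have "l 3 \<le> (\<Sum>i=3..<k. l i)" by (intro member_le_sum) auto
          then have "l 0 + l 1 + l 2 + l 3 \<le> 3" using suml a unfolding sum_k sum3 by linarith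
          moreover have "l 1 \<le> l 0" "l 2 \<le> l 1" "l 3 \<le> l 2" using anti(1)[of 0] anti(1)[of 1] anti(1)[of 2]
            by (simp_all add: eval_nat_numeral)
          ultimately show ?thesis by linarith
        qed
        have l0: "l i = 0" if "i \<ge> 3" for i
          using lift_Suc_antimono_le[of l 3 i] anti(1) that \<open>l 3 = 0\<close> by simp
        have m0: "m i = 0" if "i \<ge> 3" for i using l0[OF that] anti(3)[of i] by simp
        have "(\<Sum>i=3..<k. l i) = 0" using l0 by simp
        then have s: "l 0 + l 1 + l 2 = a" using suml unfolding sum_k sum3 by simp
        have ord: "l 1 \<le> l 0" "l 2 \<le> l 1" "m 1 \<le> m 0" "m 2 \<le> m 1"
          using anti(1)[of 0] anti(1)[of 1] anti(2)[of 0] anti(2)[of 1] by (simp_all add: eval_nat_numeral)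
        have "?F (l 0) (l 1) (l 2) = l" "?F (m 0) (m 1) (m 2) = m"
        proof -
          show "?F (l 0) (l 1) (l 2) = l" using l0 by (auto simp: fun_eq_iff not_less)
          show "?F (m 0) (m 1) (m 2) = m" using m0 by (auto simp: fun_eq_iff not_less)
        qed
        moreover have "(l 0, l 1, l 2, m 0, m 1, m 2) \<in> set (?T a)"
          using ord s a anti(3)[of 0] anti(3)[of 1] anti(3)[of 2] unfolding T by simp
        ultimately show ?thesis by blast
      qed
      show "\<forall>x\<in>part_pairs k a. (case (case x of (l, m) \<Rightarrow> (l 0, l 1, l 2, m 0, m 1, m 2)) of
          (x, y, z, u, v, w) \<Rightarrow> (?F x y z, ?F u v w)) = x"
      proof
        fix x assume x: "x \<in> part_pairs k a"
        obtain l m where x': "x = (l, m)" by (cases x)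
        show "(case (case x of (l, m) \<Rightarrow> (l 0, l 1, l 2, m 0, m 1, m 2)) of
          (x, y, z, u, v, w) \<Rightarrow> (?F x y z, ?F u v w)) = x"
          using lm[OF x[unfolded x']] unfolding x' prod.case by blast
      qed
      show "(\<lambda>(l, m). (l 0, l 1, l 2, m 0, m 1, m 2)) ` part_pairs k a \<subseteq> set (?T a)"
      proof (rule image_subsetI)
        fix x assume x: "x \<in> part_pairs k a"
        obtain l m where x': "x = (l, m)" by (cases x)
        show "(case x of (l, m) \<Rightarrow> (l 0, l 1, l 2, m 0, m 1, m 2)) \<in> set (?T a)"
          using lm[OF x[unfolded x']] unfolding x' prod.case by blast
      qed
      show "(\<lambda>(x, y, z, u, v, w). (?F x y z, ?F u v w)) ` set (?T a) \<subseteq> part_pairs k a"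
      proof (rule image_subsetI)
        fix t assume t: "t \<in> set (?T a)"
        obtain x y z u v w where xyz: "t = (x, y, z, u, v, w)" by (metis prod_cases6)
        have "(\<Sum>i=3..<k. ?F x y z i) = 0" by simp
        then show "(case t of (x, y, z, u, v, w) \<Rightarrow> (?F x y z, ?F u v w)) \<in> part_pairs k a"
          using t k unfolding xyz T part_pairs_def sum_k sum3 by auto
      qed
      show "\<forall>t\<in>set (?T a). (case (case t of (x, y, z, u, v, w) \<Rightarrow> (?F x y z, ?F u v w)) of
          (l, m) \<Rightarrow> (l 0, l 1, l 2, m 0, m 1, m 2)) = t"
      proof
        fix t :: "nat \<times> nat \<times> nat \<times> nat \<times> nat \<times> nat"
        obtain x y z u v w where xyz: "t = (x, y, z, u, v, w)" by (metis prod_cases6)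
        show "(case (case t of (x, y, z, u, v, w) \<Rightarrow> (?F x y z, ?F u v w)) of
          (l, m) \<Rightarrow> (l 0, l 1, l 2, m 0, m 1, m 2)) = t" unfolding xyz prod.case by simp
      qed
    qed
    from bij_betw_same_card[OF this] show ?thesis unfolding part_count_def by (rule sym)
  qed
  have c: "card (set (?T 1)) = 2" "card (set (?T 2)) = 6" "card (set (?T 3)) = 13"
    by (simp_all add: eval_nat_numeral upt_rec card_insert_if)
  show "part_count k 1 = 2" by (rule trans[OF count c(1)]) simp
  show "part_count k 2 = 6" by (rule trans[OF count c(2)]) simp
  show "part_count k 3 = 13" by (rule trans[OF count c(3)]) simp
qed

subsection \<open>Continuation of zeta\<close>

lemma norm_of_nat_powr: "n > 0 \<Longrightarrow> norm (of_nat n powr s :: complex) = real n powr Re s"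
  using norm_powr_real_powr[of "complex_of_real (real n)" s] by simp

lemma summable_Suc_powr:
  assumes "\<sigma> > 1"
  shows "summable (\<lambda>n. real (Suc n) powr (- \<sigma>))"
  using assms summable_real_powr_iff[of "- \<sigma>"] by (subst summable_Suc_iff) simp

lemma holomorphic_on_suminf:
  fixes f :: "nat \<Rightarrow> complex \<Rightarrow> complex"
  assumes S: "open S" and hol: "\<And>n. f n holomorphic_on S"
    and M: "\<And>x. x \<in> S \<Longrightarrow> \<exists>r>0. cball x r \<subseteq> S \<and> (\<exists>M. summable M \<and> (\<forall>n. \<forall>y\<in>cball x r. norm (f n y) \<le> M n))"
  shows "(\<lambda>s. suminf (\<lambda>n. f n s)) holomorphic_on S"
proof (rule holomorphic_uniform_sequence[where f = "\<lambda>n s. \<Sum>i<n. f i s", OF S])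
  show "(\<lambda>s. \<Sum>i<n. f i s) holomorphic_on S" for n using hol by (intro holomorphic_on_sum) auto
  fix x assume "x \<in> S"
  from M[OF this] obtain r M where r: "r > 0" "cball x r \<subseteq> S"
    and "summable M" "\<And>n y. y \<in> cball x r \<Longrightarrow> norm (f n y) \<le> M n" by blast
  then have "uniform_limit (cball x r) (\<lambda>n s. \<Sum>i<n. f i s) (\<lambda>s. suminf (\<lambda>i. f i s)) sequentially"
    by (intro Weierstrass_m_test) auto
  then show "\<exists>d>0. cball x d \<subseteq> S \<and>
      uniform_limit (cball x d) (\<lambda>n s. \<Sum>i<n. f i s) (\<lambda>s. suminf (\<lambda>n. f n s)) sequentially"
    using r by blast
qed

lemma cball_Re_gt:
  assumes "y \<in> cball x r"
  shows "Re y \<ge> Re x - r"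
proof -
  have "\<bar>Re (x - y)\<bar> \<le> norm (x - y)" by (rule abs_Re_le_cmod)
  also have "\<dots> \<le> r" using assms by (simp add: dist_norm)
  finally show ?thesis by simp
qed

text \<open>On a closed ball whose radius is half the distance to the line \<open>Re s = c\<close>,
  every term is dominated by its norm at the real point \<open>Re x - r\<close>, where the series
  converges absolutely.\<close>

lemma dirichlet_series_holomorphic:
  assumes conv: "\<And>s. Re s > c \<Longrightarrow> dirichlet_abs_conv a s"
  shows "dirichlet_series a holomorphic_on {s. Re s > c}"
  unfolding dirichlet_series_def
proof (rule holomorphic_on_suminf)
  show "open {s. Re s > c}" by (rule open_halfspace_Re_gt)
  show "(\<lambda>s. a (Suc n) * of_nat (Suc n) powr - s) holomorphic_on {s. Re s > c}" for n
    by (intro holomorphic_intros)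
  fix x assume "x \<in> {s. Re s > c}"
  then have x: "Re x > c" by simp
  define r where "r = (Re x - c) / 2"
  have r: "r > 0" "Re x - r > c" using x by (auto simp: r_def field_simps)
  let ?M = "\<lambda>n. norm (a (Suc n) * of_nat (Suc n) powr - complex_of_real (Re x - r))"
  have "summable ?M" using conv[of "complex_of_real (Re x - r)"] r unfolding dirichlet_abs_conv_def by simp
  moreover have "norm (a (Suc n) * of_nat (Suc n) powr - y) \<le> ?M n" if "y \<in> cball x r" for n y
    unfolding norm_mult using cball_Re_gt[OF that]
    by (subst (1 2) norm_of_nat_powr) (auto intro!: mult_left_mono powr_mono)
  moreover have "cball x r \<subseteq> {s. Re s > c}" using cball_Re_gt r by fastforce
  ultimately show "\<exists>r>0. cball x r \<subseteq> {s. Re s > c} \<and>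
      (\<exists>M. summable M \<and> (\<forall>n. \<forall>y\<in>cball x r. norm (a (Suc n) * of_nat (Suc n) powr - y) \<le> M n))"
    using r(1) by blast
qed

lemma dirichlet_abs_conv_1: "Re s > 1 \<Longrightarrow> dirichlet_abs_conv (\<lambda>_. 1) s"
  unfolding dirichlet_abs_conv_def using summable_Suc_powr[of "Re s"]
  by (simp add: norm_of_nat_powr del: of_nat_Suc)

text \<open>The falling factorial of \<open>1 - s\<close>: the coefficient in the
  \<open>j\<close>-th derivative of \<open>x powr (1 - s)\<close>.\<close>

definition falling :: "nat \<Rightarrow> complex \<Rightarrow> complex" where
  "falling j s = (\<Prod>k<j. 1 - s - of_nat k)"

text \<open>The remainder at \<open>n + 1\<close> of the Taylor polynomial of degree
  \<open>J\<close> of \<open>x powr (1 - s)\<close> around \<open>n\<close>.\<close>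

definition taylor_rem :: "nat \<Rightarrow> nat \<Rightarrow> complex \<Rightarrow> complex" where
  "taylor_rem J n s = of_nat (Suc n) powr (1 - s) -
     (\<Sum>j\<le>J. falling j s * of_nat n powr (1 - s - of_nat j) / fact j)"

lemma falling_Suc: "falling (Suc j) s = falling j s * (1 - s - of_nat j)"
  by (simp add: falling_def)

text \<open>Taylor's theorem on the segment from \<open>n\<close> to \<open>n + 1\<close>: the
  derivative of order \<open>J + 1\<close> is \<open>falling (Suc J) s\<close> times
  \<open>x powr (- s - J)\<close>, which under \<open>Re s + J \<ge> 0\<close> is largest in norm at
  the left end.\<close>

lemma norm_taylor_rem_le:
  assumes n: "n > 0" and J: "Re s + real J \<ge> 0"
  shows "norm (taylor_rem J n s) \<le> norm (falling (Suc J) s) * real n powr (- Re s - real J)"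
proof -
  define f where "f = (\<lambda>i x. falling i s * x powr (1 - s - of_nat i))"
  let ?S = "complex_of_real ` {real n..real n + 1}"
  have "norm (f 0 (of_nat (Suc n)) - (\<Sum>i\<le>J. f i (of_nat n) * (of_nat (Suc n) - of_nat n) ^ i / fact i))
      \<le> (norm (falling (Suc J) s) * real n powr (- Re s - real J)) *
        norm (of_nat (Suc n) - of_nat n :: complex) ^ Suc J / fact J"
  proof (rule complex_Taylor)
    show "convex ?S" by (intro convex_linear_image) (auto intro: linearI)
    fix i x assume "x \<in> ?S" "i \<le> J"
    then obtain t where t: "x = of_real t" "t \<ge> real n" by auto
    then have t0: "t > 0" using n by simp
    then have "x \<notin> \<real>\<^sub>\<le>\<^sub>0" using t(1) by (simp add: complex_nonpos_Reals_iff)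
    then have "(f i has_field_derivative falling i s * ((1 - s - of_nat i) * x powr (1 - s - of_nat i - 1))) (at x)"
      unfolding f_def by (intro DERIV_cmult has_field_derivative_powr)
    also have "falling i s * ((1 - s - of_nat i) * x powr (1 - s - of_nat i - 1)) = f (Suc i) x"
      by (simp add: f_def falling_Suc algebra_simps)
    finally show "(f i has_field_derivative f (Suc i) x) (at x within ?S)"
      by (rule has_field_derivative_at_within)
  next
    fix x assume "x \<in> ?S"
    then obtain t where t: "x = of_real t" "t \<ge> real n" by auto
    then have t0: "t > 0" using n by simp
    have "norm (x powr (1 - s - of_nat (Suc J))) = t powr (- Re s - real J)"
      using t0 t(1) by (simp add: norm_powr_real_powr)
    also have "\<dots> \<le> real n powr (- Re s - real J)"
      using t(2) n J by (intro powr_mono2') auto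
    finally show "norm (f (Suc J) x) \<le> norm (falling (Suc J) s) * real n powr (- Re s - real J)"
      unfolding f_def norm_mult by (rule mult_left_mono) simp
  next
    show "of_nat n \<in> ?S" by (rule image_eqI[of _ _ "real n"]) auto
    show "of_nat (Suc n) \<in> ?S" by (rule image_eqI[of _ _ "real n + 1"]) auto
  qed
  also have "f 0 (of_nat (Suc n)) - (\<Sum>i\<le>J. f i (of_nat n) * (of_nat (Suc n) - of_nat n) ^ i / fact i) = taylor_rem J n s"
    by (simp add: f_def taylor_rem_def falling_def)
  also have "(norm (falling (Suc J) s) * real n powr (- Re s - real J)) *
        norm (of_nat (Suc n) - of_nat n :: complex) ^ Suc J / fact J \<le>
      (norm (falling (Suc J) s) * real n powr (- Re s - real J)) / 1"
    by (simp, rule divide_left_mono[of 1 "fact J", simplified]) (auto simp: fact_ge_1)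
  finally show ?thesis by simp
qed

lemma norm_falling_le:
  assumes "norm s \<le> C"
  shows "norm (falling J s) \<le> (1 + C + real J) ^ J"
proof -
  have "norm (falling J s) = (\<Prod>k<J. norm (1 - s - of_nat k))" by (simp add: falling_def prod_norm)
  also have "\<dots> \<le> (\<Prod>k<J. 1 + C + real J)"
  proof (rule prod_mono)
    fix k assume k: "k \<in> {..<J}"
    have "norm (1 - s - of_nat k) \<le> norm (1 - s) + norm (of_nat k :: complex)" by (rule norm_triangle_ineq4)
    also have "norm (1 - s) \<le> norm (1::complex) + norm s" by (rule norm_triangle_ineq4)
    finally show "0 \<le> norm (1 - s - of_nat k) \<and> norm (1 - s - of_nat k) \<le> 1 + C + real J"
      using assms k by simp
  qed
  finally show ?thesis by simp
qed

text \<open>At order \<open>m + 1\<close> the remainders are, locally uniformly in \<open>s\<close>,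
  of size \<open>n powr (- Re s - m - 1)\<close>, hence summable for
  \<open>Re s > - m\<close>.\<close>

lemma taylor_rem_sum_holomorphic:
  "(\<lambda>s. suminf (\<lambda>n. taylor_rem (Suc m) (Suc n) s)) holomorphic_on {s. Re s > - real m}"
proof (rule holomorphic_on_suminf)
  show "open {s. Re s > - real m}" by (rule open_halfspace_Re_gt)
  show "taylor_rem (Suc m) (Suc n) holomorphic_on {s. Re s > - real m}" for n
    unfolding taylor_rem_def falling_def by (intro holomorphic_intros) auto
  fix x assume "x \<in> {s. Re s > - real m}"
  then have x: "Re x > - real m" by simp
  define r where "r = (Re x + real m) / 2"
  have r: "r > 0" "Re x - r > - real m" using x by (auto simp: r_def field_simps)
  define C where "C = (1 + (norm x + r) + real (Suc (Suc m))) ^ Suc (Suc m)"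
  let ?M = "\<lambda>n. C * real (Suc n) powr (- (Re x - r + real m + 1))"
  have "summable ?M" using r by (intro summable_mult summable_Suc_powr) simp
  moreover have "norm (taylor_rem (Suc m) (Suc n) y) \<le> ?M n" if y: "y \<in> cball x r" for n y
  proof -
    have Re: "Re y \<ge> Re x - r" by (rule cball_Re_gt[OF y])
    have "norm y \<le> norm x + norm (y - x)" by (rule norm_triangle_sub)
    also have "norm (y - x) \<le> r" using y by (simp add: dist_norm norm_minus_commute)
    finally have "norm y \<le> norm x + r" by simp
    have "norm (taylor_rem (Suc m) (Suc n) y) \<le>
        norm (falling (Suc (Suc m)) y) * real (Suc n) powr (- Re y - real (Suc m))"
      using Re r by (intro norm_taylor_rem_le) auto
    also have "\<dots> \<le> C * real (Suc n) powr (- (Re x - r + real m + 1))"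
      unfolding C_def using Re r \<open>norm y \<le> norm x + r\<close>
      by (intro mult_mono norm_falling_le powr_mono zero_le_power) auto
    finally show ?thesis .
  qed
  moreover have "cball x r \<subseteq> {s. Re s > - real m}" using cball_Re_gt r by fastforce
  ultimately show "\<exists>r>0. cball x r \<subseteq> {s. Re s > - real m} \<and>
      (\<exists>M. summable M \<and> (\<forall>n. \<forall>y\<in>cball x r. norm (taylor_rem (Suc m) (Suc n) y) \<le> M n))"
    using r(1) by blast
qed

lemma dirichlet_series_1_sums:
  assumes "Re s > 1"
  shows "(\<lambda>n. of_nat (Suc n) powr - s) sums dirichlet_series (\<lambda>_. 1) s"
  using dirichlet_abs_conv_1[OF assms] unfolding dirichlet_abs_conv_def dirichlet_series_def
  by (simp del: of_nat_Suc add: summable_sums summable_norm_cancel)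

text \<open>Expand \<open>(n + 1) powr (1 - s)\<close> around \<open>n\<close> up to order \<open>m + 1\<close> and sum over \<open>n\<close>: the left
  sides telescope.\<close>

lemma zeta_recurrence:
  assumes s: "Re s > 1"
  shows "(s - 1) * dirichlet_series (\<lambda>_. 1) s =
    1 + (\<Sum>j=1..m. falling (Suc j) s / fact (Suc j) * dirichlet_series (\<lambda>_. 1) (s + of_nat j)) +
    suminf (\<lambda>n. taylor_rem (Suc m) (Suc n) s)"
proof -
  let ?D = "dirichlet_series (\<lambda>_. 1)"
  let ?N = "\<lambda>n. of_nat (Suc n) :: complex"
  let ?T = "\<lambda>j n. falling j s / fact j * ?N n powr (1 - s - of_nat j)"
  have "(\<lambda>n. of_nat (Suc n) powr (1 - s) :: complex) \<longlonglongrightarrow> 0"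
    using s by (intro tendsto_neg_powr_complex_of_nat filterlim_Suc) auto
  from telescope_sums[OF this]
  \<comment> \<open>The summation starts at 1, and \<open>1 powr (1 - s) = 1\<close> is what remains
    of the telescoping sum.\<close>
  have tele: "(\<lambda>n. ?N (Suc n) powr (1 - s) - ?N n powr (1 - s)) sums (- 1)" by simp
  have "(\<lambda>n. ?T (Suc j) n) sums (falling (Suc j) s / fact (Suc j) * ?D (s + of_nat j))" for j
  proof -
    have "1 - s - of_nat (Suc j) = - (s + of_nat j)" by simp
    then show ?thesis using s by (simp only:) (intro sums_mult dirichlet_series_1_sums, simp)
  qed
  then have main: "(\<lambda>n. \<Sum>j\<le>m. ?T (Suc j) n) sums
      (\<Sum>j\<le>m. falling (Suc j) s / fact (Suc j) * ?D (s + of_nat j))"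
    by (intro sums_sum)
  \<comment> \<open>The Taylor term of degree 0 goes into the telescoping difference. The term of
    degree 1, which is \<open>j = 0\<close> after the shift, will supply \<open>(1 - s)\<close>
    times the series at \<open>s\<close> itself.\<close>
  have "taylor_rem (Suc m) (Suc n) s =
      ?N (Suc n) powr (1 - s) - ?N n powr (1 - s) - (\<Sum>j\<le>m. ?T (Suc j) n)" for n
    unfolding taylor_rem_def
    by (subst sum.atMost_Suc_shift) (simp add: falling_def algebra_simps)
  then have "(\<lambda>n. taylor_rem (Suc m) (Suc n) s) sums
      (- 1 - (\<Sum>j\<le>m. falling (Suc j) s / fact (Suc j) * ?D (s + of_nat j)))"
    using sums_diff[OF tele main] by simp
  then have "suminf (\<lambda>n. taylor_rem (Suc m) (Suc n) s) =
      - 1 - (\<Sum>j\<le>m. falling (Suc j) s / fact (Suc j) * ?D (s + of_nat j))" by (rule sums_unique[symmetric])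
  also have "{..m} = insert 0 {1..m}" by auto
  also have "(\<Sum>j\<in>insert 0 {1..m}. falling (Suc j) s / fact (Suc j) * ?D (s + of_nat j)) =
      (1 - s) * ?D s + (\<Sum>j=1..m. falling (Suc j) s / fact (Suc j) * ?D (s + of_nat j))"
    by (subst sum.insert) (auto simp: falling_def)
  finally show ?thesis by (simp add: algebra_simps)
qed

text \<open>The recurrence involves only arguments \<open>s + j\<close> with
  \<open>j \<ge> 1\<close>, so each use gains a strip of width 1. Splitting the factor
  \<open>s + j - 1\<close> off \<open>falling (Suc j) s\<close> turns the series at
  \<open>s + j\<close> into \<open>E (s + j)\<close> and thereby absorbs its pole.\<close>

lemma zeta_continuation_step:
  "\<exists>E. E holomorphic_on {s. Re s > 1 - real m} \<and>
    (\<forall>s. Re s > 1 \<longrightarrow> E s = (s - 1) * dirichlet_series (\<lambda>_. 1) s)"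
proof (induction m)
  case 0
  have "(\<lambda>s. (s - 1) * dirichlet_series (\<lambda>_. 1) s) holomorphic_on {s. Re s > 1}"
    by (intro holomorphic_intros dirichlet_series_holomorphic dirichlet_abs_conv_1)
  then show ?case by auto
next
  case (Suc m)
  then obtain E where E: "E holomorphic_on {s. Re s > 1 - real m}"
    and ED: "\<And>s. Re s > 1 \<Longrightarrow> E s = (s - 1) * dirichlet_series (\<lambda>_. 1) s" by blast
  define E' where "E' = (\<lambda>s. 1 + (\<Sum>j=1..m. - falling j s / fact (Suc j) * E (s + of_nat j)) +
    suminf (\<lambda>n. taylor_rem (Suc m) (Suc n) s))"
  have comp: "(\<lambda>s. E (s + of_nat j)) holomorphic_on {s. Re s > - real m}" if "j \<in> {1..m}" for j
  proof -
    have "(\<lambda>s. s + of_nat j) ` {s. Re s > - real m} \<subseteq> {s. Re s > 1 - real m}" using that by auto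
    then have "E \<circ> (\<lambda>s. s + of_nat j) holomorphic_on {s. Re s > - real m}"
      by (intro holomorphic_on_compose holomorphic_intros) (rule holomorphic_on_subset[OF E])
    then show ?thesis by (simp add: o_def)
  qed
  have "falling j holomorphic_on A" for j A
    unfolding falling_def[abs_def] by (intro holomorphic_intros)
  then have "E' holomorphic_on {s. Re s > - real m}"
    unfolding E'_def using comp
    by (intro holomorphic_on_add holomorphic_on_const holomorphic_on_sum holomorphic_on_mult
        holomorphic_on_divide holomorphic_on_minus taylor_rem_sum_holomorphic) (auto simp del: fact_Suc)
  moreover have "E' s = (s - 1) * dirichlet_series (\<lambda>_. 1) s" if s: "Re s > 1" for s
  proof -
    have "- falling j s / fact (Suc j) * E (s + of_nat j) =
        falling (Suc j) s / fact (Suc j) * dirichlet_series (\<lambda>_. 1) (s + of_nat j)" for j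
    proof -
      have "E (s + of_nat j) = (s + of_nat j - 1) * dirichlet_series (\<lambda>_. 1) (s + of_nat j)"
        using s by (intro ED) simp
      moreover have "falling (Suc j) s = - falling j s * (s + of_nat j - 1)"
        by (simp add: falling_Suc algebra_simps)
      ultimately show ?thesis by simp
    qed
    then show ?thesis unfolding E'_def zeta_recurrence[OF s, of m] by simp
  qed
  ultimately show ?case by (intro exI[of _ E']) (simp add: algebra_simps)
qed

text \<open>The continuations to the nested half-planes agree by the identity theorem, since all
  coincide on \<open>Re s > 1\<close>; hence they glue.\<close>

lemma zeta_continuation:
  "\<exists>E. E holomorphic_on UNIV \<and> (\<forall>s. Re s > 1 \<longrightarrow> E s = (s - 1) * dirichlet_series (\<lambda>_. 1) s)"
proof -
  obtain e where e: "\<And>m. e m holomorphic_on {s. Re s > 1 - real m}"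
    and eD: "\<And>m s. Re s > 1 \<Longrightarrow> e m s = (s - 1) * dirichlet_series (\<lambda>_. 1) s"
    using zeta_continuation_step by metis
  have agree: "e m s = e k s" if "m \<le> k" "Re s > 1 - real m" for m k s
  proof (rule analytic_continuation_open[of "{s. Re s > 1}" "{s. Re s > 1 - real m}" "e m" "e k"])
    show "e k holomorphic_on {s. Re s > 1 - real m}"
      using e[of k] by (rule holomorphic_on_subset) (use that in auto)
    show "{s. Re s > 1} \<noteq> {}" by (auto intro: exI[of _ 2])
    show "connected {s. Re s > 1 - real m}"
      by (intro convex_connected convex_halfspace_Re_gt)
  qed (use e eD that in \<open>auto simp: open_halfspace_Re_gt\<close>)
  \<comment> \<open>The index depends on \<open>s\<close> and is large enough for its half-plane to
    contain \<open>s\<close>.\<close>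
  define F where "F = (\<lambda>s. e (Suc (nat \<lceil>1 - Re s\<rceil>)) s)"
  have F: "F s = e m s" if "Re s > 1 - real m" for m s
  proof -
    let ?k = "Suc (nat \<lceil>1 - Re s\<rceil>)"
    have k: "Re s > 1 - real ?k" by linarith
    show ?thesis
    proof (cases "m \<le> ?k")
      case True
      show ?thesis unfolding F_def by (rule agree[OF True that, symmetric])
    next
      case False
      then have "?k \<le> m" by simp
      then show ?thesis unfolding F_def using k by (rule agree)
    qed
  qed
  have "F holomorphic_on (\<Union>m. {s. Re s > 1 - real m})"
  proof (rule holomorphic_on_UN_open)
    fix m show "F holomorphic_on {s. Re s > 1 - real m}"
      using e[of m] by (rule holomorphic_transform) (simp add: F)
  qed (rule open_halfspace_Re_gt)
  also have "(\<Union>m. {s. Re s > 1 - real m}) = UNIV"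
  proof (rule UNIV_eq_I[symmetric])
    fix s :: complex
    obtain m where "1 - Re s < real m" using reals_Archimedean2 by blast
    then have "Re s > 1 - real m" by linarith
    then show "s \<in> (\<Union>m. {s. Re s > 1 - real m})" by blast
  qed
  finally have "F holomorphic_on UNIV" .
  moreover have "F s = (s - 1) * dirichlet_series (\<lambda>_. 1) s" if "Re s > 1" for s
    using F[of 0 s] eD[OF that, of 0] that by simp
  ultimately show ?thesis by blast
qed

section \<open>Properties of zeta on the punctured plane\<close>

lemma zeta_characterization:
  "zeta holomorphic_on - {1}" "Re s > 1 \<Longrightarrow> zeta s = dirichlet_series (\<lambda>_. 1) s"
proof -
  obtain E where E: "E holomorphic_on UNIV" "\<And>s. Re s > 1 \<Longrightarrow> E s = (s - 1) * dirichlet_series (\<lambda>_. 1) s"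
    using zeta_continuation by blast
  let ?P = "\<lambda>f. f holomorphic_on - {1} \<and> (\<forall>s. Re s > 1 \<longrightarrow> f s = dirichlet_series (\<lambda>_. 1) s)"
  have "?P (\<lambda>s. E s / (s - 1))"
    using E by (auto intro!: holomorphic_intros intro: holomorphic_on_subset)
  then have "?P zeta" unfolding zeta_def by (rule someI[of ?P])
  then show "zeta holomorphic_on - {1}" "Re s > 1 \<Longrightarrow> zeta s = dirichlet_series (\<lambda>_. 1) s" by blast+
qed

text \<open>The identity theorem on the connected set \<open>- {1}\<close> gives
  \<open>zeta s = E s / (s - 1)\<close>. As \<open>zeta 1\<close> is unspecified, the comparison is
  made on punctured neighbourhoods, which is enough for meromorphy.\<close>

lemma zeta_meromorphic: "zeta meromorphic_on UNIV"
proof -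
  obtain E where E: "E holomorphic_on UNIV" "\<And>s. Re s > 1 \<Longrightarrow> E s = (s - 1) * dirichlet_series (\<lambda>_. 1) s"
    using zeta_continuation by blast
  have eq: "zeta s = E s / (s - 1)" if "s \<noteq> 1" for s
  proof (rule analytic_continuation_open[of "{s. Re s > 1}" "- {1}" zeta "\<lambda>s. E s / (s - 1)"])
    show "{s. Re s > 1} \<noteq> {}" by (auto intro: exI[of _ 2])
    show "connected (- {1::complex})" by (rule connected_punctured_universe) simp
    show "(\<lambda>s. E s / (s - 1)) holomorphic_on - {1}"
      using E(1) by (auto intro!: holomorphic_intros intro: holomorphic_on_subset)
    fix z :: complex assume "z \<in> {s. Re s > 1}"
    then show "zeta z = E z / (z - 1)" using zeta_characterization(2)[of z] E(2)[of z] by auto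
  qed (use that zeta_characterization(1) in \<open>auto simp: open_halfspace_Re_gt\<close>)
  have "E analytic_on UNIV" using E(1) by (simp add: analytic_on_open)
  then have "(\<lambda>s. E s / (s - 1)) meromorphic_on UNIV"
    by (intro meromorphic_intros analytic_on_imp_meromorphic_on) (auto intro!: analytic_intros)
  moreover have "\<forall>\<^sub>F w in at z. zeta w = E w / (w - 1)" for z
  proof -
    have "\<forall>\<^sub>F w in at z. w \<noteq> 1"
      by (cases "z = 1") (auto simp: eventually_at_topological intro: exI[of _ "- {1}"])
    then show ?thesis by eventually_elim (rule eq)
  qed
  ultimately show ?thesis using meromorphic_on_cong[of UNIV zeta "\<lambda>s. E s / (s - 1)" UNIV] by simp
qed

lemma zeta_mult_meromorphic: "(\<lambda>s. zeta (c * s)) meromorphic_on UNIV"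
  by (rule meromorphic_on_compose[OF zeta_meromorphic]) (auto intro!: analytic_intros)

subsection \<open>Euler products\<close>

text \<open>The multiplicative function with value \<open>C a\<close> at \<open>p ^ a\<close>, for
  every prime \<open>p\<close> and \<open>a > 0\<close>.\<close>

definition mult_fun :: "(nat \<Rightarrow> complex) \<Rightarrow> nat \<Rightarrow> complex" where
  "mult_fun C n = (\<Prod>p\<in>prime_factors n. C (multiplicity p n))"

lemma of_nat_powr_mult: "(of_nat (a * b) :: complex) powr z = of_nat a powr z * of_nat b powr z"
  using powr_times_real[of "of_nat a" "of_nat b" z] by simp

lemma of_nat_powr_power: "(of_nat (a ^ k) :: complex) powr z = (of_nat a powr z) ^ k"
  by (induction k) (simp_all only: power_Suc of_nat_powr_mult, simp_all)

lemma of_nat_powr_prod: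
  "(of_nat (\<Prod>i\<in>A. f i) :: complex) powr z = (\<Prod>i\<in>A. of_nat (f i) powr z)"
proof (induction A rule: infinite_finite_induct)
  case (insert x F)
  show ?case by (simp only: prod.insert[OF insert.hyps] of_nat_powr_mult insert.IH)
qed simp_all

lemma multiplicity_less_self:
  fixes n p :: nat
  assumes "n > 0" "prime p"
  shows "multiplicity p n < n"
proof -
  have "multiplicity p n < 2 ^ multiplicity p n" by (rule less_exp)
  also have "\<dots> \<le> p ^ multiplicity p n" using prime_ge_2_nat[OF assms(2)] by (rule power_mono) simp
  also have "\<dots> \<le> n" using assms(1) by (intro dvd_imp_le multiplicity_dvd)
  finally show ?thesis .
qed

lemma mult_fun_prod_primes:
  assumes "finite P" "\<And>p. p \<in> P \<Longrightarrow> prime p" "C 0 = 1"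
  shows "mult_fun C (\<Prod>p\<in>P. p ^ g p) = (\<Prod>p\<in>P. C (g p))"
proof -
  let ?n = "\<Prod>p\<in>P. p ^ g p"
  have mult: "multiplicity q ?n = (if q \<in> P then g q else 0)" if "prime q" for q
    using assms that by (intro multiplicity_prod_prime_powers) auto
  have n0: "?n > 0" using assms(2) by (intro prod_pos) (auto intro: prime_gt_0_nat)
  have "prime_factors ?n \<subseteq> P"
  proof
    fix q assume q: "q \<in> prime_factors ?n"
    then have "multiplicity q ?n > 0" using n0 by (auto simp: prime_factors_multiplicity)
    then show "q \<in> P" using mult[OF in_prime_factors_imp_prime[OF q]] by (simp split: if_splits)
  qed
  moreover have "C (multiplicity q ?n) = 1" if "q \<in> P - prime_factors ?n" for q
    using that assms(2)[of q] n0 assms(3) by (auto simp: prime_factors_multiplicity)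
  ultimately have "mult_fun C ?n = (\<Prod>q\<in>P. C (multiplicity q ?n))"
    unfolding mult_fun_def using assms(1) by (intro prod.mono_neutral_left) auto
  also have "\<dots> = (\<Prod>q\<in>P. C (g q))" using mult assms(2) by (intro prod.cong) auto
  finally show ?thesis .
qed

lemma inj_on_prod_primes:
  assumes "finite P" "\<And>p. p \<in> P \<Longrightarrow> prime p"
  shows "inj_on (\<lambda>g. \<Prod>p\<in>P. p ^ g p :: nat) (PiE P A)"
proof (rule inj_onI)
  fix g h assume g: "g \<in> PiE P A" "h \<in> PiE P A" and eq: "(\<Prod>p\<in>P. p ^ g p) = (\<Prod>p\<in>P. p ^ h p)"
  have "g q = h q" if "q \<in> P" for q
  proof -
    have "multiplicity q (\<Prod>p\<in>P. p ^ u p) = u q" for u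
      using assms that by (subst multiplicity_prod_prime_powers) auto
    then show ?thesis using eq by metis
  qed
  then show "g = h" using g by (auto intro: PiE_ext)
qed

lemma finite_euler_product:
  assumes "finite P" "\<And>p. p \<in> P \<Longrightarrow> prime p" "C 0 = 1"
  shows "(\<Sum>n\<in>(\<lambda>g. \<Prod>p\<in>P. p ^ g p) ` (PiE P (\<lambda>_. {..M})). mult_fun C n * of_nat n powr z) =
    (\<Prod>p\<in>P. \<Sum>a\<le>M. C a * (of_nat p powr z) ^ a)"
proof -
  have "(\<Sum>n\<in>(\<lambda>g. \<Prod>p\<in>P. p ^ g p) ` (PiE P (\<lambda>_. {..M})). mult_fun C n * of_nat n powr z) =
      (\<Sum>g\<in>PiE P (\<lambda>_. {..M}). mult_fun C (\<Prod>p\<in>P. p ^ g p) * of_nat (\<Prod>p\<in>P. p ^ g p) powr z)"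
    by (subst sum.reindex[OF inj_on_prod_primes[OF assms(1,2)]]) simp_all
  also have "\<dots> = (\<Sum>g\<in>PiE P (\<lambda>_. {..M}). \<Prod>p\<in>P. C (g p) * (of_nat p powr z) ^ g p)"
    by (simp only: mult_fun_prod_primes[of P C, OF assms] of_nat_powr_prod of_nat_powr_power prod.distrib)
  also have "\<dots> = (\<Prod>p\<in>P. \<Sum>a\<le>M. C a * (of_nat p powr z) ^ a)"
    using assms(1) by (subst prod_sum_PiE) simp_all
  finally show ?thesis .
qed

abbreviation primes_le :: "nat \<Rightarrow> nat set" where
  "primes_le N \<equiv> {p. prime p \<and> p \<le> N}"

text \<open>Exponents up to \<open>M\<close> suffice because \<open>multiplicity p n < n\<close>; so
  the truncated Euler product over the primes up to \<open>N\<close> contains every term with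
  \<open>n \<le> N\<close>.\<close>

lemma atLeastAtMost_subset_smooth:
  assumes "N \<le> M"
  shows "{1..N} \<subseteq> (\<lambda>g. \<Prod>p\<in>primes_le N. p ^ g p) ` (PiE (primes_le N) (\<lambda>_. {..M}))"
proof
  fix n assume n: "n \<in> {1..N}"
  have fin: "finite (primes_le N)" by simp
  have "(\<Prod>p\<in>primes_le N. p ^ multiplicity p n) = (\<Prod>p\<in>prime_factors n. p ^ multiplicity p n)"
  proof (rule prod.mono_neutral_right[OF fin])
    show "prime_factors n \<subseteq> primes_le N" using n by (auto simp: prime_factors_dvd dest!: dvd_imp_le)
    show "\<forall>p\<in>primes_le N - prime_factors n. p ^ multiplicity p n = 1"
      using n by (auto simp: prime_factors_multiplicity)
  qed
  also have "\<dots> = n" using n by (intro prod_primes_power_multiplicity) auto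
  finally have eq: "n = (\<Prod>p\<in>primes_le N. p ^ restrict (\<lambda>p. multiplicity p n) (primes_le N) p)" by simp
  have "multiplicity p n \<le> M" if "prime p" for p
    using multiplicity_less_self[of n p] that n assms by simp
  then have "restrict (\<lambda>p. multiplicity p n) (primes_le N) \<in> PiE (primes_le N) (\<lambda>_. {..M})" by auto
  then have "(\<Prod>p\<in>primes_le N. p ^ restrict (\<lambda>p. multiplicity p n) (primes_le N) p) \<in>
      (\<lambda>g. \<Prod>p\<in>primes_le N. p ^ g p) ` (PiE (primes_le N) (\<lambda>_. {..M}))" by (rule imageI)
  then show "n \<in> (\<lambda>g. \<Prod>p\<in>primes_le N. p ^ g p) ` (PiE (primes_le N) (\<lambda>_. {..M}))"
    by (simp only: eq[symmetric])
qed

lemma smooth_pos: "n \<in> (\<lambda>g. \<Prod>p\<in>primes_le N. p ^ g p) ` X \<Longrightarrow> n > 0"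
proof -
  have "(\<Prod>p\<in>primes_le N. p ^ g p) > 0" for g
    by (rule prod_pos) (auto intro: prime_gt_0_nat)
  then show "n \<in> (\<lambda>g. \<Prod>p\<in>primes_le N. p ^ g p) ` X \<Longrightarrow> n > 0" by blast
qed

text \<open>Norms of terms are again terms, for the coefficients \<open>norm (C a)\<close> at a real
  exponent, so \<open>finite_euler_product\<close> evaluates sums of norms too.\<close>

lemma norm_mult_fun_term:
  assumes "n > 0"
  shows "complex_of_real (norm (mult_fun C n * of_nat n powr z)) =
    mult_fun (\<lambda>a. of_real (norm (C a))) n * of_nat n powr of_real (Re z)"
proof -
  have "of_nat n powr (of_real (Re z) :: complex) = of_real (real n powr Re z)"
    using assms by (simp add: powr_of_real[symmetric])
  then show ?thesis
    using assms by (simp add: norm_mult norm_of_nat_powr mult_fun_def prod_norm[symmetric])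
qed

text \<open>One tail bounds the terms of \<open>A\<close> beyond \<open>N\<close>, a second one the
  terms of the series beyond \<open>N\<close>; hence the factor 2.\<close>

lemma norm_sum_diff_suminf_le:
  fixes u :: "nat \<Rightarrow> complex"
  assumes sm: "summable (\<lambda>n. norm (u n))" and A: "finite A" "{..<N} \<subseteq> A"
  shows "norm (sum u A - suminf u) \<le> 2 * (suminf (\<lambda>n. norm (u (n + N))))"
proof -
  let ?T = "suminf (\<lambda>n. norm (u (n + N)))"
  have smN: "summable (\<lambda>n. norm (u (n + N)))" using sm by (subst summable_iff_shift)
  have "norm (sum u (A - {..<N})) \<le> (\<Sum>i\<in>A - {..<N}. norm (u i))" by (rule norm_sum)
  also have "\<dots> = (\<Sum>j\<in>(\<lambda>i. i - N) ` (A - {..<N}). norm (u (j + N)))"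
    by (subst sum.reindex) (auto simp: inj_on_def not_less)
  also have "\<dots> \<le> ?T" using A smN by (intro sum_le_suminf) auto
  finally have 1: "norm (sum u (A - {..<N})) \<le> ?T" .
  have "suminf u - sum u {..<N} = suminf (\<lambda>n. u (n + N))"
    using suminf_minus_initial_segment[OF summable_norm_cancel[OF sm], of N] by simp
  moreover have "norm (suminf (\<lambda>n. u (n + N))) \<le> ?T" using smN by (rule summable_norm)
  ultimately have 2: "norm (suminf u - sum u {..<N}) \<le> ?T" by simp
  have "sum u A = sum u (A - {..<N}) + sum u {..<N}" using A by (rule sum.subset_diff[rotated])
  then have "sum u A - suminf u = sum u (A - {..<N}) - (suminf u - sum u {..<N})" by simp
  then have "norm (sum u A - suminf u) \<le> norm (sum u (A - {..<N})) + norm (suminf u - sum u {..<N})"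
    by (metis norm_triangle_ineq4)
  then show ?thesis using 1 2 by simp
qed

text \<open>Each local series differs from 1 by at most \<open>B p\<close>. The bound is nonnegative
  and summable over all naturals, so sums over sets of primes are controlled by
  \<open>suminf B\<close>.\<close>

locale euler_product =
  fixes C :: "nat \<Rightarrow> complex" and s :: complex and B :: "nat \<Rightarrow> real"
  assumes C0: "C 0 = 1"
    and summable_local: "\<And>p. prime p \<Longrightarrow> summable (\<lambda>a. norm (C a * (of_nat p powr - s) ^ a))"
    and local_le: "\<And>p. prime p \<Longrightarrow> (\<Sum>a. norm (C (Suc a) * (of_nat p powr - s) ^ Suc a)) \<le> B p"
    and B_nonneg: "\<And>p. B p \<ge> 0" and summable_B: "summable B"
begin

lemma local_sum_le:
  assumes "prime p"
  shows "(\<Sum>a\<le>M. norm (C a * (of_nat p powr - s) ^ a)) \<le> exp (B p)"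
proof -
  have sm: "summable (\<lambda>a. norm (C (Suc a) * (of_nat p powr - s) ^ Suc a))"
    by (subst summable_Suc_iff[of "\<lambda>a. norm (C a * (of_nat p powr - s) ^ a)"])
      (rule summable_local[OF assms])
  have "(\<Sum>a\<le>M. norm (C a * (of_nat p powr - s) ^ a)) =
      1 + (\<Sum>a<M. norm (C (Suc a) * (of_nat p powr - s) ^ Suc a))"
    by (subst sum.atMost_shift) (simp add: C0 del: power_Suc)
  also have "(\<Sum>a<M. norm (C (Suc a) * (of_nat p powr - s) ^ Suc a)) \<le>
      (\<Sum>a. norm (C (Suc a) * (of_nat p powr - s) ^ Suc a))"
    by (rule sum_le_suminf[OF sm]) auto
  also have "\<dots> \<le> B p" by (rule local_le[OF assms])
  also have "1 + B p \<le> exp (B p)" by (rule exp_ge_add_one_self)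
  finally show ?thesis by simp
qed

text \<open>The norms up to \<open>N\<close> are among the terms of the expanded product over the
  primes up to \<open>N\<close>, and \<open>1 + B p \<le> exp (B p)\<close> bounds that product by
  \<open>exp (suminf B)\<close> for all \<open>N\<close>.\<close>

lemma abs_conv: "dirichlet_abs_conv (mult_fun C) s"
  unfolding dirichlet_abs_conv_def
proof (rule summableI_nonneg_bounded)
  fix N
  let ?t = "\<lambda>n. mult_fun C n * of_nat n powr - s"
  let ?H = "(\<lambda>g. \<Prod>p\<in>primes_le N. p ^ g p) ` (PiE (primes_le N) (\<lambda>_. {..N}))"
  have fin: "finite (primes_le N)" by simp
  then have finH: "finite ?H" by (intro finite_imageI finite_PiE) auto
  have pos: "n > 0" if "n \<in> ?H" for n using that by (rule smooth_pos)
  have "(\<Sum>i<N. norm (?t (Suc i))) = (\<Sum>n\<in>{1..N}. norm (?t n))"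
    by (rule sum.reindex_bij_witness[of _ "\<lambda>n. n - 1" Suc]) auto
  also have "\<dots> \<le> (\<Sum>n\<in>?H. norm (?t n))"
    using atLeastAtMost_subset_smooth[of N N] finH by (intro sum_mono2) auto
  also have "\<dots> = (\<Prod>p\<in>primes_le N. \<Sum>a\<le>N. norm (C a * (of_nat p powr - s) ^ a))"
  proof -
    \<comment> \<open>\<open>finite_euler_product\<close> is a complex statement, so the real
      identity is proved after embedding.\<close>
    have "complex_of_real (\<Sum>n\<in>?H. norm (?t n)) =
        (\<Sum>n\<in>?H. mult_fun (\<lambda>a. of_real (norm (C a))) n * of_nat n powr of_real (Re (- s)))"
      unfolding of_real_sum using pos by (intro sum.cong refl norm_mult_fun_term)
    also have "\<dots> = (\<Prod>p\<in>primes_le N. \<Sum>a\<le>N. of_real (norm (C a)) * (of_nat p powr of_real (Re (- s))) ^ a)"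
      by (rule finite_euler_product) (simp_all add: C0)
    also have "\<dots> = (\<Prod>p\<in>primes_le N. \<Sum>a\<le>N. complex_of_real (norm (C a * (of_nat p powr - s) ^ a)))"
    proof (intro prod.cong sum.cong refl)
      fix p a assume "p \<in> primes_le N"
      then have p: "p > 0" using prime_gt_0_nat by auto
      have "of_nat p powr (of_real (Re (- s)) :: complex) = of_real (real p powr Re (- s))"
        using p by (simp add: powr_of_real[symmetric])
      then show "of_real (norm (C a)) * (of_nat p powr of_real (Re (- s))) ^ a =
          complex_of_real (norm (C a * (of_nat p powr - s) ^ a))"
        using p by (simp add: norm_mult norm_power norm_of_nat_powr)
    qed
    also have "\<dots> = complex_of_real (\<Prod>p\<in>primes_le N. \<Sum>a\<le>N. norm (C a * (of_nat p powr - s) ^ a))"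
      by simp
    finally show ?thesis by (simp only: of_real_eq_iff)
  qed
  also have "\<dots> \<le> (\<Prod>p\<in>primes_le N. exp (B p))"
    using local_sum_le by (intro prod_mono) (auto intro!: sum_nonneg)
  also have "\<dots> = exp (\<Sum>p\<in>primes_le N. B p)" by (simp add: exp_sum)
  also have "\<dots> \<le> exp (suminf B)"
    using B_nonneg summable_B fin by (simp add: sum_le_suminf)
  finally show "(\<Sum>i<N. norm (mult_fun C (Suc i) * of_nat (Suc i) powr - s)) \<le> exp (suminf B)" .
qed simp

text \<open>For \<open>M \<ge> N\<close> the product of the local sums truncated at \<open>M\<close>
  is a finite sum containing all terms up to \<open>N\<close>, so it misses the limit by at most two
  tails. Letting \<open>M\<close> grow with \<open>N\<close> fixed completes the local factors; then
  \<open>N\<close> grows.\<close>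

lemma product_tendsto:
  "(\<lambda>N. \<Prod>p\<in>primes_le N. \<Sum>a. C a * (of_nat p powr - s) ^ a) \<longlonglongrightarrow> dirichlet_series (mult_fun C) s"
proof -
  define u where "u = (\<lambda>n. mult_fun C (Suc n) * of_nat (Suc n) powr - s)"
  have sm: "summable (\<lambda>n. norm (u n))" using abs_conv unfolding dirichlet_abs_conv_def u_def .
  define T where "T = (\<lambda>N. 2 * suminf (\<lambda>n. norm (u (n + N))))"
  have "T \<longlonglongrightarrow> 2 * (suminf (\<lambda>n. norm (u n)) - suminf (\<lambda>n. norm (u n)))"
    unfolding T_def suminf_minus_initial_segment[OF sm]
    by (intro tendsto_intros summable_LIMSEQ sm)
  then have T: "T \<longlonglongrightarrow> 0" by simp
  have bound: "norm ((\<Prod>p\<in>primes_le N. \<Sum>a. C a * (of_nat p powr - s) ^ a) - suminf u) \<le> T N" for N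
  proof (rule LIMSEQ_le_const2)
    have "(\<lambda>M. \<Prod>p\<in>primes_le N. \<Sum>a\<le>M. C a * (of_nat p powr - s) ^ a) \<longlonglongrightarrow>
        (\<Prod>p\<in>primes_le N. \<Sum>a. C a * (of_nat p powr - s) ^ a)"
    proof (rule tendsto_prod)
      fix p assume "p \<in> primes_le N"
      then have "summable (\<lambda>a. C a * (of_nat p powr - s) ^ a)"
        using summable_local[of p] by (simp only: mem_Collect_eq summable_norm_cancel)
      then show "(\<lambda>M. \<Sum>a\<le>M. C a * (of_nat p powr - s) ^ a) \<longlonglongrightarrow> (\<Sum>a. C a * (of_nat p powr - s) ^ a)"
        by (rule summable_LIMSEQ')
    qed
    then show "(\<lambda>M. norm ((\<Prod>p\<in>primes_le N. \<Sum>a\<le>M. C a * (of_nat p powr - s) ^ a) - suminf u)) \<longlonglongrightarrow>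
        norm ((\<Prod>p\<in>primes_le N. \<Sum>a. C a * (of_nat p powr - s) ^ a) - suminf u)"
      by (intro tendsto_norm tendsto_diff tendsto_const)
    show "\<exists>M0. \<forall>M\<ge>M0. norm ((\<Prod>p\<in>primes_le N. \<Sum>a\<le>M. C a * (of_nat p powr - s) ^ a) - suminf u) \<le> T N"
    proof (intro exI[of _ N] allI impI)
      fix M assume M: "N \<le> M"
      let ?H = "(\<lambda>g. \<Prod>p\<in>primes_le N. p ^ g p) ` (PiE (primes_le N) (\<lambda>_. {..M}))"
      \<comment> \<open>The term of \<open>n\<close> is \<open>u (n - 1)\<close>, since
        \<open>u\<close> is indexed from 0.\<close>
      let ?A = "(\<lambda>n. n - 1) ` ?H"
      have finH: "finite ?H" by (intro finite_imageI finite_PiE) auto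
      have pos: "n > 0" if "n \<in> ?H" for n using that by (rule smooth_pos)
      have "(\<Sum>n\<in>?H. mult_fun C n * of_nat n powr - s) = (\<Sum>n\<in>?H. u (n - 1))"
      proof (rule sum.cong[OF refl])
        fix n assume "n \<in> ?H"
        then have "Suc (n - 1) = n" using pos[of n] by simp
        then show "mult_fun C n * of_nat n powr - s = u (n - 1)" by (simp only: u_def)
      qed
      also have "\<dots> = sum u ?A"
      proof (rule sum.reindex[symmetric, unfolded o_def])
        show "inj_on (\<lambda>n. n - 1) ?H"
        proof (rule inj_onI)
          fix a b assume "a \<in> ?H" "b \<in> ?H" "a - 1 = b - 1"
          then show "a = b" using pos[of a] pos[of b] by linarith
        qed
      qed
      finally have e1: "(\<Sum>n\<in>?H. mult_fun C n * of_nat n powr - s) = sum u ?A" .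
      have "(\<Sum>n\<in>?H. mult_fun C n * of_nat n powr - s) =
          (\<Prod>p\<in>primes_le N. \<Sum>a\<le>M. C a * (of_nat p powr - s) ^ a)"
        by (rule finite_euler_product) (simp_all add: C0)
      with e1 have eq: "sum u ?A = (\<Prod>p\<in>primes_le N. \<Sum>a\<le>M. C a * (of_nat p powr - s) ^ a)"
        by (rule trans[OF sym])
      have "{..<N} \<subseteq> ?A"
      proof
        fix i assume "i \<in> {..<N}"
        then have "Suc i \<in> {1..N}" by simp
        then have "Suc i \<in> ?H" using atLeastAtMost_subset_smooth[OF M] by (rule rev_subsetD)
        then have "Suc i - 1 \<in> ?A" by (rule imageI)
        then show "i \<in> ?A" by (simp only: diff_Suc_1)
      qed
      then show "norm ((\<Prod>p\<in>primes_le N. \<Sum>a\<le>M. C a * (of_nat p powr - s) ^ a) - suminf u) \<le> T N"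
        unfolding T_def eq[symmetric] by (rule norm_sum_diff_suminf_le[OF sm finite_imageI[OF finH]])
    qed
  qed
  have "(\<lambda>N. (\<Prod>p\<in>primes_le N. \<Sum>a. C a * (of_nat p powr - s) ^ a) - suminf u) \<longlonglongrightarrow> 0"
    by (rule Lim_null_comparison[OF _ T]) (use bound in auto)
  then show ?thesis unfolding dirichlet_series_def u_def by (rule LIM_zero_cancel)
qed

text \<open>Setting the factors at non-primes to 1 makes this a product over all naturals with
  summable deviations from 1; an absolutely convergent product of nonzero factors is
  nonzero.\<close>

lemma dirichlet_series_nonzero:
  assumes nz: "\<And>p. prime p \<Longrightarrow> (\<Sum>a. C a * (of_nat p powr - s) ^ a) \<noteq> 0"
  shows "dirichlet_series (mult_fun C) s \<noteq> 0"
proof -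
  define f where "f = (\<lambda>n. if prime n then (\<Sum>a. C a * (of_nat n powr - s) ^ a) else 1)"
  have "norm (f n - 1) \<le> B n" for n
  proof (cases "prime n")
    case True
    have sm: "summable (\<lambda>a. C a * (of_nat n powr - s) ^ a)"
      by (rule summable_norm_cancel[OF summable_local[OF True]])
    have "f n - 1 = (\<Sum>a. C (Suc a) * (of_nat n powr - s) ^ Suc a)"
      using suminf_split_head[OF sm] True by (simp add: f_def C0)
    also have "norm \<dots> \<le> (\<Sum>a. norm (C (Suc a) * (of_nat n powr - s) ^ Suc a))"
      by (rule summable_norm, subst summable_Suc_iff[of "\<lambda>a. norm (C a * (of_nat n powr - s) ^ a)"])
        (rule summable_local[OF True])
    finally show ?thesis using local_le[OF True] by simp
  qed (simp add: f_def B_nonneg)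
  then have "summable (\<lambda>n. norm (f n - 1))" by (intro summable_comparison_test'[OF summable_B]) simp
  then have conv: "convergent_prod f"
    by (intro abs_convergent_prod_imp_convergent_prod summable_imp_abs_convergent_prod)
  have "(\<Prod>p\<in>primes_le N. \<Sum>a. C a * (of_nat p powr - s) ^ a) = (\<Prod>i\<le>N. f i)" for N
    unfolding f_def by (rule prod.mono_neutral_cong_left) auto
  then have "dirichlet_series (mult_fun C) s = prodinf f"
    using product_tendsto convergent_prod_LIMSEQ[OF conv] LIMSEQ_unique by simp
  moreover have "f i \<noteq> 0" for i using nz by (simp add: f_def)
  ultimately show ?thesis using prodinf_nonzero[OF conv] by simp
qed

end

section \<open>Euler products whose local factors are one power series in
  \<open>p powr - s\<close>\<close>

lemma norm_prime_powr_less_1: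
  assumes "prime p" "Re s > 0"
  shows "norm (of_nat p powr - s :: complex) < 1"
  using assms prime_gt_1_nat[OF assms(1)] by (simp add: norm_of_nat_powr powr_less_one)

lemma of_nat_powr_of_nat_mult:
  assumes "n > 0"
  shows "(of_nat n :: complex) powr - (of_nat j * s) = (of_nat n powr - s) ^ j"
proof (induction j)
  case (Suc j)
  have "- (of_nat (Suc j) * s) = - s + - (of_nat j * s)" by (simp add: algebra_simps)
  then show ?case using Suc by (simp only: powr_add power_Suc)
qed (use assms in simp)

text \<open>Apart from its constant term \<open>C\<close> starts in degree \<open>m\<close>, so the
  local deviation is at most a constant times \<open>p powr (- m * Re s)\<close>, with summable
  bound when \<open>m * Re s > 1\<close>.\<close>

lemma fps_euler_product:
  fixes C :: "complex fps"
  assumes R: "fps_conv_radius C \<ge> 1" and C0: "fps_nth C 0 = 1"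
    and Cm: "\<And>j. 0 < j \<Longrightarrow> j < m \<Longrightarrow> fps_nth C j = 0" and m: "m > 0" and s: "real m * Re s > 1"
  shows "\<exists>B. euler_product (fps_nth C) s B"
proof -
  have s0: "Re s > 0" using s m by (metis mult_nonneg_nonpos not_less of_nat_0_le_iff not_one_less_zero le_less_trans)
  \<comment> \<open>The largest value of \<open>norm (p powr - s)\<close> over primes, attained at
    2. For degrees at least \<open>m\<close> the ratio \<open>y / w \<le> 1\<close> yields the
    factor \<open>(y / w) ^ m\<close>, uniformly in \<open>p\<close>.\<close>
  define w where "w = 2 powr (- Re s)"
  have w: "w > 0" "w < 1" using s0 by (auto simp: w_def powr_less_one)
  define D where "D = (\<Sum>a. norm (fps_nth C (Suc a)) * w ^ Suc a)"
  have abs: "summable (\<lambda>a. norm (fps_nth C a * z ^ a))" if "norm z < 1" for z :: complex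
  proof (rule abs_summable_in_conv_radius[of z "fps_nth C", folded fps_conv_radius_def])
    have "ereal (norm z) < 1" using that by (simp add: one_ereal_def)
    then show "ereal (norm z) < fps_conv_radius C" using R by (rule less_le_trans)
  qed
  have smw: "summable (\<lambda>a. norm (fps_nth C (Suc a)) * w ^ Suc a)"
    using abs[of "of_real w"] w
    by (subst summable_Suc_iff[of "\<lambda>a. norm (fps_nth C a) * w ^ a"]) (simp add: norm_mult norm_power)
  have D: "D \<ge> 0" unfolding D_def using w by (intro suminf_nonneg smw) simp
  define B where "B = (\<lambda>p. D / w ^ m * real p powr (- (real m * Re s)))"
  have "euler_product (fps_nth C) s B"
  proof
    show "fps_nth C 0 = 1" by (rule C0)
    show "B p \<ge> 0" for p using D w by (simp add: B_def)
    show "summable B" unfolding B_def using s by (intro summable_mult) (simp add: summable_real_powr_iff)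
    fix p :: nat assume p: "prime p"
    let ?x = "of_nat p powr - s :: complex"
    show sm: "summable (\<lambda>a. norm (fps_nth C a * ?x ^ a))" by (rule abs[OF norm_prime_powr_less_1[OF p s0]])
    define y where "y = norm ?x"
    have y: "y = real p powr (- Re s)" using prime_gt_0_nat[OF p] by (simp add: y_def norm_of_nat_powr)
    have y0: "y > 0" using prime_gt_0_nat[OF p] by (simp add: y)
    have yw: "y \<le> w" unfolding y w_def using prime_ge_2_nat[OF p] s0 by (intro powr_mono2') auto
    have le: "norm (fps_nth C (Suc a) * ?x ^ Suc a) \<le> (y / w) ^ m * (norm (fps_nth C (Suc a)) * w ^ Suc a)" for a
    proof (cases "Suc a < m")
      case True
      then show ?thesis using Cm[of "Suc a"] by simp
    next
      case False
      have "y ^ Suc a = (y / w) ^ Suc a * w ^ Suc a" using w by (simp add: power_divide)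
      also have "\<dots> \<le> (y / w) ^ m * w ^ Suc a"
        using False y0 yw w by (intro mult_right_mono power_decreasing) auto
      finally have "norm (fps_nth C (Suc a)) * y ^ Suc a \<le> norm (fps_nth C (Suc a)) * ((y / w) ^ m * w ^ Suc a)"
        by (rule mult_left_mono) simp
      then show ?thesis by (simp add: norm_mult norm_power y_def mult_ac)
    qed
    have "(\<Sum>a. norm (fps_nth C (Suc a) * ?x ^ Suc a)) \<le>
        (\<Sum>a. (y / w) ^ m * (norm (fps_nth C (Suc a)) * w ^ Suc a))"
    proof (rule suminf_le[OF le])
      show "summable (\<lambda>a. norm (fps_nth C (Suc a) * ?x ^ Suc a))"
        by (subst summable_Suc_iff[of "\<lambda>a. norm (fps_nth C a * ?x ^ a)"]) (rule sm)
      show "summable (\<lambda>a. (y / w) ^ m * (norm (fps_nth C (Suc a)) * w ^ Suc a))"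
        by (intro summable_mult smw)
    qed
    also have "\<dots> = (y / w) ^ m * D" unfolding D_def by (rule suminf_mult[OF smw])
    also have "\<dots> = B p"
    proof -
      have "y ^ m = real p powr (- (real m * Re s))"
        using prime_gt_0_nat[OF p] by (simp add: y powr_powr powr_realpow[symmetric] mult.commute)
      then show ?thesis by (simp add: B_def power_divide)
    qed
    finally show "(\<Sum>a. norm (fps_nth C (Suc a) * ?x ^ Suc a)) \<le> B p" .
  qed
  then show ?thesis by blast
qed

lemma fps_euler_product_props:
  fixes C :: "complex fps"
  assumes "fps_conv_radius C \<ge> 1" "fps_nth C 0 = 1"
    "\<And>j. 0 < j \<Longrightarrow> j < m \<Longrightarrow> fps_nth C j = 0" "m > 0" "real m * Re s > 1"
  shows "dirichlet_abs_conv (mult_fun (fps_nth C)) s"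
    "(\<lambda>N. \<Prod>p\<in>primes_le N. eval_fps C (of_nat p powr - s)) \<longlonglongrightarrow> dirichlet_series (mult_fun (fps_nth C)) s"
    "(\<And>p. prime p \<Longrightarrow> eval_fps C (of_nat p powr - s) \<noteq> 0) \<Longrightarrow> dirichlet_series (mult_fun (fps_nth C)) s \<noteq> 0"
proof -
  obtain B where "euler_product (fps_nth C) s B" using fps_euler_product[OF assms] by blast
  then interpret euler_product "fps_nth C" s B .
  show "dirichlet_abs_conv (mult_fun (fps_nth C)) s" by (rule abs_conv)
  show "(\<lambda>N. \<Prod>p\<in>primes_le N. eval_fps C (of_nat p powr - s)) \<longlonglongrightarrow> dirichlet_series (mult_fun (fps_nth C)) s"
    unfolding eval_fps_def by (rule product_tendsto)
  show "(\<And>p. prime p \<Longrightarrow> eval_fps C (of_nat p powr - s) \<noteq> 0) \<Longrightarrow> dirichlet_series (mult_fun (fps_nth C)) s \<noteq> 0"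
    unfolding eval_fps_def by (rule dirichlet_series_nonzero)
qed

lemma zeta_euler_product:
  assumes s: "Re s > 1"
  shows "(\<lambda>N. \<Prod>p\<in>primes_le N. 1 / (1 - of_nat p powr - s)) \<longlonglongrightarrow> zeta s"
proof -
  let ?C = "Abs_fps (\<lambda>_. 1) :: complex fps"
  have R: "fps_conv_radius ?C \<ge> 1"
    unfolding fps_conv_radius_def
    by (rule conv_radius_geI_ex') (simp add: one_ereal_def summable_geometric)
  have "mult_fun (fps_nth ?C) = (\<lambda>_. 1)" by (simp add: mult_fun_def fun_eq_iff)
  moreover have "(\<lambda>N. \<Prod>p\<in>primes_le N. eval_fps ?C (of_nat p powr - s)) \<longlonglongrightarrow> dirichlet_series (mult_fun (fps_nth ?C)) s"
    by (rule fps_euler_product_props(2)[OF R, of 1]) (use s in auto)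
  moreover have "eval_fps ?C (of_nat p powr - s) = 1 / (1 - of_nat p powr - s)" if "prime p" for p
    using norm_prime_powr_less_1[OF that, of s] s by (simp add: eval_fps_def suminf_geometric)
  ultimately show ?thesis using zeta_characterization(2)[OF s] by simp
qed

text \<open>The Euler product with local factor \<open>1 - X\<close>, which belongs to the Moebius
  function, converges as well, and its partial products times those of zeta are constantly
  1.\<close>

lemma zeta_nonzero:
  assumes s: "Re s > 1"
  shows "zeta s \<noteq> 0"
proof
  assume z: "zeta s = 0"
  let ?C = "1 - fps_X :: complex fps"
  have R: "fps_conv_radius ?C \<ge> 1"
    using fps_conv_radius_diff[of "1 :: complex fps" fps_X] by simp
  have "(\<lambda>N. \<Prod>p\<in>primes_le N. eval_fps ?C (of_nat p powr - s)) \<longlonglongrightarrow> dirichlet_series (mult_fun (fps_nth ?C)) s"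
    by (rule fps_euler_product_props(2)[OF R, of 1]) (use s in auto)
  from tendsto_mult[OF this zeta_euler_product[OF s]]
  have "(\<lambda>N. (\<Prod>p\<in>primes_le N. eval_fps ?C (of_nat p powr - s)) *
      (\<Prod>p\<in>primes_le N. 1 / (1 - of_nat p powr - s))) \<longlonglongrightarrow> 0" using z by simp
  moreover have "(\<Prod>p\<in>primes_le N. eval_fps ?C (of_nat p powr - s)) *
      (\<Prod>p\<in>primes_le N. 1 / (1 - of_nat p powr - s)) = 1" for N
  proof -
    have "eval_fps ?C (of_nat p powr - s) * (1 / (1 - of_nat p powr - s)) = 1" if "prime p" for p
    proof -
      have "norm (of_nat p powr - s) < 1" using norm_prime_powr_less_1[OF that, of s] s by simp
      then have "1 - of_nat p powr - s \<noteq> 0" by auto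
      then show ?thesis by (subst eval_fps_diff) simp_all
    qed
    then show ?thesis unfolding prod.distrib[symmetric] by (intro prod.neutral) simp
  qed
  ultimately have "(\<lambda>N::nat. 1 :: complex) \<longlonglongrightarrow> 0" by simp
  then show False by (simp add: LIMSEQ_const_iff)
qed

subsection \<open>Local factors\<close>

definition part_fps :: "nat \<Rightarrow> complex fps" where
  "part_fps k = Abs_fps (\<lambda>a. of_nat (part_count k a))"

text \<open>With \<open>r = y * y\<close>, one factor \<open>y ^ n\<close> absorbs the polynomial
  and the other is left for the geometric comparison.\<close>

lemma summable_poly_times_power:
  fixes r :: real
  assumes "0 < r" "r < 1"
  shows "summable (\<lambda>n. real (n + 1) ^ K * r ^ n)"
proof -
  define y where "y = sqrt r"
  have y: "0 < y" "y < 1" "r = y * y" using assms by (auto simp: y_def)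
  have "(\<lambda>n. (real n + 1) ^ K * y ^ n) \<longlonglongrightarrow> 0" using y(1,2) by real_asymp
  then have "Bseq (\<lambda>n. (real n + 1) ^ K * y ^ n)" by (intro convergent_imp_Bseq convergentI)
  then obtain M where M: "\<And>n. norm ((real n + 1) ^ K * y ^ n) \<le> M" unfolding Bseq_def by blast
  show ?thesis
  proof (rule summable_comparison_test')
    show "summable (\<lambda>n. M * y ^ n)" using y by (intro summable_mult summable_geometric) simp
    fix n
    have "norm (real (n + 1) ^ K * r ^ n) = norm ((real n + 1) ^ K * y ^ n) * y ^ n"
      using y by (simp add: power_mult_distrib abs_mult add_ac)
    also have "\<dots> \<le> M * y ^ n" using M y by (intro mult_right_mono) auto
    finally show "norm (real (n + 1) ^ K * r ^ n) \<le> M * y ^ n" .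
  qed
qed

lemma part_fps_conv_radius: "fps_conv_radius (part_fps k) \<ge> 1"
  unfolding fps_conv_radius_def
proof (rule conv_radius_geI_ex')
  fix r :: real assume "0 < r" "ereal r < 1"
  then have r: "0 < r" "r < 1" by (simp_all add: one_ereal_def)
  show "summable (\<lambda>n. fps_nth (part_fps k) n * of_real r ^ n)"
  proof (rule summable_comparison_test'[OF summable_poly_times_power[OF r, of "2 * k"]])
    fix n
    have "real (part_count k n) \<le> real ((n + 1) ^ (2 * k))" using part_count_le of_nat_le_iff by blast
    then show "norm (fps_nth (part_fps k) n * of_real r ^ n) \<le> real (n + 1) ^ (2 * k) * r ^ n"
      using r by (simp add: part_fps_def norm_mult norm_power mult_right_mono)
  qed
qed

lemma part_fps_0: "fps_nth (part_fps k) 0 = 1"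
  by (simp add: part_fps_def part_count_0)

lemma part_fps_1: "part_fps 1 * (1 - fps_X) ^ 2 = 1"
proof (rule fps_ext)
  fix n
  have "part_fps 1 * (1 - fps_X) ^ 2 = part_fps 1 - fps_const 2 * (fps_X * part_fps 1) + fps_X ^ 2 * part_fps 1"
    by (simp add: power2_eq_square algebra_simps numeral_fps_const[symmetric])
  then show "fps_nth (part_fps 1 * (1 - fps_X) ^ 2) n = fps_nth 1 n"
    by (simp add: fps_X_power_mult_nth part_fps_def part_count_1[unfolded One_nat_def])
qed

text \<open>The closed form of the count involves \<open>a div 2\<close>, so the two parities give
  different polynomials in \<open>b\<close>.\<close>

lemma part_fps_2_even: "2 * fps_nth (part_fps 2) (2 * b) = (of_nat b + 1) ^ 2 * (of_nat b + 2)"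
proof -
  have "2 * real (part_count 2 (2 * b)) = (real b + 1) ^ 2 * (real b + 2)"
    using part_count_2[of "2 * b"] by (simp add: power2_eq_square algebra_simps)
  from arg_cong[OF this, of complex_of_real] show ?thesis by (simp add: part_fps_def)
qed

lemma part_fps_2_odd: "2 * fps_nth (part_fps 2) (2 * b + 1) = (of_nat b + 1) * (of_nat b + 2) ^ 2"
proof -
  have "2 * real (part_count 2 (2 * b + 1)) = (real b + 1) * (real b + 2) ^ 2"
    using part_count_2[of "2 * b + 1"] by (simp add: power2_eq_square algebra_simps)
  from arg_cong[OF this, of complex_of_real] show ?thesis by (simp add: part_fps_def)
qed

text \<open>The product on the left has degree 8 in its polynomial factor, so from
  \<open>n = 8\<close> on all shifted coefficients are in range and the claim is, for each parity, a
  polynomial identity in \<open>b\<close>. The eight initial coefficients are evaluated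
  directly.\<close>

lemma part_fps_2: "part_fps 2 * ((1 - fps_X) ^ 2 * (1 - fps_X ^ 2) ^ 3) = 1 - fps_X ^ 3"
proof (rule fps_ext)
  fix n
  let ?F = "part_fps 2"
  have id: "(1 - x) ^ 2 * (1 - x ^ 2) ^ 3 =
      1 - 2 * x - 2 * x ^ 2 + 6 * x ^ 3 - 6 * x ^ 5 + 2 * x ^ 6 + 2 * x ^ 7 - x ^ 8" for x :: "complex fps"
    by (simp add: eval_nat_numeral algebra_simps)
  have "?F * ((1 - fps_X) ^ 2 * (1 - fps_X ^ 2) ^ 3) =
      ?F - fps_const 2 * (fps_X ^ 1 * ?F) - fps_const 2 * (fps_X ^ 2 * ?F) + fps_const 6 * (fps_X ^ 3 * ?F)
      - fps_const 6 * (fps_X ^ 5 * ?F) + fps_const 2 * (fps_X ^ 6 * ?F) + fps_const 2 * (fps_X ^ 7 * ?F) - fps_X ^ 8 * ?F"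
    unfolding id numeral_fps_const[symmetric] by (simp add: algebra_simps)
  then have nth: "fps_nth (?F * ((1 - fps_X) ^ 2 * (1 - fps_X ^ 2) ^ 3)) n =
      fps_nth ?F n - 2 * (if n < 1 then 0 else fps_nth ?F (n - 1)) - 2 * (if n < 2 then 0 else fps_nth ?F (n - 2))
      + 6 * (if n < 3 then 0 else fps_nth ?F (n - 3)) - 6 * (if n < 5 then 0 else fps_nth ?F (n - 5))
      + 2 * (if n < 6 then 0 else fps_nth ?F (n - 6)) + 2 * (if n < 7 then 0 else fps_nth ?F (n - 7))
      - (if n < 8 then 0 else fps_nth ?F (n - 8))"
    by (simp only: fps_add_nth fps_sub_nth fps_mult_left_const_nth fps_X_power_mult_nth)
  have v: "fps_nth ?F 0 = 1" "fps_nth ?F 1 = 2" "fps_nth ?F 2 = 6" "fps_nth ?F 3 = 9" "fps_nth ?F 4 = 18"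
      "fps_nth ?F 5 = 24" "fps_nth ?F 6 = 40" "fps_nth ?F 7 = 50"
    using part_fps_2_even[of 0] part_fps_2_odd[of 0] part_fps_2_even[of 1] part_fps_2_odd[of 1]
      part_fps_2_even[of 2] part_fps_2_odd[of 2] part_fps_2_even[of 3] part_fps_2_odd[of 3]
    by simp_all
  have rhs: "fps_nth (1 - fps_X ^ 3 :: complex fps) n = (if n = 0 then 1 else if n = 3 then - 1 else 0)"
    by (simp add: fps_X_power_nth)
  have two: "x = 0" if "2 * x = 0" for x :: complex using that by simp
  consider "n < 8" | b where "n = 2 * b + 8" | b where "n = 2 * b + 9"
  proof -
    have "n < 8 \<or> n = 2 * ((n - 8) div 2) + 8 \<or> n = 2 * ((n - 8) div 2) + 9" by presburger
    then show ?thesis using that by blast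
  qed
  then show "fps_nth (?F * ((1 - fps_X) ^ 2 * (1 - fps_X ^ 2) ^ 3)) n = fps_nth (1 - fps_X ^ 3) n"
  proof cases
    case 1
    then have "n = 0 \<or> n = 1 \<or> n = 2 \<or> n = 3 \<or> n = 4 \<or> n = 5 \<or> n = 6 \<or> n = 7" by linarith
    then show ?thesis
      unfolding nth rhs
      by (elim disjE) (simp_all add: v v[unfolded One_nat_def])
  next
    case (2 b)
    have n: "2 * (b + 4) = n" using 2 by simp
    have idx: "n - 1 = 2 * (b + 3) + 1" "n - 2 = 2 * (b + 3)" "n - 3 = 2 * (b + 2) + 1" "n - 5 = 2 * (b + 1) + 1" "n - 6 = 2 * (b + 1)" "n - 7 = 2 * b + 1" "n - 8 = 2 * b"
      using 2 by simp_all
    have neg: "\<not> n < 1" "\<not> n < 2" "\<not> n < 3" "\<not> n < 5" "\<not> n < 6" "\<not> n < 7" "\<not> n < 8" "n \<noteq> 0" "n \<noteq> 3"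
      using 2 by simp_all
    have "2 * (fps_nth ?F (2 * (b + 4)) - 2 * fps_nth ?F (2 * (b + 3) + 1) - 2 * fps_nth ?F (2 * (b + 3)) + 6 * fps_nth ?F (2 * (b + 2) + 1) - 6 * fps_nth ?F (2 * (b + 1) + 1)
        + 2 * fps_nth ?F (2 * (b + 1)) + 2 * fps_nth ?F (2 * b + 1) - fps_nth ?F (2 * b)) =
        2 * fps_nth ?F (2 * (b + 4)) - 2 * (2 * fps_nth ?F (2 * (b + 3) + 1)) - 2 * (2 * fps_nth ?F (2 * (b + 3))) + 6 * (2 * fps_nth ?F (2 * (b + 2) + 1))
        - 6 * (2 * fps_nth ?F (2 * (b + 1) + 1)) + 2 * (2 * fps_nth ?F (2 * (b + 1))) + 2 * (2 * fps_nth ?F (2 * b + 1)) - 2 * fps_nth ?F (2 * b)"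
      by (simp add: algebra_simps)
    also have "\<dots> = 0"
      unfolding part_fps_2_even part_fps_2_odd by (simp add: power2_eq_square algebra_simps)
    finally have "fps_nth ?F (2 * (b + 4)) - 2 * fps_nth ?F (2 * (b + 3) + 1) - 2 * fps_nth ?F (2 * (b + 3)) + 6 * fps_nth ?F (2 * (b + 2) + 1) - 6 * fps_nth ?F (2 * (b + 1) + 1)
        + 2 * fps_nth ?F (2 * (b + 1)) + 2 * fps_nth ?F (2 * b + 1) - fps_nth ?F (2 * b) = 0"
      by (rule two)
    then show ?thesis
      unfolding nth rhs by (simp only: n idx neg if_False)
  next
    case (3 b)
    have n: "2 * (b + 4) + 1 = n" using 3 by simp
    have idx: "n - 1 = 2 * (b + 4)" "n - 2 = 2 * (b + 3) + 1" "n - 3 = 2 * (b + 3)" "n - 5 = 2 * (b + 2)" "n - 6 = 2 * (b + 1) + 1" "n - 7 = 2 * (b + 1)" "n - 8 = 2 * b + 1"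
      using 3 by simp_all
    have neg: "\<not> n < 1" "\<not> n < 2" "\<not> n < 3" "\<not> n < 5" "\<not> n < 6" "\<not> n < 7" "\<not> n < 8" "n \<noteq> 0" "n \<noteq> 3"
      using 3 by simp_all
    have "2 * (fps_nth ?F (2 * (b + 4) + 1) - 2 * fps_nth ?F (2 * (b + 4)) - 2 * fps_nth ?F (2 * (b + 3) + 1) + 6 * fps_nth ?F (2 * (b + 3)) - 6 * fps_nth ?F (2 * (b + 2))
        + 2 * fps_nth ?F (2 * (b + 1) + 1) + 2 * fps_nth ?F (2 * (b + 1)) - fps_nth ?F (2 * b + 1)) =
        2 * fps_nth ?F (2 * (b + 4) + 1) - 2 * (2 * fps_nth ?F (2 * (b + 4))) - 2 * (2 * fps_nth ?F (2 * (b + 3) + 1)) + 6 * (2 * fps_nth ?F (2 * (b + 3)))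
        - 6 * (2 * fps_nth ?F (2 * (b + 2))) + 2 * (2 * fps_nth ?F (2 * (b + 1) + 1)) + 2 * (2 * fps_nth ?F (2 * (b + 1))) - 2 * fps_nth ?F (2 * b + 1)"
      by (simp add: algebra_simps)
    also have "\<dots> = 0"
      unfolding part_fps_2_even part_fps_2_odd by (simp add: power2_eq_square algebra_simps)
    finally have "fps_nth ?F (2 * (b + 4) + 1) - 2 * fps_nth ?F (2 * (b + 4)) - 2 * fps_nth ?F (2 * (b + 3) + 1) + 6 * fps_nth ?F (2 * (b + 3)) - 6 * fps_nth ?F (2 * (b + 2))
        + 2 * fps_nth ?F (2 * (b + 1) + 1) + 2 * fps_nth ?F (2 * (b + 1)) - fps_nth ?F (2 * b + 1) = 0"
      by (rule two)
    then show ?thesis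
      unfolding nth rhs by (simp only: n idx neg if_False)
  qed
qed

text \<open>The local factor of the remaining Dirichlet series: \<open>part_fps k\<close> divided by
  the Euler factors of the three powers of zeta.\<close>

definition rest_fps :: "nat \<Rightarrow> complex fps" where
  "rest_fps k = part_fps k * ((1 - fps_X) ^ 2 * (1 - fps_X ^ 2) ^ 3 * (1 - fps_X ^ 3) ^ 3)"

lemma rest_fps_nth:
  assumes k: "k \<ge> 3"
  shows "fps_nth (rest_fps k) 0 = 1" "0 < j \<Longrightarrow> j < 4 \<Longrightarrow> fps_nth (rest_fps k) j = 0"
proof -
  let ?F = "part_fps k"
  \<comment> \<open>The cofactor of \<open>x ^ 4\<close> in the expanded product. Modulo
    \<open>x ^ 4\<close> there remains 1 - 2 x - 2 x^2 + 3 x^3, which cancels the coefficients 2, 6,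
    13.\<close>
  define R where "R = (\<lambda>x :: complex fps. 6 - 13 * x ^ 2 - 4 * x ^ 3 + 11 * x ^ 4 + 11 * x ^ 5 - 4 * x ^ 6
    - 13 * x ^ 7 + 6 * x ^ 9 + 3 * x ^ 10 - 2 * x ^ 11 - 2 * x ^ 12 + x ^ 13)"
  have id: "(1 - x) ^ 2 * (1 - x ^ 2) ^ 3 * (1 - x ^ 3) ^ 3 =
      1 - 2 * x - 2 * x ^ 2 + 3 * x ^ 3 + x ^ 4 * R x" for x :: "complex fps"
    unfolding R_def by (simp add: eval_nat_numeral algebra_simps)
  have "rest_fps k = ?F - fps_const 2 * (fps_X ^ 1 * ?F) - fps_const 2 * (fps_X ^ 2 * ?F)
      + fps_const 3 * (fps_X ^ 3 * ?F) + fps_X ^ 4 * (R fps_X * ?F)"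
    unfolding rest_fps_def id numeral_fps_const[symmetric] by (simp add: algebra_simps)
  then have nth: "fps_nth (rest_fps k) n = fps_nth ?F n - 2 * (if n < 1 then 0 else fps_nth ?F (n - 1))
      - 2 * (if n < 2 then 0 else fps_nth ?F (n - 2)) + 3 * (if n < 3 then 0 else fps_nth ?F (n - 3))
      + (if n < 4 then 0 else fps_nth (R fps_X * ?F) (n - 4))" for n
    by (simp only: fps_add_nth fps_sub_nth fps_mult_left_const_nth fps_X_power_mult_nth)
  have v: "fps_nth ?F 0 = 1" "fps_nth ?F 1 = 2" "fps_nth ?F 2 = 6" "fps_nth ?F 3 = 13"
    using part_count_small[OF k] by (simp_all add: part_fps_def part_count_0)
  show "fps_nth (rest_fps k) 0 = 1" unfolding nth by (simp add: v)
  assume "0 < j" "j < 4"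
  then have "j = 1 \<or> j = 2 \<or> j = 3" by linarith
  then show "fps_nth (rest_fps k) j = 0" unfolding nth by (elim disjE) (simp_all add: v v[unfolded One_nat_def])
qed

lemma conv_radius_cyclotomic:
  "fps_conv_radius ((1 - fps_X ^ j) ^ m :: complex fps) = \<infinity>"
proof -
  have "(1 - fps_X ^ j :: complex fps) = fps_of_poly (1 - Polynomial.monom 1 j)"
    by (simp add: fps_of_poly_diff fps_of_poly_monom')
  then show ?thesis by (simp only: fps_of_poly_power[symmetric] fps_conv_radius_fps_of_poly)
qed

lemma eval_cyclotomic: "eval_fps ((1 - fps_X ^ j) ^ m :: complex fps) z = (1 - z ^ j) ^ m"
proof -
  have "fps_conv_radius (1 - fps_X ^ j :: complex fps) = \<infinity>" using conv_radius_cyclotomic[of j 1] by simp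
  then show ?thesis by (simp add: eval_fps_power eval_fps_diff)
qed

lemma rest_fps_conv_radius: "fps_conv_radius (rest_fps k) \<ge> 1"
proof -
  let ?P = "(1 - fps_X) ^ 2 * (1 - fps_X ^ 2) ^ 3 * (1 - fps_X ^ 3) ^ 3 :: complex fps"
  have "fps_conv_radius ((1 - fps_X) ^ 2 * (1 - fps_X ^ 2) ^ 3 :: complex fps) \<ge> \<infinity>"
    using fps_conv_radius_mult[of "(1 - fps_X) ^ 2 :: complex fps" "(1 - fps_X ^ 2) ^ 3"]
      conv_radius_cyclotomic[of 1 2, unfolded power_one_right] conv_radius_cyclotomic[of 2 3] by simp
  then have "fps_conv_radius ?P \<ge> \<infinity>"
    using fps_conv_radius_mult[of "(1 - fps_X) ^ 2 * (1 - fps_X ^ 2) ^ 3 :: complex fps" "(1 - fps_X ^ 3) ^ 3"]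
    by (simp add: conv_radius_cyclotomic)
  then have "fps_conv_radius ?P = \<infinity>" by simp
  then show ?thesis
    using fps_conv_radius_mult[of "part_fps k" ?P] part_fps_conv_radius[of k]
    unfolding rest_fps_def by simp
qed

text \<open>The radius bound is carried along so that the factors can be attached one after
  another.\<close>

lemma eval_fps_mult_cyclotomic:
  fixes F :: "complex fps"
  assumes "fps_conv_radius F \<ge> 1" "norm z < 1"
  shows "eval_fps (F * (1 - fps_X ^ j) ^ m) z = eval_fps F z * (1 - z ^ j) ^ m"
    "fps_conv_radius (F * (1 - fps_X ^ j) ^ m) \<ge> 1"
proof -
  have "ereal (norm z) < fps_conv_radius F"
    using assms by (metis ereal_less(3) less_le_trans one_ereal_def less_ereal.simps(1))
  then show "eval_fps (F * (1 - fps_X ^ j) ^ m) z = eval_fps F z * (1 - z ^ j) ^ m"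
    by (simp add: eval_fps_mult conv_radius_cyclotomic eval_cyclotomic)
  show "fps_conv_radius (F * (1 - fps_X ^ j) ^ m) \<ge> 1"
    using fps_conv_radius_mult[of F "(1 - fps_X ^ j) ^ m"] assms(1) by (simp add: conv_radius_cyclotomic)
qed

section \<open>Comparison of the series with products of zeta values\<close>

lemma A_coeff_eq_mult_fun: "n > 0 \<Longrightarrow> A_coeff k n = mult_fun (fps_nth (part_fps k)) n"
  by (simp add: A_sum_eq_prod_part_count mult_fun_def part_fps_def)

lemma Z_series_euler_product:
  assumes "Re s > 1"
  shows "dirichlet_abs_conv (A_coeff k) s"
    "(\<lambda>N. \<Prod>p\<in>primes_le N. eval_fps (part_fps k) (of_nat p powr - s)) \<longlonglongrightarrow> Z_series k s"
proof -
  \<comment> \<open>With \<open>m = 1\<close> there is no vanishing condition on coefficients, and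
    the abscissa is 1.\<close>
  note props = fps_euler_product_props[OF part_fps_conv_radius[of k] part_fps_0[of k], where m = 1 and s = s]
  have "dirichlet_abs_conv (mult_fun (fps_nth (part_fps k))) s" by (rule props(1)) (use assms in auto)
  then show "dirichlet_abs_conv (A_coeff k) s"
    unfolding dirichlet_abs_conv_def by (simp only: A_coeff_eq_mult_fun zero_less_Suc)
  have "Z_series k s = dirichlet_series (mult_fun (fps_nth (part_fps k))) s"
    unfolding Z_series_def dirichlet_series_def by (simp only: A_coeff_eq_mult_fun zero_less_Suc)
  then show "(\<lambda>N. \<Prod>p\<in>primes_le N. eval_fps (part_fps k) (of_nat p powr - s)) \<longlonglongrightarrow> Z_series k s"
    using props(2) assms by simp
qed

text \<open>Rewriting \<open>p powr - (j * s)\<close> as the \<open>j\<close>-th power of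
  \<open>p powr - s\<close> makes all local factors functions of one variable.\<close>

lemma zeta_mult_euler_product:
  assumes "Re s > 1" "j > 0"
  shows "(\<lambda>N. \<Prod>p\<in>primes_le N. 1 / (1 - (of_nat p powr - s) ^ j)) \<longlonglongrightarrow> zeta (of_nat j * s)"
proof -
  have "1 * 1 < real j * Re s" using assms by (intro mult_le_less_imp_less) auto
  then have "(\<lambda>N. \<Prod>p\<in>primes_le N. 1 / (1 - of_nat p powr - (of_nat j * s))) \<longlonglongrightarrow> zeta (of_nat j * s)"
    by (intro zeta_euler_product) simp
  moreover have "(\<Prod>p\<in>primes_le N. 1 / (1 - of_nat p powr - (of_nat j * s))) =
      (\<Prod>p\<in>primes_le N. 1 / (1 - (of_nat p powr - s) ^ j))" for N
    by (rule prod.cong) (auto simp: of_nat_powr_of_nat_mult prime_gt_0_nat)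
  ultimately show ?thesis by simp
qed

lemma one_minus_power_nonzero:
  fixes z :: complex
  assumes "norm z < 1" "j > 0"
  shows "1 - z ^ j \<noteq> 0"
proof
  assume "1 - z ^ j = 0"
  then have "norm z ^ j = 1" by (metis norm_one norm_power right_minus_eq)
  moreover have "norm z ^ j < 1" using assms power_less_one_iff[of "norm z" j] by simp
  ultimately show False by simp
qed

lemma Z_1:
  assumes s: "Re s > 1"
  shows "Z_series 1 s = zeta s ^ 2"
proof -
  have "eval_fps (part_fps 1) z = (1 / (1 - z)) ^ 2" if z: "norm z < 1" for z
  proof -
    have "eval_fps (part_fps 1) z * (1 - z) ^ 2 = 1"
      using eval_fps_mult_cyclotomic(1)[OF part_fps_conv_radius z, of 1 1 2] part_fps_1 by simp
    then show ?thesis using one_minus_power_nonzero[OF z, of 1] by (simp add: field_simps)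
  qed
  then have "(\<Prod>p\<in>primes_le N. eval_fps (part_fps 1) (of_nat p powr - s)) =
      (\<Prod>p\<in>primes_le N. 1 / (1 - of_nat p powr - s)) ^ 2" for N
    unfolding prod_power_distrib using s norm_prime_powr_less_1 by (intro prod.cong) auto
  then have "(\<lambda>N. (\<Prod>p\<in>primes_le N. 1 / (1 - of_nat p powr - s)) ^ 2) \<longlonglongrightarrow> Z_series 1 s"
    using Z_series_euler_product(2)[OF s, of 1] by simp
  moreover have "(\<lambda>N. (\<Prod>p\<in>primes_le N. 1 / (1 - of_nat p powr - s)) ^ 2) \<longlonglongrightarrow> zeta s ^ 2"
    by (intro tendsto_power zeta_euler_product s)
  ultimately show ?thesis by (rule LIMSEQ_unique)
qed

text \<open>The limits are compared after multiplying by the Euler product of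
  \<open>zeta (3 * s)\<close>; the division takes place only at the end, by
  \<open>zeta_nonzero\<close>.\<close>

lemma Z_2:
  assumes s: "Re s > 1"
  shows "Z_series 2 s = zeta s ^ 2 * zeta (2 * s) ^ 3 / zeta (3 * s)"
proof -
  let ?P = "\<lambda>j N. \<Prod>p\<in>primes_le N. 1 / (1 - (of_nat p powr - s) ^ j)"
  have lim: "?P j \<longlonglongrightarrow> zeta (of_nat j * s)" if "j > 0" for j
    using zeta_mult_euler_product[OF s that] .
  have ev: "eval_fps (part_fps 2) z * (1 / (1 - z ^ 3)) = (1 / (1 - z ^ 1)) ^ 2 * (1 / (1 - z ^ 2)) ^ 3"
    if z: "norm z < 1" for z
  proof -
    note e1 = eval_fps_mult_cyclotomic[OF part_fps_conv_radius z, of 2 1 2]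
    have "eval_fps (part_fps 2 * (1 - fps_X ^ 1) ^ 2 * (1 - fps_X ^ 2) ^ 3) z =
        eval_fps (part_fps 2) z * (1 - z ^ 1) ^ 2 * (1 - z ^ 2) ^ 3"
      by (simp only: eval_fps_mult_cyclotomic(1)[OF e1(2) z] e1(1))
    also have "part_fps 2 * (1 - fps_X ^ 1) ^ 2 * (1 - fps_X ^ 2) ^ 3 = (1 - fps_X ^ 3) ^ 1"
      using part_fps_2 by (simp add: mult.assoc)
    finally have "eval_fps (part_fps 2) z * (1 - z ^ 1) ^ 2 * (1 - z ^ 2) ^ 3 = 1 - z ^ 3"
      using eval_cyclotomic[of 3 1 z] by (simp only: power_one_right)
    moreover have "1 - z ^ 1 \<noteq> 0" "1 - z ^ 2 \<noteq> 0" "1 - z ^ 3 \<noteq> 0"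
      by (rule one_minus_power_nonzero[OF z], simp)+
    ultimately show ?thesis by (simp only: power_divide power_one) (simp add: divide_simps mult_ac)
  qed
  have "(\<Prod>p\<in>primes_le N. eval_fps (part_fps 2) (of_nat p powr - s)) * ?P 3 N = ?P 1 N ^ 2 * ?P 2 N ^ 3" for N
    unfolding prod_power_distrib prod.distrib[symmetric]
    using ev s norm_prime_powr_less_1 by (intro prod.cong) auto
  moreover have "(\<lambda>N. (\<Prod>p\<in>primes_le N. eval_fps (part_fps 2) (of_nat p powr - s)) * ?P 3 N) \<longlonglongrightarrow>
      Z_series 2 s * zeta (of_nat 3 * s)"
    by (intro tendsto_mult lim Z_series_euler_product s) simp
  moreover have "(\<lambda>N. ?P 1 N ^ 2 * ?P 2 N ^ 3) \<longlonglongrightarrow> zeta (of_nat 1 * s) ^ 2 * zeta (of_nat 2 * s) ^ 3"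
    by (intro tendsto_mult tendsto_power lim) simp_all
  ultimately have "Z_series 2 s * zeta (of_nat 3 * s) = zeta (of_nat 1 * s) ^ 2 * zeta (of_nat 2 * s) ^ 3"
    using LIMSEQ_unique by auto
  moreover have "zeta (3 * s) \<noteq> 0" using s by (intro zeta_nonzero) simp
  ultimately show ?thesis by (simp add: field_simps)
qed

lemma eval_rest_fps:
  assumes z: "norm z < 1"
  shows "eval_fps (rest_fps k) z = eval_fps (part_fps k) z * (1 - z ^ 1) ^ 2 * (1 - z ^ 2) ^ 3 * (1 - z ^ 3) ^ 3"
proof -
  note e1 = eval_fps_mult_cyclotomic[OF part_fps_conv_radius z, of k 1 2]
  note e2 = eval_fps_mult_cyclotomic[OF e1(2) z, of 2 3]
  note e3 = eval_fps_mult_cyclotomic[OF e2(2) z, of 3 3]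
  have "rest_fps k = part_fps k * (1 - fps_X ^ 1) ^ 2 * (1 - fps_X ^ 2) ^ 3 * (1 - fps_X ^ 3) ^ 3"
    by (simp add: rest_fps_def mult.assoc)
  then show ?thesis by (simp only: e1(1) e2(1) e3(1))
qed

lemma Z_ge_3:
  assumes s: "Re s > 1" and k: "k \<ge> 3"
  shows "Z_series k s = zeta s ^ 2 * zeta (2 * s) ^ 3 * zeta (3 * s) ^ 3 *
    dirichlet_series (mult_fun (fps_nth (rest_fps k))) s"
proof -
  let ?P = "\<lambda>j N. \<Prod>p\<in>primes_le N. 1 / (1 - (of_nat p powr - s) ^ j)"
  let ?R = "\<lambda>N. \<Prod>p\<in>primes_le N. eval_fps (rest_fps k) (of_nat p powr - s)"
  have lim: "?P j \<longlonglongrightarrow> zeta (of_nat j * s)" if "j > 0" for j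
    using zeta_mult_euler_product[OF s that] .
  have ev: "eval_fps (part_fps k) z = (1 / (1 - z ^ 1)) ^ 2 * (1 / (1 - z ^ 2)) ^ 3 * (1 / (1 - z ^ 3)) ^ 3 *
      eval_fps (rest_fps k) z" if z: "norm z < 1" for z
  proof -
    have "1 - z ^ 1 \<noteq> 0" "1 - z ^ 2 \<noteq> 0" "1 - z ^ 3 \<noteq> 0"
      by (rule one_minus_power_nonzero[OF z], simp)+
    then show ?thesis unfolding eval_rest_fps[OF z] by (simp add: power_divide)
  qed
  have "(\<Prod>p\<in>primes_le N. eval_fps (part_fps k) (of_nat p powr - s)) =
      ?P 1 N ^ 2 * ?P 2 N ^ 3 * ?P 3 N ^ 3 * ?R N" for N
    unfolding prod_power_distrib prod.distrib[symmetric]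
    using ev s norm_prime_powr_less_1 by (intro prod.cong) auto
  moreover have "?R \<longlonglongrightarrow> dirichlet_series (mult_fun (fps_nth (rest_fps k))) s"
    by (rule fps_euler_product_props(2)[OF rest_fps_conv_radius rest_fps_nth[OF k]]) (use s in auto)
  then have "(\<lambda>N. ?P 1 N ^ 2 * ?P 2 N ^ 3 * ?P 3 N ^ 3 * ?R N) \<longlonglongrightarrow>
      zeta (of_nat 1 * s) ^ 2 * zeta (of_nat 2 * s) ^ 3 * zeta (of_nat 3 * s) ^ 3 *
        dirichlet_series (mult_fun (fps_nth (rest_fps k))) s"
    by (intro tendsto_mult tendsto_power lim) simp_all
  ultimately show ?thesis
    using Z_series_euler_product(2)[OF s, of k] LIMSEQ_unique by auto
qed

lemma eval_part_fps_nonzero: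
  fixes y :: real
  assumes y: "0 < y" "y < 1"
  shows "eval_fps (part_fps k) (of_real y) \<noteq> 0"
proof -
  have sm: "summable (\<lambda>a. real (part_count k a) * y ^ a)"
  proof (rule summable_comparison_test'[OF summable_poly_times_power[OF y, of "2 * k"]])
    fix n
    have "real (part_count k n) \<le> real ((n + 1) ^ (2 * k))" using part_count_le of_nat_le_iff by blast
    then show "norm (real (part_count k n) * y ^ n) \<le> real (n + 1) ^ (2 * k) * y ^ n"
      using y by (simp add: mult_right_mono)
  qed
  have "eval_fps (part_fps k) (of_real y) = (\<Sum>a. complex_of_real (real (part_count k a) * y ^ a))"
    by (simp add: eval_fps_def part_fps_def)
  also have "\<dots> = complex_of_real (\<Sum>a. real (part_count k a) * y ^ a)" by (rule suminf_of_real[OF sm, symmetric])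
  finally have eq: "eval_fps (part_fps k) (of_real y) = complex_of_real (\<Sum>a. real (part_count k a) * y ^ a)" .
  have "(\<Sum>a. real (part_count k a) * y ^ a) > 0"
    by (rule suminf_pos2[OF sm, of 0]) (use y in \<open>simp_all add: part_count_0\<close>)
  then show ?thesis unfolding eq of_real_eq_0_iff by (rule less_imp_neq[symmetric])
qed

lemma rest_series_nonzero:
  assumes k: "k \<ge> 3" and x: "x > 1 / 4"
  shows "dirichlet_series (mult_fun (fps_nth (rest_fps k))) (complex_of_real x) \<noteq> 0"
proof (rule fps_euler_product_props(3)[OF rest_fps_conv_radius rest_fps_nth[OF k]])
  show "real 4 * Re (complex_of_real x) > 1" using x by simp
  fix p :: nat assume p: "prime p"
  let ?y = "real p powr (- x)"
  have y: "0 < ?y" "?y < 1" using prime_gt_1_nat[OF p] x by (auto simp: powr_less_one)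
  have eq: "of_nat p powr - complex_of_real x = complex_of_real ?y"
    using powr_of_real[of "real p" "- x"] by simp
  then have z: "norm (of_nat p powr - complex_of_real x) < 1" using y by simp
  have "eval_fps (part_fps k) (of_nat p powr - complex_of_real x) \<noteq> 0"
    unfolding eq by (rule eval_part_fps_nonzero[OF y])
  then show "eval_fps (rest_fps k) (of_nat p powr - complex_of_real x) \<noteq> 0"
    unfolding eval_rest_fps[OF z]
    using one_minus_power_nonzero[OF z, of 1] one_minus_power_nonzero[OF z, of 2] one_minus_power_nonzero[OF z, of 3]
    by simp
qed auto

lemma rest_series_abs_conv:
  assumes k: "k \<ge> 3" and s: "Re s > 1 / 4"
  shows "dirichlet_abs_conv (mult_fun (fps_nth (rest_fps k))) s"
  by (rule fps_euler_product_props(1)[OF rest_fps_conv_radius rest_fps_nth[OF k]]) (use s in auto)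

text \<open>In ranks 1 and 2 only zeta occurs, so the continuation is to the whole plane. For
  \<open>k \<ge> 3\<close> it is to \<open>Re s > 1 / 4\<close>, where absolute convergence makes
  the remaining series holomorphic.\<close>

theorem theorem3:
  shows
    "((\<forall>s. Re s > 1 \<longrightarrow> dirichlet_abs_conv (A_coeff 1) s \<and> Z_series 1 s = zeta s ^ 2) \<and>
      (\<lambda>s. zeta s ^ 2) meromorphic_on UNIV)
     \<and>
     ((\<forall>s. Re s > 1 \<longrightarrow> dirichlet_abs_conv (A_coeff 2) s \<and>
          Z_series 2 s = zeta s ^ 2 * zeta (2 * s) ^ 3 / zeta (3 * s)) \<and>
      (\<lambda>s. zeta s ^ 2 * zeta (2 * s) ^ 3 / zeta (3 * s)) meromorphic_on UNIV)
     \<and>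
     (\<forall>k\<ge>3. \<exists>g :: nat \<Rightarrow> complex.
        (\<forall>s. Re s > 1 / 4 \<longrightarrow> dirichlet_abs_conv g s) \<and>
        (\<forall>x::real. x > 1 / 4 \<longrightarrow> dirichlet_series g (complex_of_real x) \<noteq> 0) \<and>
        (\<forall>s. Re s > 1 \<longrightarrow> dirichlet_abs_conv (A_coeff k) s \<and>
          Z_series k s = zeta s ^ 2 * zeta (2 * s) ^ 3 * zeta (3 * s) ^ 3 * dirichlet_series g s) \<and>
        (\<lambda>s. zeta s ^ 2 * zeta (2 * s) ^ 3 * zeta (3 * s) ^ 3 * dirichlet_series g s)
          meromorphic_on {s. Re s > 1 / 4})"
proof (intro conjI allI impI)
  show "dirichlet_abs_conv (A_coeff 1) s" "Z_series 1 s = zeta s ^ 2" if "Re s > 1" for s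
    using Z_series_euler_product(1) Z_1 that by blast+
  show "(\<lambda>s. zeta s ^ 2) meromorphic_on UNIV"
    by (intro meromorphic_intros zeta_meromorphic)
  show "dirichlet_abs_conv (A_coeff 2) s"
    "Z_series 2 s = zeta s ^ 2 * zeta (2 * s) ^ 3 / zeta (3 * s)" if "Re s > 1" for s
    using Z_series_euler_product(1) Z_2 that by blast+
  show "(\<lambda>s. zeta s ^ 2 * zeta (2 * s) ^ 3 / zeta (3 * s)) meromorphic_on UNIV"
    by (intro meromorphic_intros zeta_meromorphic zeta_mult_meromorphic)
next
  fix k :: nat assume k: "k \<ge> 3"
  let ?g = "mult_fun (fps_nth (rest_fps k))"
  let ?H = "{s. Re s > 1 / 4}"
  have "dirichlet_series ?g holomorphic_on ?H"
    by (rule dirichlet_series_holomorphic) (rule rest_series_abs_conv[OF k])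
  then have "dirichlet_series ?g analytic_on ?H"
    by (simp only: analytic_on_open[OF open_halfspace_Re_gt])
  then have "dirichlet_series ?g meromorphic_on ?H" by (rule analytic_on_imp_meromorphic_on)
  then have "(\<lambda>s. zeta s ^ 2 * zeta (2 * s) ^ 3 * zeta (3 * s) ^ 3 * dirichlet_series ?g s) meromorphic_on ?H"
    by (intro meromorphic_on_mult meromorphic_on_power meromorphic_on_subset[OF zeta_meromorphic]
        meromorphic_on_subset[OF zeta_mult_meromorphic] subset_UNIV)
  then show "\<exists>g :: nat \<Rightarrow> complex.
        (\<forall>s. Re s > 1 / 4 \<longrightarrow> dirichlet_abs_conv g s) \<and>
        (\<forall>x::real. x > 1 / 4 \<longrightarrow> dirichlet_series g (complex_of_real x) \<noteq> 0) \<and>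
        (\<forall>s. Re s > 1 \<longrightarrow> dirichlet_abs_conv (A_coeff k) s \<and>
          Z_series k s = zeta s ^ 2 * zeta (2 * s) ^ 3 * zeta (3 * s) ^ 3 * dirichlet_series g s) \<and>
        (\<lambda>s. zeta s ^ 2 * zeta (2 * s) ^ 3 * zeta (3 * s) ^ 3 * dirichlet_series g s)
          meromorphic_on {s. Re s > 1 / 4}"
    using rest_series_abs_conv[OF k] rest_series_nonzero[OF k] Z_series_euler_product(1) Z_ge_3[OF _ k]
    by (intro exI[of _ ?g]) blast
qed

end
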